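(* For any $\lambda,\mu>0$ and $0<T\le\infty$, as $n\to\infty$ the waiting time $W_n$ of the $n$-th served customer converges in distribution to a non-negative random variable $W_T$. Furthermore, the distribution function $F_T$ of $W_T$ satisfies $F_T(x)=0$ for $x<0$, $F_T(x)=1$ for $x>T$, and, for $0\le x\le T$ (for $0\le x<\infty$ if $T=\infty$), $$F_T(x)=\frac{1}{C(T)}\left[\frac1M+\frac{1}{\rho\vee 1}\left(1-\frac1M\right)\int_0^x f_\rho(t)\,dt\right],$$ where $M=M(\lambda,\mu,T)$ (with $1/M=0$ if $M=\infty$), $C(T)$ is the normalization constant (making $F_T$ a probability distribution function), $\rho=\lambda/\mu$, and $$f_\rho(t)=\sqrt{\rho\vee\rho^{-1}}\;\frac1t\;e^{-(\lambda+\mu)t}\,I_1\!\left(2t\sqrt{\lambda\mu}\right),\qquad t>0.$$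
   Context: Single-server queue with impatience. Fix $\lambda,\mu>0$ and $0<T\le\infty$. Let $X_1,X_2,\dots$ be i.i.d. exponential random variables with parameter (rate) $\lambda$, and, independent of them, let $Y_1,Y_2,\dots$ be i.i.d. exponential random variables with parameter $\mu$. Put $S^X_n=\sum_{i=1}^n X_i$. Customer $0$ arrives at time $0$ to an empty system and immediately enters service; customer $n\ge 1$ arrives at time $S^X_n$. There is a single server, serving one customer at a time; $Y_k$ is the service time of the $k$-th service performed. A service in progress is never interrupted. A customer arriving when the server is idle enters service immediately. A customer waiting in the queue whose waiting time (time since arrival, not yet in service) exceeds $T$ leaves the queue without being served (when $T=\infty$ no customer ever leaves unserved). The remaining customers are served in last-in-first-out order: whenever a service is completed, the waiting customer with the shortest current waiting time, if there is one, is served next. For $n\ge 0$, $D_n$ denotes the waiting time of the $n$-th customer: the time from his arrival to the start of his service if he is finally served before his waiting time exceeds $T$, and $D_n=\infty$ otherwise. In particular $D_0=0$. Define $$\tau=\tau(\lambda,\mu,T)=\inf\{n\ge 1: D_n=0\}\quad(\inf\emptyset=\infty),\qquad M=M(\lambda,\mu,T)=\mathbb{E}(\tau)\in[1,\infty].$$ $W_n$ denotes the waiting time (from arrival to start of service) of the $n$-th served customer, i.e. of the customer receiving the $n$-th service; customers who leave unserved are not counted. Notation: $a\vee b=\max(a,b)$, and $I_1$ is the modified Bessel function of the first kind of order $1$, $I_1(t)=\sum_{m=0}^\infty \frac{1}{m!(m+1)!}\left(\frac t2\right)^{2m+1}$. *)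

theory Defs
  imports "HOL-Probability.Probability"
begin

text \<open>
  The queue is described pathwise: \<open>x i\<close> is the \<open>i\<close>-th interarrival time, \<open>y k\<close> the duration of
  the \<open>k\<close>-th service (both indexed from 1), and \<open>T\<close> the patience bound, possibly \<open>\<infinity>\<close>.
\<close>

definition arrival_time :: "(nat \<Rightarrow> real) \<Rightarrow> nat \<Rightarrow> real" where
  "arrival_time x n = (\<Sum>i=1..n. x i)"

text \<open>Customers in the queue at time \<open>t\<close>, when \<open>S\<close> is the set of customers whose service has
  already started.\<close>

definition waiting_customers :: "(nat \<Rightarrow> real) \<Rightarrow> ereal \<Rightarrow> nat set \<Rightarrow> real \<Rightarrow> nat set" where
  "waiting_customers x T S t =
     {n. n \<notin> S \<and> arrival_time x n \<le> t \<and> ereal (t - arrival_time x n) \<le> T}"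

text \<open>
  The customer who receives the next service when the server becomes free at time \<open>t\<close>: the waiting
  one with the shortest current waiting time or, if nobody waits, the first one to arrive after
  \<open>t\<close>.  The outer \<open>Max\<close> only breaks ties between simultaneous arrivals, which have probability 0.
\<close>

definition next_customer :: "(nat \<Rightarrow> real) \<Rightarrow> ereal \<Rightarrow> nat set \<Rightarrow> real \<Rightarrow> nat" where
  "next_customer x T S t =
     (let Q = waiting_customers x T S t
      in if Q = {} then LEAST n. t < arrival_time x n
         else Max {n. is_arg_min (\<lambda>m. t - arrival_time x m) (\<lambda>m. m \<in> Q) n})"

text \<open>
  \<open>server_state x y T k\<close> is the time at which the \<open>k\<close>-th service is completed, together with the
  set of customers who received one of the first \<open>k\<close> services.  The server is free from time 0 on;
  as customer 0 arrives at time 0, he receives the first service.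
\<close>

primrec server_state ::
    "(nat \<Rightarrow> real) \<Rightarrow> (nat \<Rightarrow> real) \<Rightarrow> ereal \<Rightarrow> nat \<Rightarrow> real \<times> nat set" where
  "server_state x y T 0 = (0, {})"
| "server_state x y T (Suc k) =
     (let (t, S) = server_state x y T k; c = next_customer x T S t
      in (max t (arrival_time x c) + y (Suc k), insert c S))"

text \<open>The customer receiving the \<open>k\<close>-th service, and its starting time; meaningful for \<open>k \<ge> 1\<close>.\<close>

definition served_customer ::
    "(nat \<Rightarrow> real) \<Rightarrow> (nat \<Rightarrow> real) \<Rightarrow> ereal \<Rightarrow> nat \<Rightarrow> nat" where
  "served_customer x y T k =
     (case server_state x y T (k - 1) of (t, S) \<Rightarrow> next_customer x T S t)"

definition service_start ::
    "(nat \<Rightarrow> real) \<Rightarrow> (nat \<Rightarrow> real) \<Rightarrow> ereal \<Rightarrow> nat \<Rightarrow> real" where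
  "service_start x y T k =
     max (fst (server_state x y T (k - 1))) (arrival_time x (served_customer x y T k))"

text \<open>\<open>W\<^sub>n\<close>, for \<open>n \<ge> 1\<close>.\<close>

definition served_wait :: "(nat \<Rightarrow> real) \<Rightarrow> (nat \<Rightarrow> real) \<Rightarrow> ereal \<Rightarrow> nat \<Rightarrow> real" where
  "served_wait x y T n = service_start x y T n - arrival_time x (served_customer x y T n)"

text \<open>\<open>D\<^sub>n\<close>, for \<open>n \<ge> 0\<close>.  Almost surely a customer is served at most once, so that \<open>LEAST\<close> picks
  the only possible index.\<close>

definition customer_wait :: "(nat \<Rightarrow> real) \<Rightarrow> (nat \<Rightarrow> real) \<Rightarrow> ereal \<Rightarrow> nat \<Rightarrow> ereal" where
  "customer_wait x y T n =
     (if \<exists>k\<ge>1. served_customer x y T k = n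
      then ereal (served_wait x y T (LEAST k. 1 \<le> k \<and> served_customer x y T k = n))
      else \<infinity>)"

definition tau :: "(nat \<Rightarrow> real) \<Rightarrow> (nat \<Rightarrow> real) \<Rightarrow> ereal \<Rightarrow> enat" where
  "tau x y T = Inf {enat n |n. 1 \<le> n \<and> customer_wait x y T n = 0}"

definition expected_tau ::
    "'a measure \<Rightarrow> (nat \<Rightarrow> 'a \<Rightarrow> real) \<Rightarrow> (nat \<Rightarrow> 'a \<Rightarrow> real) \<Rightarrow> ereal \<Rightarrow> ennreal" where
  "expected_tau P X Y T =
     (\<integral>\<^sup>+\<omega>. ennreal_of_enat (tau (\<lambda>i. X i \<omega>) (\<lambda>k. Y k \<omega>) T) \<partial>P)"

definition bessel_I1 :: "real \<Rightarrow> real" where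
  "bessel_I1 t = (\<Sum>m. 1 / (fact m * fact (m + 1)) * (t / 2) ^ (2 * m + 1))"

definition f_dens :: "real \<Rightarrow> real \<Rightarrow> real \<Rightarrow> real" where
  "f_dens l m t =
     (let \<rho> = l / m
      in sqrt (max \<rho> (inverse \<rho>)) * (1 / t) * exp (- (l + m) * t) * bessel_I1 (2 * t * sqrt (l * m)))"

text \<open>The expression in square brackets in the formula for \<open>F\<^sub>T(x)\<close>, with \<open>p\<close> in place of \<open>1/M\<close>.
  The argument \<open>x\<close> may be \<open>\<infinity>\<close>.\<close>

definition F_bracket :: "real \<Rightarrow> real \<Rightarrow> real \<Rightarrow> ereal \<Rightarrow> real" where
  "F_bracket l m p x = p + 1 / max (l / m) 1 * (1 - p) * (LBINT t=0..x. f_dens l m t)"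

text \<open>The normalization constant \<open>C(T)\<close> is the value at \<open>x = T\<close>, which for \<open>T = \<infinity>\<close> is the limit
  as \<open>x\<close> tends to infinity.\<close>

definition norm_const :: "real \<Rightarrow> real \<Rightarrow> real \<Rightarrow> ereal \<Rightarrow> real" where
  "norm_const l m p T = F_bracket l m p T"

end

theory Submission
  imports Defs
begin

text \<open>
  Cut the idle times of the server out of the time axis.  On the remaining \<^emph>\<open>busy
  clock\<close> the lack of memory of the exponential law turns the queue into a sequence of independent
  events (\<open>race_law\<close>, \<open>event_seq_law\<close>): each event is an arrival with
  probability \<open>l/(l+m)\<close> and otherwise a service completion, and the gaps between events are
  exponential with rate \<open>l+m\<close>.  Since the order of service is last-in-first-out, the
  waiting customers form a stack whose top is youngest, and impatience only ever spoils the bottom part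
  of this stack.  So one may run a stack in which nobody is impatient, and consult the bound
  \<open>T\<close> only at completions: if the top has age at most \<open>T\<close>, it is served and
  its age is its wait; otherwise the server becomes idle and the next customer does not wait
  (\<open>served_wait_event\<close>).

  \<^bold>\<open>The law of the wait.\<close> Let \<open>v k\<close> be the probability that the
  completion number \<open>k\<close>, counted from zero, finds a top of age at most \<open>x\<close>.
  Prepending a completion to the sequence only shifts the count, and prepending an arrival matters only
  for the completion that pops this very customer; this gives a one-term recursion for \<open>v\<close>
  (\<open>kth_hit_recursion\<close>).  The inhomogeneous term is a first passage probability, which is a
  ballot number times an Erlang distribution function (\<open>passage_prob\<close>,
  \<open>weight_ballot\<close>).  Hence \<open>v k\<close> increases to \<open>H x\<close>, the integral
  over \<open>[0,x]\<close> of a density \<open>h\<close> which is a Bessel series: it is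
  \<open>f_dens\<close> times \<open>\<rho>/max \<rho> 1\<close>, \<open>\<rho> = l/m\<close>
  (\<open>kth_hit_prob\<close>, \<open>f_dens_eq\<close>).  The wait therefore converges in law to a
  variable with distribution function \<open>1 - H T + H x\<close> on \<open>[0,T]\<close>, and
  monotonicity in \<open>k\<close> takes the place of a renewal theorem.

  \<^bold>\<open>The mean of\<close> \<open>\<tau>\<close>\<^bold>\<open>.\<close> Let \<open>L\<close>
  be the expected number of events up to the first completion that leaves the server idle.  The
  completions among them, except for the last one, serve customers who arrived during this period, and
  each arrival is served in time with probability \<open>H T/\<rho>\<close>, whatever happened before.
  Counting completions in these two ways gives \<open>m/(l+m) * L = l/(l+m) * H T/\<rho> * L + 1\<close>
  (\<open>cycle_balance\<close>, \<open>cycle_length\<close>), and \<open>M = 1 + l/(l+m) * L = 1 +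
  \<rho>/(1 - H T)\<close>, which is infinite if \<open>H T = 1\<close>.  Hence \<open>1/M = (1 - H
  T)/(1 - H T + \<rho>)\<close>, and with this value the asserted formula becomes \<open>1 - H T + H
  x\<close>.  In the text \<open>H\<close> is called \<open>busy_total\<close>.
\<close>

section \<open>Event sequences on the busy clock\<close>

abbreviation (input) shift :: "nat \<Rightarrow> (nat \<Rightarrow> 'a) \<Rightarrow> nat \<Rightarrow> 'a" where
  "shift k h \<equiv> (\<lambda>j. h (k + j))"

text \<open>
  An event sequence \<open>h\<close> records, for each event, whether it is an arrival (\<open>True\<close>) or a service
  completion (\<open>False\<close>), and how much busy time has passed since the preceding event.
\<close>

definition clock :: "(nat \<Rightarrow> bool \<times> real) \<Rightarrow> nat \<Rightarrow> real" where
  "clock h n = (\<Sum>j<n. snd (h j))"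

text \<open>
  The entries are the indices of arrival events, youngest first.  Customers whose patience is
  exhausted stay in this stack; they are recognized by their age when they come to its top.  Keeping
  them makes the stack depend on the types of the events only.
\<close>

primrec stack :: "(nat \<Rightarrow> bool \<times> real) \<Rightarrow> nat \<Rightarrow> nat list" where
  "stack h 0 = []"
| "stack h (Suc n) = (if fst (h n) then n # stack h n else tl (stack h n))"

primrec completions :: "(nat \<Rightarrow> bool \<times> real) \<Rightarrow> nat \<Rightarrow> nat" where
  "completions h 0 = 0"
| "completions h (Suc n) = (if fst (h n) then completions h n else Suc (completions h n))"

text \<open>
  A completion that finds the top of the stack at an age of at most \<open>x\<close>.  With \<open>x = T\<close> these are the
  completions after which a waiting customer enters service.
\<close>

definition hit :: "ereal \<Rightarrow> (nat \<Rightarrow> bool \<times> real) \<Rightarrow> nat \<Rightarrow> bool" where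
  "hit x h n \<longleftrightarrow> \<not> fst (h n) \<and> stack h n \<noteq> [] \<and>
     ereal (clock h (Suc n) - clock h (Suc (hd (stack h n)))) \<le> x"

definition idles :: "ereal \<Rightarrow> (nat \<Rightarrow> bool \<times> real) \<Rightarrow> nat \<Rightarrow> bool" where
  "idles T h n \<longleftrightarrow> \<not> fst (h n) \<and> \<not> hit T h n"

text \<open>
  No completion before event \<open>n\<close> left the server idle, so that event \<open>n\<close> itself, even if it is an idling
  completion, still belongs to the first busy period.
\<close>

definition in_cycle :: "ereal \<Rightarrow> (nat \<Rightarrow> bool \<times> real) \<Rightarrow> nat \<Rightarrow> bool" where
  "in_cycle T h n \<longleftrightarrow> (\<forall>j<n. \<not> idles T h j)"

text \<open>
  First passage from level \<open>d\<close> to level \<open>0\<close> at exactly the \<open>n\<close>-th event, arrivals going up and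
  completions going down.  With \<open>d = 1\<close> this is the time that a customer just arrived spends in the
  stack: level \<open>d\<close> stands for this customer and \<open>d - 1\<close> younger ones.
\<close>

primrec passage :: "nat \<Rightarrow> nat \<Rightarrow> (nat \<Rightarrow> bool \<times> real) \<Rightarrow> bool" where
  "passage 0 d h \<longleftrightarrow> d = 0"
| "passage (Suc n) d h \<longleftrightarrow>
     0 < d \<and> passage n (if fst (h 0) then Suc d else d - 1) (\<lambda>j. h (Suc j))"

text \<open>
  The customer arriving with event \<open>i\<close> is popped by event \<open>n\<close>, at an age of at most \<open>x\<close>.  The
  conditions after \<open>fst (h i)\<close> concern the events following \<open>i\<close> only, so that they are independent of
  the past.
\<close>

definition pop :: "ereal \<Rightarrow> (nat \<Rightarrow> bool \<times> real) \<Rightarrow> nat \<Rightarrow> nat \<Rightarrow> bool" where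
  "pop x h i n \<longleftrightarrow> i < n \<and> fst (h i) \<and> passage (n - i) 1 (shift (Suc i) h) \<and>
     ereal (clock (shift (Suc i) h) (n - i)) \<le> x"

lemma clock_Suc: "clock h (Suc n) = clock h n + snd (h n)"
  by (simp add: clock_def)

lemma clock_0 [simp]: "clock h 0 = 0"
  by (simp add: clock_def)

lemma clock_add: "clock h (m + n) = clock h m + clock (shift m h) n"
  by (induction n) (simp_all add: clock_Suc)

lemma clock_mono:
  assumes "\<And>j. 0 \<le> snd (h j)" "m \<le> n"
  shows "clock h m \<le> clock h n"
  using assms by (auto simp: clock_def intro!: sum_mono2)

lemma clock_case_nat: "clock (case_nat e h) (Suc n) = snd e + clock h n"
  by (simp add: clock_def lessThan_Suc_eq_insert_0 sum.reindex image_iff)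

lemma clock_cong: "(\<And>j. j < n \<Longrightarrow> h j = h' j) \<Longrightarrow> clock h n = clock h' n"
  by (simp add: clock_def)

lemma stack_cong: "(\<And>j. j < n \<Longrightarrow> h j = h' j) \<Longrightarrow> stack h n = stack h' n"
  by (induction n) simp_all

lemma completions_mono: "m \<le> n \<Longrightarrow> completions h m \<le> completions h n"
  by (rule lift_Suc_mono_le[of "completions h"]) auto

lemma completions_case_nat:
  "completions (case_nat e h) (Suc n) = completions h n + (if fst e then 0 else 1)"
  by (induction n) auto

lemma stack_less: "i \<in> set (stack h n) \<Longrightarrow> i < n \<and> fst (h i)"
  by (induction n) (auto split: if_splits simp: less_Suc_eq dest: list.set_sel(2)[rotated],
      (metis list.set_sel(2) empty_iff list.set(1) tl_Nil)+)

lemma stack_sorted: "sorted_wrt (>) (stack h n)"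
proof (induction n)
  case (Suc n)
  then show ?case
    using stack_less[of _ h n] by (cases "stack h n") auto
qed simp

lemma stack_distinct: "distinct (stack h n)"
proof -
  have "sorted_wrt (>) xs \<Longrightarrow> distinct xs" for xs :: "nat list"
    by (induction xs) auto
  then show ?thesis using stack_sorted by blast
qed

lemma stack_keep: "i \<in> set (stack h n) \<Longrightarrow> i < m \<Longrightarrow> m \<le> n \<Longrightarrow> i \<in> set (stack h m)"
proof (induction n)
  case (Suc n)
  show ?case
  proof (cases "m = Suc n")
    case False
    with Suc.prems have "m \<le> n" by simp
    moreover have "i \<in> set (stack h n)"
      using Suc.prems \<open>m \<le> n\<close>
      by (auto split: if_splits) (metis list.set_sel(2) empty_iff list.set(1) tl_Nil)
    ultimately show ?thesis using Suc by simp
  qed (use Suc in simp)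
qed simp

text \<open>
  Below the last element of \<open>pre\<close> nothing moves until \<open>pre\<close> is used up, and until then the length of
  what is left of \<open>pre\<close>, including later arrivals, is the level of the passage.  An index that has
  left the stack never returns, which is why the condition at time \<open>s + k\<close> alone characterizes the
  first passage.
\<close>

lemma passage_iff_stack:
  assumes "stack h s = pre @ rest" "pre \<noteq> []"
  shows "passage (Suc k) (length pre) (shift s h) \<longleftrightarrow>
     \<not> fst (h (s + k)) \<and> stack h (s + k) \<noteq> [] \<and> hd (stack h (s + k)) = last pre"
  using assms
proof (induction k arbitrary: s pre)
  case 0
  have d: "distinct (pre @ rest)" using 0 stack_distinct[of h s] by simp
  have "hd pre = last pre \<longleftrightarrow> length pre = 1"
    using 0(2) d by (cases pre) (auto dest: last_in_set)
  moreover have "0 < length pre" using 0 by simp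
  ultimately show ?case using 0 by (cases "length pre") auto
next
  case (Suc k)
  have eq: "(\<lambda>j. shift s h (Suc j)) = shift (Suc s) h" by simp
  show ?case
  proof (cases "fst (h s)")
    case True
    then have "stack h (Suc s) = (s # pre) @ rest" using Suc by simp
    from Suc.IH[OF this] True Suc.prems show ?thesis by simp
  next
    case False
    then have st: "stack h (Suc s) = tl pre @ rest" using Suc by simp
    show ?thesis
    proof (cases "tl pre = []")
      case True
      then have pre: "pre = [last pre]" using Suc.prems by (cases pre) auto
      have d: "distinct (stack h s)" by (rule stack_distinct)
      have "last pre \<notin> set rest" using d Suc.prems pre by (metis disjoint_iff distinct_append last_in_set)
      moreover have "last pre < s" using stack_less[of "last pre" h s] Suc.prems by simp
      ultimately have "last pre \<notin> set (stack h (Suc s + k))"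
        using stack_keep[of "last pre" h "Suc s + k" "Suc s"] st True by auto
      then have "\<not> (stack h (s + Suc k) \<noteq> [] \<and> hd (stack h (s + Suc k)) = last pre)"
        by (metis add_Suc_shift hd_in_set)
      moreover have "length pre = 1" using pre by (metis length_Cons list.size(3) One_nat_def)
      ultimately show ?thesis using False by auto
    next
      case tl: False
      have "last (tl pre) = last pre" using tl by (cases pre) auto
      with Suc.IH[OF st tl] False Suc.prems show ?thesis by simp
    qed
  qed
qed

lemma pop_iff_stack:
  "pop x h i n \<longleftrightarrow> \<not> fst (h n) \<and> stack h n \<noteq> [] \<and> hd (stack h n) = i \<and>
     ereal (clock h (Suc n) - clock h (Suc i)) \<le> x"
proof -
  have *: "i < n \<and> fst (h i)" if "stack h n \<noteq> []" "hd (stack h n) = i"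
    using that stack_less[of i h n] by auto
  show ?thesis
  proof (cases "i < n \<and> fst (h i)")
    case True
    then obtain k where n: "n = Suc i + k" using less_iff_Suc_add by auto
    have "stack h (Suc i) = [i] @ stack h i" using True by simp
    from passage_iff_stack[OF this, of k] n True
    have "passage (n - i) 1 (shift (Suc i) h) \<longleftrightarrow>
      \<not> fst (h n) \<and> stack h n \<noteq> [] \<and> hd (stack h n) = i" by (simp add: Suc_diff_le)
    moreover have "clock (shift (Suc i) h) (n - i) = clock h (Suc n) - clock h (Suc i)"
      using clock_add[of h "Suc i" "n - i"] True by simp
    ultimately show ?thesis using True unfolding pop_def by auto
  next
    case False then show ?thesis using * unfolding pop_def by blast
  qed
qed

lemma hit_iff_pop: "hit x h n \<longleftrightarrow> (\<exists>i<n. pop x h i n)"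
  unfolding hit_def pop_iff_stack using stack_less[of "hd (stack h n)" h n] by auto

lemma pop_unique: "pop x h i n \<Longrightarrow> pop x h j n \<Longrightarrow> i = j"
  unfolding pop_iff_stack by simp

text \<open>
  Between the arrival of a customer and the start of his service the server cannot become idle: every
  completion in between serves a customer above him in the stack, who is younger and hence still patient.
\<close>

lemma in_cycle_pop:
  assumes gaps: "\<And>j. 0 \<le> snd (h j)" and p: "pop T h i n"
  shows "in_cycle T h n \<longleftrightarrow> in_cycle T h i"
proof
  assume "in_cycle T h n"
  then show "in_cycle T h i" using p unfolding in_cycle_def pop_def by auto
next
  assume i: "in_cycle T h i"
  have "\<not> idles T h j" if "j < n" for j
  proof (cases "j < i")
    case True then show ?thesis using i unfolding in_cycle_def by simp
  next
    case False
    show ?thesis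
    proof (cases "fst (h j)")
      case True then show ?thesis by (simp add: idles_def)
    next
      case comp: False
      have "i \<noteq> j" using p comp unfolding pop_def by auto
      then have "i < j" using False by simp
      have "i \<in> set (stack h n)" using p unfolding pop_iff_stack by auto
      then have ij: "i \<in> set (stack h j)" using stack_keep[of i h n j] that \<open>i < j\<close> by simp
      then obtain t r where tr: "stack h j = t # r" by (cases "stack h j") auto
      have "i \<le> t" using stack_sorted[of h j] tr ij by auto
      have "clock h (Suc j) - clock h (Suc t) \<le> clock h (Suc n) - clock h (Suc i)"
        using clock_mono[of h "Suc j" "Suc n"] clock_mono[of h "Suc i" "Suc t"] gaps that \<open>i \<le> t\<close>
        by (smt (verit) Suc_le_mono less_imp_le_nat)
      then have "ereal (clock h (Suc j) - clock h (Suc t)) \<le> T"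
        using p unfolding pop_iff_stack by (meson ereal_less_eq(3) order_trans)
      then show ?thesis using tr comp by (simp add: idles_def hit_def)
    qed
  qed
  then show "in_cycle T h n" by (simp add: in_cycle_def)
qed

lemma pop_case_nat_Suc: "pop x (case_nat e h) (Suc i) (Suc n) \<longleftrightarrow> pop x h i n"
  by (simp add: pop_def)

lemma pop_case_nat_0:
  "pop x (case_nat e h) 0 (Suc n) \<longleftrightarrow> fst e \<and> passage (Suc n) 1 h \<and> ereal (clock h (Suc n)) \<le> x"
  by (simp add: pop_def)

lemma hit_case_nat_0: "\<not> hit x h 0"
  by (simp add: hit_def)

text \<open>
  Prepending an event adds one customer who may be popped and otherwise only shifts the indices.
\<close>

lemma hit_case_nat_Suc:
  "hit x (case_nat e h) (Suc n) \<longleftrightarrow>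
     (fst e \<and> passage (Suc n) 1 h \<and> ereal (clock h (Suc n)) \<le> x) \<or> hit x h n"
proof -
  have "hit x (case_nat e h) (Suc n) \<longleftrightarrow>
    pop x (case_nat e h) 0 (Suc n) \<or> (\<exists>i<n. pop x (case_nat e h) (Suc i) (Suc n))"
    unfolding hit_iff_pop by (metis Suc_less_eq less_Suc_eq_0_disj zero_less_Suc)
  then show ?thesis by (simp add: pop_case_nat_Suc pop_case_nat_0 hit_iff_pop)
qed

lemma hit_case_nat_disjoint:
  fixes e :: "bool \<times> real"
  shows "\<not> (fst e \<and> passage (Suc n) 1 h \<and> ereal (clock h (Suc n)) \<le> x \<and> hit x h n)"
  using pop_unique[of x "case_nat e h" 0 "Suc n"] pop_case_nat_0[of x e h n]
    pop_case_nat_Suc[of x e h _ n] unfolding hit_iff_pop by blast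

lemma passage_completions: "passage n d h \<Longrightarrow> n + d = 2 * completions h n"
proof (induction n arbitrary: d h)
  case (Suc n)
  have h: "h = case_nat (h 0) (\<lambda>j. h (Suc j))" by (auto split: nat.split)
  have "completions h (Suc n) = completions (\<lambda>j. h (Suc j)) n + (if fst (h 0) then 0 else 1)"
    using completions_case_nat[of "h 0" "\<lambda>j. h (Suc j)" n] h by simp
  then show ?case using Suc.prems Suc.IH[of "if fst (h 0) then Suc d else d - 1" "\<lambda>j. h (Suc j)"]
    by (cases "fst (h 0)") auto
qed simp

section \<open>Independent events\<close>

lemma suminf_commute_ennreal:
  fixes f :: "nat \<Rightarrow> nat \<Rightarrow> ennreal"
  shows "(\<Sum>n. \<Sum>i. f n i) = (\<Sum>i. \<Sum>n. f n i)"
proof -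
  interpret pair_sigma_finite "count_space (UNIV :: nat set)" "count_space (UNIV :: nat set)"
    by (intro pair_sigma_finite.intro sigma_finite_measure_count_space_countable) auto
  have "(\<integral>\<^sup>+i. \<integral>\<^sup>+n. f n i \<partial>count_space UNIV \<partial>count_space UNIV) =
        (\<integral>\<^sup>+n. \<integral>\<^sup>+i. f n i \<partial>count_space UNIV \<partial>count_space UNIV)"
    using Fubini'[of "\<lambda>n i. f n i"] by (simp add: pair_measure_countable)
  then show ?thesis by (simp add: nn_integral_count_space_nat)
qed

lemma Cauchy_product_ennreal:
  fixes a b :: "nat \<Rightarrow> ennreal"
  shows "(\<Sum>n. \<Sum>i<n. a i * b (n - Suc i)) = (\<Sum>i. a i) * (\<Sum>r. b r)"
proof -
  have "(\<Sum>n. \<Sum>i<n. a i * b (n - Suc i)) = (\<Sum>n. \<Sum>i. if i < n then a i * b (n - Suc i) else 0)"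
    by (intro suminf_cong) (subst suminf_finite[of "{..<_}"], auto)
  also have "\<dots> = (\<Sum>i. \<Sum>n. if i < n then a i * b (n - Suc i) else 0)"
    by (rule suminf_commute_ennreal)
  also have "\<dots> = (\<Sum>i. a i * (\<Sum>r. b r))"
  proof (rule suminf_cong)
    fix i
    have "(\<Sum>n. if i < n then a i * b (n - Suc i) else 0) = (\<Sum>r. a i * b r)"
      by (subst suminf_mono_reindex[of "\<lambda>r. Suc i + r", symmetric])
         (auto simp: strict_mono_def image_iff less_iff_Suc_add)
    then show "(\<Sum>n. if i < n then a i * b (n - Suc i) else 0) = a i * (\<Sum>r. b r)" by simp
  qed
  finally show ?thesis by simp
qed

lemma (in sequence_space) nn_integral_cons:
  assumes [measurable]: "f \<in> borel_measurable S"
  shows "(\<integral>\<^sup>+x. f x \<partial>S) = (\<integral>\<^sup>+a. \<integral>\<^sup>+x. f (case_nat a x) \<partial>S \<partial>M)"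
proof -
  have "(\<integral>\<^sup>+x. f x \<partial>S) = (\<integral>\<^sup>+x. f x \<partial>distr (M \<Otimes>\<^sub>M S) S (\<lambda>(s, \<omega>). case_nat s \<omega>))"
    unfolding PiM_iter ..
  also have "\<dots> = (\<integral>\<^sup>+z. f (case z of (s, \<omega>) \<Rightarrow> case_nat s \<omega>) \<partial>(M \<Otimes>\<^sub>M S))"
    by (subst nn_integral_distr) auto
  also have "\<dots> = (\<integral>\<^sup>+a. \<integral>\<^sup>+x. f (case_nat a x) \<partial>S \<partial>M)"
    by (subst P.nn_integral_fst[symmetric]) auto
  finally show ?thesis .
qed

lemma (in sequence_space) measurable_tail: "(\<lambda>x i. x (Suc i)) \<in> measurable S S"
  by (rule measurable_PiM_single') (auto simp: space_PiM)

locale race =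
  fixes l m :: real
  assumes l_pos: "0 < l" and m_pos: "0 < m"
begin

definition p_arr :: real where "p_arr = l / (l + m)"
definition p_comp :: real where "p_comp = m / (l + m)"

definition gap_law :: "real measure" where
  "gap_law = density lborel (exponential_density (l + m))"

text \<open>
  The winner of a race between two independent exponential times with rates \<open>l\<close> and \<open>m\<close> is the first
  one with probability \<open>l/(l+m)\<close>, and the winning time is exponential with rate \<open>l+m\<close> and independent
  of the winner.
\<close>

definition event_law :: "(bool \<times> real) measure" where
  "event_law = measure_pmf (bernoulli_pmf p_arr) \<Otimes>\<^sub>M gap_law"

lemma p_arr_comp: "p_arr + p_comp = 1" "1 - p_arr = p_comp"
  using l_pos m_pos by (simp_all add: p_arr_def p_comp_def add_divide_distrib[symmetric] field_simps)

lemma p_arr_pos: "0 < p_arr" "p_arr < 1" and p_comp_pos: "0 < p_comp"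
  using l_pos m_pos by (auto simp: p_arr_def p_comp_def field_simps)

lemma space_gap_law [simp]: "space gap_law = UNIV"
  and sets_gap_law [measurable_cong, simp]: "sets gap_law = sets borel"
  by (simp_all add: gap_law_def)

lemma prob_space_gap_law: "prob_space gap_law"
  unfolding gap_law_def using l_pos m_pos by (intro prob_space_exponential_density) simp

sublocale gap: prob_space gap_law by (rule prob_space_gap_law)

lemma space_event_law [simp]: "space event_law = UNIV"
  by (simp add: event_law_def space_pair_measure)

lemma sets_event_law [measurable_cong]: "sets event_law = sets (count_space UNIV \<Otimes>\<^sub>M borel)"
  unfolding event_law_def by (intro sets_pair_measure_cong) auto

lemma prob_space_event_law: "prob_space event_law"
proof -
  interpret pair_prob_space "measure_pmf (bernoulli_pmf p_arr)" gap_law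
    by standard
  show ?thesis unfolding event_law_def by (rule P.prob_space_axioms)
qed

sublocale sequence_space event_law
  by (intro sequence_space.intro product_prob_spaceI prob_space_event_law)

lemma nn_integral_event_law:
  assumes [measurable]: "f \<in> borel_measurable (count_space UNIV \<Otimes>\<^sub>M borel)"
  shows "(\<integral>\<^sup>+e. f e \<partial>event_law) =
    ennreal p_arr * (\<integral>\<^sup>+g. f (True, g) \<partial>gap_law) + ennreal p_comp * (\<integral>\<^sup>+g. f (False, g) \<partial>gap_law)"
proof -
  have f: "f \<in> borel_measurable (measure_pmf (bernoulli_pmf p_arr) \<Otimes>\<^sub>M gap_law)"
    using assms measurable_cong_sets[OF sets_event_law refl] unfolding event_law_def by blast
  have "(\<integral>\<^sup>+e. f e \<partial>event_law) = (\<integral>\<^sup>+b. \<integral>\<^sup>+g. f (b, g) \<partial>gap_law \<partial>measure_pmf (bernoulli_pmf p_arr))"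
    unfolding event_law_def using gap.nn_integral_fst[OF f] by simp
  also have "\<dots> = ennreal p_arr * (\<integral>\<^sup>+g. f (True, g) \<partial>gap_law) + ennreal p_comp * (\<integral>\<^sup>+g. f (False, g) \<partial>gap_law)"
    using p_arr_pos p_arr_comp by (subst nn_integral_bernoulli_pmf) (auto simp: mult.commute)
  finally show ?thesis .
qed

lemma space_S [simp]: "space S = UNIV"
  by (simp add: space_PiM)

text \<open>
  Probabilities are taken in the extended nonnegative reals, where series of them can be rearranged
  and the expected length of a busy period, which may be infinite, can be written as such a series.
\<close>

definition pr :: "((nat \<Rightarrow> bool \<times> real) \<Rightarrow> bool) \<Rightarrow> ennreal" where
  "pr A = emeasure S {h. A h}"

lemma pr_eq_nn_integral: "Measurable.pred S A \<Longrightarrow> pr A = (\<integral>\<^sup>+h. indicator {h. A h} h \<partial>S)"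
  by (auto simp: pr_def pred_def)

lemma pr_le_1: "pr A \<le> 1"
  unfolding pr_def by (metis emeasure_space P.emeasure_space_1)

lemma pr_True: "pr (\<lambda>h. True) = 1"
  using P.emeasure_space_1 by (simp add: pr_def)

lemma pr_disj:
  assumes [measurable]: "Measurable.pred S A" "Measurable.pred S B" and "\<And>h. \<not> (A h \<and> B h)"
  shows "pr (\<lambda>h. A h \<or> B h) = pr A + pr B"
proof -
  have "{h. A h \<or> B h} = {h. A h} \<union> {h. B h}" by auto
  then show ?thesis unfolding pr_def using assms
    by (subst plus_emeasure) (auto simp: pred_def)
qed

lemma pr_suminf:
  assumes [measurable]: "\<And>n. Measurable.pred S (A n)" and "\<And>h i j. A i h \<Longrightarrow> A j h \<Longrightarrow> i = (j :: nat)"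
  shows "pr (\<lambda>h. \<exists>n. A n h) = (\<Sum>n. pr (A n))"
proof -
  have "{h. \<exists>n. A n h} = (\<Union>n. {h. A n h})" by auto
  then show ?thesis unfolding pr_def using assms
    by (subst suminf_emeasure) (auto simp: pred_def disjoint_family_on_def)
qed

lemma measurable_event_fst [measurable]: "(\<lambda>h. fst (h n)) \<in> measurable S (count_space UNIV)"
proof -
  have "fst \<in> measurable event_law (count_space UNIV)" by measurable
  moreover have "(\<lambda>h. h n) \<in> measurable S event_law" by measurable
  ultimately show ?thesis by (rule measurable_compose[rotated])
qed

lemma measurable_event_snd [measurable]: "(\<lambda>h. snd (h n)) \<in> borel_measurable S"
proof -
  have "snd \<in> borel_measurable event_law" by measurable
  moreover have "(\<lambda>h. h n) \<in> measurable S event_law" by measurable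
  ultimately show ?thesis by (rule measurable_compose[rotated])
qed

lemma measurable_clock [measurable]: "(\<lambda>h. clock h n) \<in> borel_measurable S"
  unfolding clock_def by measurable

lemma measurable_stack [measurable]: "(\<lambda>h. stack h n) \<in> measurable S (count_space UNIV)"
proof (induction n)
  case (Suc n)
  note [measurable] = Suc
  show ?case unfolding stack.simps by measurable
qed simp

lemma measurable_completions [measurable]:
  "(\<lambda>h. completions h n) \<in> measurable S (count_space UNIV)"
proof (induction n)
  case (Suc n)
  note [measurable] = Suc
  show ?case unfolding completions.simps by measurable
qed simp

lemma measurable_hit [measurable]: "Measurable.pred S (\<lambda>h. hit x h n)"
proof -
  have [measurable]: "(\<lambda>h. clock h (Suc (hd (stack h n)))) \<in> borel_measurable S"
    by (rule measurable_compose_countable[where f="\<lambda>i h. clock h (Suc i)"]) measurable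
  show ?thesis unfolding hit_def by measurable
qed

lemma measurable_idles [measurable]: "Measurable.pred S (\<lambda>h. idles T h n)"
  unfolding idles_def by measurable

lemma measurable_in_cycle [measurable]: "Measurable.pred S (\<lambda>h. in_cycle T h n)"
  unfolding in_cycle_def by measurable

lemma measurable_shift [measurable]: "(\<lambda>h. shift k h) \<in> measurable S S"
  by (rule measurable_PiM_single') (auto simp: space_PiM)

lemma measurable_shift_Suc [measurable]: "(\<lambda>h j. h (Suc j)) \<in> measurable S S"
  using measurable_shift[of 1] by simp

lemma measurable_passage [measurable]: "Measurable.pred S (passage n d)"
proof (induction n arbitrary: d)
  case (Suc n)
  have [measurable]: "Measurable.pred S (\<lambda>h. passage n d (\<lambda>j. h (Suc j)))" for d
    using measurable_compose[OF measurable_shift_Suc Suc] .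
  have *: "passage (Suc n) d h \<longleftrightarrow> 0 < d \<and> (fst (h 0) \<and> passage n (Suc d) (\<lambda>j. h (Suc j)) \<or>
      \<not> fst (h 0) \<and> passage n (d - 1) (\<lambda>j. h (Suc j)))" for h :: "nat \<Rightarrow> bool \<times> real"
    by simp
  show ?case unfolding * by measurable
next
  case 0
  have "passage 0 d = (\<lambda>h. d = 0)" by (simp add: fun_eq_iff)
  then show ?case by simp
qed

lemma measurable_pop [measurable]: "Measurable.pred S (\<lambda>h. pop x h i n)"
proof -
  have [measurable]: "Measurable.pred S (\<lambda>h. passage k d (\<lambda>j. h (Suc i + j)))" for k d
    using measurable_compose[OF measurable_shift measurable_passage, of k d "Suc i"] .
  have [measurable]: "(\<lambda>h. clock (\<lambda>j. h (Suc i + j)) k) \<in> borel_measurable S" for k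
    using measurable_compose[OF measurable_shift measurable_clock, of "Suc i" k] .
  show ?thesis unfolding pop_def by measurable
qed

lemma pr_first_event:
  assumes A [measurable]: "Measurable.pred S A"
  shows "pr A = ennreal p_arr * (\<integral>\<^sup>+g. pr (\<lambda>h. A (case_nat (True, g) h)) \<partial>gap_law)
              + ennreal p_comp * (\<integral>\<^sup>+g. pr (\<lambda>h. A (case_nat (False, g) h)) \<partial>gap_law)"
proof -
  have cn [measurable]: "(\<lambda>(s, \<omega>). case_nat s \<omega>) \<in> measurable (event_law \<Otimes>\<^sub>M S) S"
    by measurable
  have ind [measurable]: "(indicator {h. A h} :: _ \<Rightarrow> ennreal) \<in> borel_measurable S"
    using A by (auto simp: pred_def)
  have sec: "Measurable.pred S (\<lambda>h. A (case_nat e h))" for e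
    using measurable_compose[OF _ A, of "\<lambda>h. case_nat e h" S]
      measurable_compose[OF measurable_Pair1'[of e event_law S] cn] by simp
  have m1: "(\<lambda>z. indicator {h. A h} (case z of (s, \<omega>) \<Rightarrow> case_nat s \<omega>) :: ennreal) \<in> borel_measurable (event_law \<Otimes>\<^sub>M S)"
    by measurable
  have "pr A = (\<integral>\<^sup>+h. indicator {h. A h} h \<partial>distr (event_law \<Otimes>\<^sub>M S) S (\<lambda>(s, \<omega>). case_nat s \<omega>))"
    unfolding PiM_iter by (rule pr_eq_nn_integral) measurable
  also have "\<dots> = (\<integral>\<^sup>+z. indicator {h. A h} (case z of (s, \<omega>) \<Rightarrow> case_nat s \<omega>) \<partial>(event_law \<Otimes>\<^sub>M S))"
    by (subst nn_integral_distr) auto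
  also have "\<dots> = (\<integral>\<^sup>+e. \<integral>\<^sup>+h. indicator {h. A h} (case_nat e h) \<partial>S \<partial>event_law)"
    using P.nn_integral_fst[OF m1] by simp
  also have "\<dots> = (\<integral>\<^sup>+e. pr (\<lambda>h. A (case_nat e h)) \<partial>event_law)"
    by (intro nn_integral_cong) (simp add: pr_eq_nn_integral[OF sec] indicator_def)
  also have "\<dots> = ennreal p_arr * (\<integral>\<^sup>+g. pr (\<lambda>h. A (case_nat (True, g) h)) \<partial>gap_law)
              + ennreal p_comp * (\<integral>\<^sup>+g. pr (\<lambda>h. A (case_nat (False, g) h)) \<partial>gap_law)"
  proof (rule nn_integral_event_law)
    have "(\<lambda>e. \<integral>\<^sup>+h. indicator {h. A h} (case_nat e h) \<partial>S) \<in> borel_measurable event_law"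
      using P.borel_measurable_nn_integral_fst[OF m1] by simp
    also have "(\<lambda>e. \<integral>\<^sup>+h. indicator {h. A h} (case_nat e h) \<partial>S) = (\<lambda>e. pr (\<lambda>h. A (case_nat e h)))"
      by (simp add: fun_eq_iff pr_eq_nn_integral[OF sec] indicator_def)
    finally show "(\<lambda>e. pr (\<lambda>h. A (case_nat e h))) \<in> borel_measurable (count_space UNIV \<Otimes>\<^sub>M borel)"
      using measurable_cong_sets[OF sets_event_law refl] by blast
  qed
  finally show ?thesis .
qed

lemma pr_past_future:
  assumes A [measurable]: "Measurable.pred S A" and B [measurable]: "Measurable.pred S B"
    and local: "\<And>h h'. (\<And>j. j < n \<Longrightarrow> h j = h' j) \<Longrightarrow> A h \<longleftrightarrow> A h'"
  shows "pr (\<lambda>h. A h \<and> B (shift n h)) = pr A * pr B"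
proof -
  let ?c = "\<lambda>(\<omega>, \<omega>'). comb_seq n \<omega> \<omega>'"
  have "Measurable.pred S (\<lambda>h. B (shift n h))"
    using measurable_compose[OF measurable_shift B] .
  with A have "Measurable.pred S (\<lambda>h. A h \<and> B (shift n h))" by (rule pred_intros_logic)
  then have AB: "{h. A h \<and> B (shift n h)} \<in> sets S" by (simp add: pred_def)
  have c: "A (comb_seq n h h') \<longleftrightarrow> A h" "shift n (comb_seq n h h') = h'" for h h'
    by (auto simp: comb_seq_less comb_seq_def intro!: local)
  have "pr (\<lambda>h. A h \<and> B (shift n h)) = emeasure (distr (S \<Otimes>\<^sub>M S) S ?c) {h. A h \<and> B (shift n h)}"
    unfolding PiM_comb_seq pr_def ..
  also have "\<dots> = emeasure (S \<Otimes>\<^sub>M S) ({h. A h} \<times> {h. B h})"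
    using AB by (subst emeasure_distr[OF measurable_comb_seq])
      (auto simp: c space_pair_measure intro!: arg_cong2[where f=emeasure])
  also have "\<dots> = pr A * pr B"
    unfolding pr_def using A B by (intro P.emeasure_pair_measure_Times) (auto simp: pred_def)
  finally show ?thesis .
qed

end

section \<open>First passages and the law of a positive wait\<close>

lemma suminf_ennreal_le_limit:
  fixes f :: "nat \<Rightarrow> ennreal"
  assumes "\<And>K. (\<Sum>n<K. f n) \<le> c" shows "(\<Sum>n. f n) \<le> c"
  using assms by (rule suminf_le_const[OF summableI])

context race
begin

text \<open>
  The probability that the types of \<open>n\<close> successive events form a first passage from level \<open>d\<close>.
\<close>

primrec weight :: "nat \<Rightarrow> nat \<Rightarrow> real" where
  "weight 0 d = (if d = 0 then 1 else 0)"
| "weight (Suc n) d = (if d = 0 then 0 else p_arr * weight n (Suc d) + p_comp * weight n (d - 1))"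

lemma weight_nonneg: "0 \<le> weight n d"
  using p_arr_pos p_comp_pos by (induction n arbitrary: d) auto

lemma weight_0: "weight n 0 = (if n = 0 then 1 else 0)"
  by (cases n) auto

text \<open>
  The hitting time theorem: of the paths with \<open>a\<close> steps up and \<open>a + d\<close> steps down, the proportion
  \<open>d/(d + 2 * a)\<close> reaches level \<open>0\<close> for the first time at the end.  The closed form satisfies the
  first-step recursion of the weights.
\<close>

lemma weight_ballot:
  "0 < d \<Longrightarrow> d + 2 * a = n \<Longrightarrow>
    weight n d = real d * fact (n - 1) / (fact a * fact (a + d)) * p_arr ^ a * p_comp ^ (a + d)"
proof (induction n arbitrary: d a)
  case 0
  then show ?case by simp
next
  case (Suc n)
  obtain d' where d: "d = Suc d'" using Suc.prems by (cases d) auto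
  have n: "n = d' + 2 * a" using Suc.prems d by simp
  \<comment> \<open>stated with the common denominator of the result; it vanishes for \<open>a = 0\<close>\<close>
  have left: "p_arr * weight n (Suc d) =
    real a * (real d + 1) * fact (n - 1) / (fact a * fact (a + d)) * p_arr ^ a * p_comp ^ (a + d)"
  proof (cases a)
    case 0
    have "weight k e = 0" if "k < e" for k e
      using that by (induction k arbitrary: e) auto
    then show ?thesis using 0 n d by simp
  next
    case (Suc a')
    have e: "a' + Suc d = a + d" and a: "real a \<noteq> 0" "fact a = real a * fact a'" "p_arr ^ a = p_arr * p_arr ^ a'"
      using \<open>a = Suc a'\<close> by simp_all
    have "weight n (Suc d) = real (Suc d) * fact (n - 1) / (fact a' * fact (a + d)) * p_arr ^ a' * p_comp ^ (a + d)"
      using Suc.IH[of "Suc d" a', unfolded e] n d \<open>a = Suc a'\<close> by simp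
    moreover have "fact (a + d) \<noteq> (0 :: real)" "fact a' \<noteq> (0 :: real)" by simp_all
    ultimately show ?thesis unfolding a(2,3) using a(1) by (simp add: divide_simps)
  qed
  have right: "p_comp * weight n (d - 1) =
    real d' * (real a + real d) * fact (n - 1) / (fact a * fact (a + d)) * p_arr ^ a * p_comp ^ (a + d)" if "0 < n"
  proof (cases d')
    case 0
    then show ?thesis using d that by (simp add: weight_0)
  next
    case (Suc d'')
    have "weight n d' = real d' * fact (n - 1) / (fact a * fact (a + d')) * p_arr ^ a * p_comp ^ (a + d')"
      using Suc.IH[of d' a] n Suc by simp
    moreover have "fact (a + d) = (real a + real d) * fact (a + d')" "p_comp ^ (a + d) = p_comp * p_comp ^ (a + d')"
      "real a + real d \<noteq> 0" "fact (a + d') \<noteq> (0 :: real)" "fact a \<noteq> (0 :: real)" "d - 1 = d'"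
      using d by simp_all
    ultimately show ?thesis by (simp add: divide_simps)
  qed
  show ?case
  proof (cases "n = 0")
    case True
    then show ?thesis using d n by simp
  next
    case False
    then obtain k where k: "n = Suc k" by (cases n) auto
    have "weight (Suc n) d = p_arr * weight n (Suc d) + p_comp * weight n (d - 1)" using d by simp
    also have "\<dots> = (real a * (real d + 1) + real d' * (real a + real d)) * fact (n - 1)
        / (fact a * fact (a + d)) * p_arr ^ a * p_comp ^ (a + d)"
      using left right False by (simp add: add_divide_distrib distrib_right)
    also have "real a * (real d + 1) + real d' * (real a + real d) = real d * real n"
      using d n by (simp add: field_simps)
    finally show ?thesis using k by (simp add: field_simps)
  qed
qed

lemma weight_Catalan:
  "weight (Suc (2 * j)) 1 = fact (2 * j) / (fact j * fact (Suc j)) * p_arr ^ j * p_comp ^ Suc j"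
  using weight_ballot[of 1 j "Suc (2 * j)"] by simp

text \<open>
  The probability that the sum of \<open>n\<close> gaps is at most \<open>x\<close>.
\<close>

primrec gap_sum_mass :: "nat \<Rightarrow> ereal \<Rightarrow> ennreal" where
  "gap_sum_mass 0 x = indicator {0..} x"
| "gap_sum_mass (Suc n) x =
     (\<integral>\<^sup>+t. ennreal (erlang_density n (l + m) t) * indicator {t. ereal t \<le> x} t \<partial>lborel)"

lemma nn_integral_gap_law:
  "f \<in> borel_measurable borel \<Longrightarrow>
    (\<integral>\<^sup>+g. f g \<partial>gap_law) = (\<integral>\<^sup>+g. ennreal (erlang_density 0 (l + m) g) * f g \<partial>lborel)"
  unfolding gap_law_def by (subst nn_integral_density) auto

lemma gap_sum_mass_Suc:
  "(\<integral>\<^sup>+g. gap_sum_mass n (x - ereal g) \<partial>gap_law) = gap_sum_mass (Suc n) x"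
proof (cases n)
  case 0
  have "(\<integral>\<^sup>+g. gap_sum_mass 0 (x - ereal g) \<partial>gap_law) = (\<integral>\<^sup>+g. indicator {t. ereal t \<le> x} g \<partial>gap_law)"
    by (intro nn_integral_cong) (cases x; auto simp: indicator_def)
  then show ?thesis using 0 by (subst (asm) nn_integral_gap_law) auto
next
  case (Suc k)
  let ?e = "\<lambda>n t. ennreal (erlang_density n (l + m) t)"
  have "(\<integral>\<^sup>+g. gap_sum_mass n (x - ereal g) \<partial>gap_law)
      = (\<integral>\<^sup>+g. (\<integral>\<^sup>+s. ?e k (s - g) * indicator {s. ereal s \<le> x} s \<partial>lborel) \<partial>gap_law)"
  proof (intro nn_integral_cong)
    fix g :: real
    show "gap_sum_mass n (x - ereal g) = (\<integral>\<^sup>+s. ?e k (s - g) * indicator {s. ereal s \<le> x} s \<partial>lborel)"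
      unfolding Suc gap_sum_mass.simps
      by (subst nn_integral_real_affine[of _ 1 "-g"])
        (auto intro!: nn_integral_cong simp: indicator_def, (cases x; auto)+)
  qed
  also have "\<dots> = (\<integral>\<^sup>+g. (\<integral>\<^sup>+s. ?e 0 g * (?e k (s - g) * indicator {s. ereal s \<le> x} s) \<partial>lborel) \<partial>lborel)"
    by (subst nn_integral_gap_law) (auto simp: nn_integral_cmult)
  also have "\<dots> = (\<integral>\<^sup>+s. (\<integral>\<^sup>+g. ?e 0 g * (?e k (s - g) * indicator {s. ereal s \<le> x} s) \<partial>lborel) \<partial>lborel)"
    by (rule lborel_pair.Fubini'[symmetric]) measurable
  also have "\<dots> = (\<integral>\<^sup>+s. (\<integral>\<^sup>+g. ?e k (s - g) * ?e 0 g \<partial>lborel) * indicator {s. ereal s \<le> x} s \<partial>lborel)"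
    by (intro nn_integral_cong) (subst nn_integral_multc[symmetric], auto simp: ac_simps)
  also have "\<dots> = gap_sum_mass (Suc n) x"
    using convolution_erlang_density[of "l + m" k 0, THEN fun_cong] l_pos m_pos Suc by simp
  finally show ?thesis .
qed

text \<open>
  Types and gaps are independent, so the probability is a product.  The proof avoids conditioning on
  the types: splitting off the first event, both sides satisfy the same recursion.
\<close>

lemma passage_prob:
  "pr (\<lambda>h. passage n d h \<and> ereal (clock h n) \<le> x) = ennreal (weight n d) * gap_sum_mass n x"
proof (induction n arbitrary: d x)
  case 0
  show ?case
    by (cases "d = 0"; cases "0 \<le> x") (simp_all add: pr_True zero_ereal_def[symmetric], simp_all add: pr_def)
next
  case (Suc n)
  show ?case
  proof (cases "d = 0")
    case True
    then show ?thesis by (simp add: pr_def)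
  next
    case False
    have c: "ereal (g + c) \<le> x \<longleftrightarrow> ereal c \<le> x - ereal g" for g c
      by (cases x) auto
    have m: "(\<lambda>g. gap_sum_mass n (x - ereal g)) \<in> borel_measurable gap_law"
      by (cases n) (simp_all add: indicator_def)
    have "pr (\<lambda>h. passage (Suc n) d h \<and> ereal (clock h (Suc n)) \<le> x)
      = ennreal p_arr * (\<integral>\<^sup>+g. pr (\<lambda>h. passage n (Suc d) h \<and> ereal (clock h n) \<le> x - ereal g) \<partial>gap_law)
      + ennreal p_comp * (\<integral>\<^sup>+g. pr (\<lambda>h. passage n (d - 1) h \<and> ereal (clock h n) \<le> x - ereal g) \<partial>gap_law)"
      using False by (subst pr_first_event) (simp_all add: clock_case_nat c)
    also have "\<dots> = ennreal p_arr * (ennreal (weight n (Suc d)) * gap_sum_mass (Suc n) x)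
      + ennreal p_comp * (ennreal (weight n (d - 1)) * gap_sum_mass (Suc n) x)"
      unfolding Suc using m by (simp add: nn_integral_cmult gap_sum_mass_Suc del: gap_sum_mass.simps)
    also have "\<dots> = (ennreal p_arr * ennreal (weight n (Suc d)) + ennreal p_comp * ennreal (weight n (d - 1))) * gap_sum_mass (Suc n) x"
      by (simp only: distrib_right mult.assoc)
    also have "ennreal p_arr * ennreal (weight n (Suc d)) + ennreal p_comp * ennreal (weight n (d - 1)) = ennreal (weight (Suc n) d)"
      using False weight_nonneg p_arr_pos p_comp_pos
      by (simp add: ennreal_mult'[symmetric] ennreal_plus[symmetric] del: ennreal_plus)
    finally show ?thesis .
  qed
qed

text \<open>
  The density of the event that a customer is popped after a passage with \<open>j\<close> later arrivals, multiplied
  by \<open>l/m\<close>; here \<open>t\<close> is his age.  The factor \<open>l/m\<close> is the mean number of arrivals during one service.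
\<close>

definition busy_term :: "nat \<Rightarrow> real \<Rightarrow> real" where
  "busy_term j t = (if t < 0 then 0 else
     l ^ Suc j * m ^ j * t ^ (2 * j) / (fact j * fact (Suc j)) * exp (- (l + m) * t))"

lemma busy_term_nonneg: "0 \<le> busy_term j t"
  using l_pos m_pos by (simp add: busy_term_def)

lemma measurable_busy_term [measurable]: "busy_term j \<in> borel_measurable borel"
  unfolding busy_term_def[abs_def] by measurable

lemma erlang_eq_busy_term:
  "p_arr * (weight (Suc (2 * j)) 1 * erlang_density (2 * j) (l + m) t) = p_comp * busy_term j t"
proof -
  let ?q = "l + m"
  have l: "l = p_arr * ?q" and m: "m = p_comp * ?q" using l_pos m_pos by (simp_all add: p_arr_def p_comp_def)
  have "l ^ Suc j * m ^ j = p_arr ^ Suc j * p_comp ^ j * ?q ^ Suc (2 * j)"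
    by (subst l, subst m) (simp add: power_mult_distrib mult_2 power_add mult.assoc mult.left_commute)
  then show ?thesis
    unfolding weight_Catalan busy_term_def erlang_density_def by (simp del: fact_Suc)
qed

definition passage_prob_at :: "ereal \<Rightarrow> nat \<Rightarrow> ennreal" where
  "passage_prob_at x r = pr (\<lambda>h. passage (Suc r) 1 h \<and> ereal (clock h (Suc r)) \<le> x)"

definition busy_mass :: "ereal \<Rightarrow> nat \<Rightarrow> ennreal" where
  "busy_mass x j = (\<integral>\<^sup>+t. ennreal (busy_term j t) * indicator {t. ereal t \<le> x} t \<partial>lborel)"

lemma passage_prob_even: "ennreal p_arr * passage_prob_at x (2 * j) = ennreal p_comp * busy_mass x j"
proof -
  have "ennreal p_arr * passage_prob_at x (2 * j) = (\<integral>\<^sup>+t. ennreal p_arr * (ennreal (weight (Suc (2 * j)) 1) *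
      (ennreal (erlang_density (2 * j) (l + m) t) * indicator {t. ereal t \<le> x} t)) \<partial>lborel)"
    unfolding passage_prob_at_def passage_prob by (simp add: nn_integral_cmult del: weight.simps)
  also have "\<dots> = (\<integral>\<^sup>+t. ennreal p_comp * (ennreal (busy_term j t) * indicator {t. ereal t \<le> x} t) \<partial>lborel)"
    using erlang_eq_busy_term[of j] p_arr_pos p_comp_pos weight_nonneg l_pos m_pos busy_term_nonneg
    by (intro nn_integral_cong) (simp add: mult.assoc[symmetric] ennreal_mult[symmetric] del: weight.simps)
  also have "\<dots> = ennreal p_comp * busy_mass x j"
    unfolding busy_mass_def by (simp add: nn_integral_cmult)
  finally show ?thesis .
qed

lemma passage_prob_odd: "odd r \<Longrightarrow> passage_prob_at x r = 0"
proof -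
  assume "odd r"
  then have "\<not> passage (Suc r) 1 h" for h
    using passage_completions[of "Suc r" 1 h] by (metis add_Suc_right Suc_eq_plus1 dvd_triv_left even_Suc)
  then show ?thesis by (simp add: passage_prob_at_def pr_def)
qed

lemma suminf_passage_prob: "ennreal p_arr * (\<Sum>r. passage_prob_at x r) = ennreal p_comp * (\<Sum>j. busy_mass x j)"
proof -
  have "(\<Sum>r. passage_prob_at x r) = (\<Sum>j. passage_prob_at x (2 * j))"
    by (rule suminf_mono_reindex[symmetric]) (auto simp: strict_mono_def image_iff intro!: passage_prob_odd elim: evenE)
  then show ?thesis
    by (simp add: ennreal_suminf_cmult[symmetric] passage_prob_even del: ennreal_suminf_cmult)
qed

text \<open>
  At the completion with \<open>completions h n = k\<close> exactly \<open>k\<close> completions precede, so \<open>k\<close> counts from \<open>0\<close>.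
\<close>

definition kth_hit :: "ereal \<Rightarrow> nat \<Rightarrow> (nat \<Rightarrow> bool \<times> real) \<Rightarrow> bool" where
  "kth_hit x k h \<longleftrightarrow> (\<exists>n. hit x h n \<and> completions h n = k)"

lemma passage_last: "passage (Suc n) d h \<Longrightarrow> \<not> fst (h n)"
proof (induction n arbitrary: d h)
  case (Suc n)
  then have "passage (Suc n) (if fst (h 0) then Suc d else d - 1) (\<lambda>j. h (Suc j))" by simp
  from Suc.IH[OF this] show ?case .
qed (auto split: if_splits)

lemma completion_unique:
  assumes "\<not> fst (h i)" "\<not> fst (h j)" "completions h i = completions h j"
  shows "i = j"
proof (rule ccontr)
  have *: False if "i < j" "\<not> fst (h i)" "completions h i = completions h j" for i j
    using completions_mono[of "Suc i" j h] that by simp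
  assume "i \<noteq> j" then show False using *[of i j] *[of j i] assms by linarith
qed

lemma kth_hit_suminf: "pr (kth_hit x k) = (\<Sum>n. pr (\<lambda>h. hit x h n \<and> completions h n = k))"
  unfolding kth_hit_def[abs_def]
  by (rule pr_suminf) (auto simp: hit_def intro: completion_unique)

text \<open>
  If the first event is a completion, the stack is still empty and only the count moves on.  If it is an
  arrival, this customer lies at the bottom and everything else is as it would be without him, except
  at the completion that pops him, which would otherwise find an empty stack.
  That completion has number \<open>k\<close> just when his passage takes \<open>2 * k + 1\<close> events.
\<close>

lemma kth_hit_recursion:
  "pr (kth_hit x k) = ennreal p_arr * (passage_prob_at x (2 * k) + pr (kth_hit x k))
     + ennreal p_comp * (case k of 0 \<Rightarrow> 0 | Suc k' \<Rightarrow> pr (kth_hit x k'))"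
proof -
  let ?A = "\<lambda>n h. passage (Suc n) 1 h \<and> ereal (clock h (Suc n)) \<le> x \<and> completions h n = k"
  let ?H = "\<lambda>k n h. hit x h n \<and> completions h n = k"
  have step: "pr (?H k (Suc n)) = ennreal p_arr * (pr (?A n) + pr (?H k n))
      + ennreal p_comp * pr (\<lambda>h. hit x h n \<and> Suc (completions h n) = k)" for n
  proof -
    have "pr (\<lambda>h. ?H k (Suc n) (case_nat (True, g) h)) = pr (?A n) + pr (?H k n)" for g
    proof -
      have "?H k (Suc n) (case_nat (True, g) h) \<longleftrightarrow> ?A n h \<or> ?H k n h" for h
        unfolding hit_case_nat_Suc completions_case_nat by auto
      then show ?thesis
        using hit_case_nat_disjoint[of "(True, g)" n _ x] by (simp only:) (rule pr_disj, auto)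
    qed
    moreover have "pr (\<lambda>h. ?H k (Suc n) (case_nat (False, g) h)) = pr (\<lambda>h. hit x h n \<and> Suc (completions h n) = k)" for g
      unfolding hit_case_nat_Suc completions_case_nat by simp
    ultimately show ?thesis
      by (subst pr_first_event) (simp_all add: gap.emeasure_space_1[unfolded space_gap_law] del: completions.simps passage.simps)
  qed
  have A: "(\<Sum>n. pr (?A n)) = passage_prob_at x (2 * k)"
  proof -
    have iff: "?A n h \<longleftrightarrow> n = 2 * k \<and> passage (Suc n) 1 h \<and> ereal (clock h (Suc n)) \<le> x" for n h
      using passage_completions[of "Suc n" 1 h] passage_last[of n 1 h] by auto
    have "pr (?A n) = 0" if "n \<noteq> 2 * k" for n
    proof -
      have "{h. ?A n h} = {}" using iff that by blast
      then show ?thesis by (simp only: pr_def emeasure_empty)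
    qed
    then have "(\<Sum>n. pr (?A n)) = (\<Sum>n\<in>{2 * k}. pr (?A n))"
      by (intro suminf_finite) auto
    also have "\<dots> = pr (?A (2 * k))" by simp
    also have "\<dots> = passage_prob_at x (2 * k)"
      unfolding passage_prob_at_def by (rule arg_cong[of _ _ pr]) (use iff in blast)
    finally show ?thesis .
  qed
  have B: "(\<Sum>n. pr (\<lambda>h. hit x h n \<and> Suc (completions h n) = k)) = (case k of 0 \<Rightarrow> 0 | Suc k' \<Rightarrow> pr (kth_hit x k'))"
    by (cases k) (simp_all add: kth_hit_suminf, simp add: pr_def)
  have "pr (kth_hit x k) = (\<Sum>n. pr (?H k (Suc n)))"
    unfolding kth_hit_suminf
    by (subst suminf_offset[of _ 1]) (auto simp: hit_case_nat_0 pr_def)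
  also have "\<dots> = ennreal p_arr * ((\<Sum>n. pr (?A n)) + (\<Sum>n. pr (?H k n)))
      + ennreal p_comp * (\<Sum>n. pr (\<lambda>h. hit x h n \<and> Suc (completions h n) = k))"
    unfolding step by (simp add: suminf_add[symmetric] distrib_left)
  finally show ?thesis unfolding A B kth_hit_suminf[symmetric] .
qed

text \<open>
  In the recursion the unknown occurs on both sides, with factor \<open>p_arr\<close> on the right.  Cancelling this
  share leaves \<open>p_comp\<close> as a common factor.
\<close>

lemma kth_hit_prob: "pr (kth_hit x k) = (\<Sum>j\<le>k. busy_mass x j)"
proof (induction k)
  have step: "pr (kth_hit x k) = busy_mass x k + v"
    if "pr (kth_hit x k) = ennreal p_arr * (passage_prob_at x (2 * k) + pr (kth_hit x k)) + ennreal p_comp * v"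
    for k v
  proof -
    let ?u = "pr (kth_hit x k)"
    have fin: "?u \<noteq> \<infinity>" using pr_le_1[of "kth_hit x k"] by (auto simp: top_unique)
    have "ennreal p_arr * ?u + ennreal p_comp * ?u = ?u"
      using p_arr_pos p_comp_pos by (simp add: distrib_right[symmetric] ennreal_plus[symmetric] p_arr_comp(1) del: ennreal_plus)
    also have "\<dots> = ennreal p_arr * ?u + ennreal p_comp * (busy_mass x k + v)"
    proof -
      have "ennreal p_arr * (passage_prob_at x (2 * k) + ?u) + ennreal p_comp * v =
          (ennreal p_comp * busy_mass x k + ennreal p_arr * ?u) + ennreal p_comp * v"
        by (simp only: distrib_left passage_prob_even)
      also have "\<dots> = ennreal p_arr * ?u + ennreal p_comp * (busy_mass x k + v)"
        by (simp only: distrib_left add.assoc add.commute add.left_commute)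
      finally show ?thesis using that by (rule trans[rotated])
    qed
    finally have "ennreal p_comp * ?u = ennreal p_comp * (busy_mass x k + v)"
      using fin by (simp add: ennreal_add_left_cancel ennreal_mult_eq_top_iff)
    then show ?thesis using p_comp_pos by (simp add: ennreal_mult_cancel_left)
  qed
  case 0
  show ?case using step[OF kth_hit_recursion[of x 0, unfolded nat.case(1)]] by simp
  case (Suc k)
  then show ?case using step[OF kth_hit_recursion[of x "Suc k", unfolded nat.case(2)]]
    by (simp add: add.commute)
qed

end

section \<open>The length of a busy period\<close>

lemma idles_cong: "(\<And>j. j \<le> n \<Longrightarrow> h j = h' j) \<Longrightarrow> idles T h n \<longleftrightarrow> idles T h' n"
proof -
  assume *: "\<And>j. j \<le> n \<Longrightarrow> h j = h' j"
  have s: "stack h n = stack h' n" using * by (intro stack_cong) simp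
  have "clock h (Suc n) = clock h' (Suc n)" using * by (intro clock_cong) simp
  moreover have "clock h (Suc (hd (stack h n))) = clock h' (Suc (hd (stack h n)))" if "stack h n \<noteq> []"
    using * stack_less[of "hd (stack h n)" h n] that by (intro clock_cong) auto
  ultimately show ?thesis using * s by (auto simp: idles_def hit_def)
qed

lemma in_cycle_cong: "(\<And>j. j < n \<Longrightarrow> h j = h' j) \<Longrightarrow> in_cycle T h n \<longleftrightarrow> in_cycle T h' n"
  unfolding in_cycle_def using idles_cong[of _ h h' T]
  by (metis le_less_trans)

lemma in_cycle_Suc: "in_cycle T h (Suc n) \<longleftrightarrow> in_cycle T h n \<and> \<not> idles T h n"
  by (auto simp: in_cycle_def less_Suc_eq)

context race
begin

lemma AE_gap_pos: "AE h in S. \<forall>n. 0 < snd (h n)"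
proof -
  have "AE g in gap_law. 0 < g"
  proof -
    have "AE g in lborel. g \<noteq> (0::real)" by (rule AE_lborel_singleton)
    then show ?thesis
      unfolding gap_law_def using l_pos m_pos
      by (subst AE_density) (auto simp: exponential_density_def elim!: eventually_mono)
  qed
  moreover interpret E: pair_prob_space "measure_pmf (bernoulli_pmf p_arr)" gap_law by standard
  have "Measurable.pred event_law (\<lambda>e. 0 < snd e)" by measurable
  ultimately have "AE e in event_law. 0 < snd e"
    unfolding event_law_def by (intro E.AE_pair_measure) (auto simp: pred_def)
  then have "AE h in S. 0 < snd (h n)" for n
    by (intro AE_component) auto
  then show ?thesis by (simp add: AE_all_countable)
qed

lemma pr_event_type: "pr (\<lambda>h. fst (h 0)) = ennreal p_arr" "pr (\<lambda>h. \<not> fst (h 0)) = ennreal p_comp"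
  by (subst pr_first_event; simp add: pr_True gap.emeasure_space_1[unfolded space_gap_law]; simp add: pr_def)+

text \<open>
  The probability \<open>z\<close> that all events have the same given type satisfies \<open>z = q * z\<close> with \<open>q < 1\<close>.
\<close>

lemma AE_type_infinitely_often: "AE h in S. \<forall>n. \<exists>j\<ge>n. fst (h j) = b"
proof -
  have z: "pr (\<lambda>h. \<forall>j. fst (h j) = c) = 0" for c
  proof -
    define z where "z = pr (\<lambda>h. \<forall>j. fst (h j) = c)"
    let ?p = "if c then p_arr else p_comp"
    have "z = pr (\<lambda>h. fst (h 0) = c \<and> (\<forall>j. fst (shift 1 h j) = c))"
      unfolding z_def
    proof (rule arg_cong[of _ _ pr], rule ext)
      fix h :: "nat \<Rightarrow> bool \<times> real"
      show "(\<forall>j. fst (h j) = c) = (fst (h 0) = c \<and> (\<forall>j. fst (shift 1 h j) = c))"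
        by (metis (no_types) not0_implies_Suc plus_1_eq_Suc)
    qed
    also have "\<dots> = pr (\<lambda>h. fst (h 0) = c) * z"
      unfolding z_def by (rule pr_past_future) auto
    also have "pr (\<lambda>h. fst (h 0) = c) = ennreal ?p"
      using pr_event_type by (cases c) simp_all
    finally have eq: "z = ennreal ?p * z" .
    have "z \<le> 1" unfolding z_def by (rule pr_le_1)
    then obtain r where r: "z = ennreal r" "0 \<le> r" by (cases z) (auto simp: top_unique)
    have "r = ?p * r" using eq r p_arr_pos p_comp_pos by (simp add: ennreal_mult[symmetric] split: if_splits)
    moreover have "?p < 1" using p_arr_pos p_comp_pos p_arr_comp by auto
    ultimately have "r = 0" by (metis mult_cancel_right1 order_less_irrefl)
    then show ?thesis using r z_def by simp
  qed
  have "AE h in S. \<exists>j\<ge>n. fst (h j) = b" for n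
  proof -
    have "pr (\<lambda>h. True \<and> (\<forall>j. fst (shift n h j) = (\<not> b))) = pr (\<lambda>h. True) * pr (\<lambda>h. \<forall>j. fst (h j) = (\<not> b))"
      by (rule pr_past_future) auto
    then have "pr (\<lambda>h. \<forall>j. fst (h (n + j)) = (\<not> b)) = 0" using z by simp
    moreover have "{h. \<forall>j. fst (h (n + j)) = (\<not> b)} \<in> sets S"
    proof -
      have "Measurable.pred S (\<lambda>h. \<forall>j. fst (h (n + j)) = (\<not> b))" by measurable
      then show ?thesis by (simp add: pred_def)
    qed
    ultimately show ?thesis
      by (intro AE_I[where N="{h. \<forall>j. fst (h (n + j)) = (\<not> b)}"])
         (auto simp: pr_def le_iff_add)
  qed
  then show ?thesis by (simp add: AE_all_countable)
qed

definition cycle_prob :: "ereal \<Rightarrow> nat \<Rightarrow> ennreal" where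
  "cycle_prob T n = pr (\<lambda>h. in_cycle T h n)"

lemma pr_in_cycle_type:
  "pr (\<lambda>h. in_cycle T h n \<and> fst (h n)) = ennreal p_arr * cycle_prob T n"
  "pr (\<lambda>h. in_cycle T h n \<and> \<not> fst (h n)) = ennreal p_comp * cycle_prob T n"
proof -
  have "pr (\<lambda>h. in_cycle T h n \<and> fst (shift n h 0)) = cycle_prob T n * pr (\<lambda>h. fst (h 0))"
    unfolding cycle_prob_def by (rule pr_past_future) (auto intro!: in_cycle_cong)
  then show "pr (\<lambda>h. in_cycle T h n \<and> fst (h n)) = ennreal p_arr * cycle_prob T n"
    by (simp add: pr_event_type mult.commute)
  have "pr (\<lambda>h. in_cycle T h n \<and> \<not> fst (shift n h 0)) = cycle_prob T n * pr (\<lambda>h. \<not> fst (h 0))"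
    unfolding cycle_prob_def by (rule pr_past_future) (auto intro!: in_cycle_cong)
  then show "pr (\<lambda>h. in_cycle T h n \<and> \<not> fst (h n)) = ennreal p_comp * cycle_prob T n"
    by (simp add: pr_event_type mult.commute)
qed

lemma pr_cong_AE:
  assumes "Measurable.pred S A" "Measurable.pred S B" "AE h in S. A h \<longleftrightarrow> B h"
  shows "pr A = pr B"
  unfolding pr_def using assms by (intro emeasure_eq_AE) (auto simp: pred_def)

text \<open>
  A hit at event \<open>n\<close> pops a unique arrival \<open>i < n\<close>, and by \<open>in_cycle_pop\<close> belonging to the first busy
  period can be tested at event \<open>i\<close>.  There it depends on the past, whereas the pop depends on the
  future of \<open>i\<close>; so the probabilities multiply and the sum is a convolution.
\<close>

lemma cycle_hit:
  "pr (\<lambda>h. in_cycle T h n \<and> hit T h n) =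
     (\<Sum>i<n. (ennreal p_arr * cycle_prob T i) * passage_prob_at T (n - Suc i))"
proof -
  have pop: "pr (\<lambda>h. in_cycle T h i \<and> pop T h i n) =
      (ennreal p_arr * cycle_prob T i) * passage_prob_at T (n - Suc i)" if "i < n" for i
  proof -
    have n: "n - i = Suc (n - Suc i)" using that by simp
    have "pr (\<lambda>h. (in_cycle T h i \<and> fst (h i)) \<and>
        (passage (Suc (n - Suc i)) 1 (shift (Suc i) h) \<and> ereal (clock (shift (Suc i) h) (Suc (n - Suc i))) \<le> T)) =
      pr (\<lambda>h. in_cycle T h i \<and> fst (h i)) * passage_prob_at T (n - Suc i)"
      unfolding passage_prob_at_def
    proof (rule pr_past_future)
      fix h h' :: "nat \<Rightarrow> bool \<times> real" assume "\<And>j. j < Suc i \<Longrightarrow> h j = h' j"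
      then show "in_cycle T h i \<and> fst (h i) \<longleftrightarrow> in_cycle T h' i \<and> fst (h' i)"
        using in_cycle_cong[of i h h' T] by simp
    qed (simp_all del: passage.simps)
    then show ?thesis
      unfolding pr_in_cycle_type pop_def n using that by (simp del: passage.simps add: conj_assoc)
  qed
  have "pr (\<lambda>h. in_cycle T h n \<and> hit T h n) = pr (\<lambda>h. \<exists>i. i < n \<and> in_cycle T h i \<and> pop T h i n)"
  proof (rule pr_cong_AE)
    show "AE h in S. (in_cycle T h n \<and> hit T h n) = (\<exists>i<n. in_cycle T h i \<and> pop T h i n)"
      using AE_gap_pos
    proof eventually_elim
      case (elim h)
      then have "0 \<le> snd (h j)" for j by (simp add: less_imp_le)
      from in_cycle_pop[of h T, OF this] show ?case unfolding hit_iff_pop by blast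
    qed
  qed measurable
  also have "\<dots> = (\<Sum>i. pr (\<lambda>h. i < n \<and> in_cycle T h i \<and> pop T h i n))"
    by (rule pr_suminf) (auto dest: pop_unique)
  also have "\<dots> = (\<Sum>i<n. pr (\<lambda>h. i < n \<and> in_cycle T h i \<and> pop T h i n))"
    by (rule suminf_finite) (auto simp: pr_def)
  also have "\<dots> = (\<Sum>i<n. (ennreal p_arr * cycle_prob T i) * passage_prob_at T (n - Suc i))"
    using pop by (intro sum.cong) auto
  finally show ?thesis .
qed

text \<open>
  Each completion of the first busy period is a hit or makes the server idle, and the latter
  happens before event \<open>K\<close> with probability \<open>1 - cycle_prob T K\<close>.
\<close>

lemma cycle_balance:
  "ennreal p_comp * (\<Sum>n<K. cycle_prob T n) + cycle_prob T K =
     (\<Sum>n<K. pr (\<lambda>h. in_cycle T h n \<and> hit T h n)) + 1"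
proof (induction K)
  case 0
  have "cycle_prob T 0 = 1" unfolding cycle_prob_def by (simp add: in_cycle_def pr_True)
  then show ?case by simp
next
  case (Suc K)
  let ?I = "pr (\<lambda>h. in_cycle T h K \<and> idles T h K)"
  let ?H = "\<lambda>n. pr (\<lambda>h. in_cycle T h n \<and> hit T h n)"
  have "(\<lambda>h. in_cycle T h K \<and> \<not> fst (h K)) =
      (\<lambda>h. (in_cycle T h K \<and> hit T h K) \<or> (in_cycle T h K \<and> idles T h K))"
    by (auto simp: fun_eq_iff idles_def hit_def)
  then have 1: "ennreal p_comp * cycle_prob T K = ?H K + ?I"
    unfolding pr_in_cycle_type[symmetric] by (simp only:) (rule pr_disj, auto simp: idles_def)
  have "(\<lambda>h. in_cycle T h K) = (\<lambda>h. in_cycle T h (Suc K) \<or> (in_cycle T h K \<and> idles T h K))"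
    by (auto simp: fun_eq_iff in_cycle_Suc)
  then have 2: "cycle_prob T K = cycle_prob T (Suc K) + ?I"
    unfolding cycle_prob_def by (simp only:) (rule pr_disj, auto simp: in_cycle_Suc)
  have "ennreal p_comp * (\<Sum>n<Suc K. cycle_prob T n) + cycle_prob T (Suc K) =
      ennreal p_comp * (\<Sum>n<K. cycle_prob T n) + (cycle_prob T (Suc K) + ?I) + ?H K"
    by (simp add: distrib_left 1 ac_simps)
  also have "\<dots> = ennreal p_comp * (\<Sum>n<K. cycle_prob T n) + cycle_prob T K + ?H K"
    using 2 by simp
  also have "\<dots> = (\<Sum>n<Suc K. ?H n) + 1"
    unfolding Suc by (simp add: ac_simps)
  finally show ?case .
qed

lemma suminf_busy_mass_le_1: "(\<Sum>j. busy_mass x j) \<le> 1"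
proof (rule suminf_ennreal_le_limit)
  fix K
  have "(\<Sum>j<K. busy_mass x j) \<le> (\<Sum>j\<le>K. busy_mass x j)"
    by (intro sum_mono2) auto
  also have "\<dots> \<le> 1" unfolding kth_hit_prob[symmetric] by (rule pr_le_1)
  finally show "(\<Sum>j<K. busy_mass x j) \<le> 1" .
qed

text \<open>
  The limit of the probability that a completion finds the top of the stack at an age of at most \<open>x\<close>.
\<close>

definition busy_total :: "ereal \<Rightarrow> real" where
  "busy_total x = enn2real (\<Sum>j. busy_mass x j)"

lemma busy_total: "ennreal (busy_total x) = (\<Sum>j. busy_mass x j)" "0 \<le> busy_total x" "busy_total x \<le> 1"
proof -
  have "(\<Sum>j. busy_mass x j) < \<infinity>" using suminf_busy_mass_le_1[of x]
    by (metis ennreal_one_less_top infinity_ennreal_def order_le_less_trans)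
  then show "ennreal (busy_total x) = (\<Sum>j. busy_mass x j)" by (simp add: busy_total_def)
  then show "busy_total x \<le> 1" using suminf_busy_mass_le_1[of x]
    by (metis ennreal_1 ennreal_le_iff zero_le_one)
qed (simp add: busy_total_def)

text \<open>
  Each arrival of the first busy period is popped in time with probability
  \<open>p_comp / p_arr * busy_total T\<close>.  Inserting this into \<open>cycle_balance\<close> gives a linear equation for the
  length \<open>L\<close>, provided that \<open>L\<close> is finite.  The truncated inequality shows that this is so if
  \<open>busy_total T < 1\<close>; if \<open>busy_total T = 1\<close>, a finite \<open>L\<close> would satisfy \<open>p_comp * L = p_comp * L + 1\<close>.
\<close>

lemma cycle_length:
  "(\<Sum>n. cycle_prob T n) = (if busy_total T = 1 then \<infinity> else ennreal (1 / (p_comp * (1 - busy_total T))))"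
proof -
  let ?L = "\<Sum>n. cycle_prob T n" and ?H = "\<lambda>n. pr (\<lambda>h. in_cycle T h n \<and> hit T h n)"
  let ?G = "\<Sum>r. passage_prob_at T r"
  have paG: "ennreal p_arr * ?G = ennreal (p_comp * busy_total T)"
    using suminf_passage_prob[of T] busy_total[of T] p_comp_pos by (simp add: ennreal_mult')
  have total: "(\<Sum>n. ?H n) = ?L * (ennreal p_arr * ?G)"
    unfolding cycle_hit Cauchy_product_ennreal[of "\<lambda>i. ennreal p_arr * cycle_prob T i" "passage_prob_at T"]
    by (simp add: ac_simps)
  have partial: "(\<Sum>n<K. ?H n) \<le> (\<Sum>n<K. cycle_prob T n) * (ennreal p_arr * ?G)" for K
  proof -
    have "(\<Sum>n<K. ?H n) = (\<Sum>n<K. \<Sum>i<K. if i < n then (ennreal p_arr * cycle_prob T i) * passage_prob_at T (n - Suc i) else 0)"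
      unfolding cycle_hit by (intro sum.cong refl sum.mono_neutral_cong_left) auto
    also have "\<dots> = (\<Sum>i<K. \<Sum>n<K. if i < n then (ennreal p_arr * cycle_prob T i) * passage_prob_at T (n - Suc i) else 0)"
      by (rule sum.swap)
    also have "\<dots> \<le> (\<Sum>i<K. (ennreal p_arr * cycle_prob T i) * ?G)"
    proof (rule sum_mono)
      fix i
      have "(\<Sum>n<K. if i < n then (ennreal p_arr * cycle_prob T i) * passage_prob_at T (n - Suc i) else 0)
        \<le> (\<Sum>n. if i < n then (ennreal p_arr * cycle_prob T i) * passage_prob_at T (n - Suc i) else 0)"
        by (rule sum_le_suminf) auto
      also have "\<dots> = (\<Sum>r. (ennreal p_arr * cycle_prob T i) * passage_prob_at T r)"
        by (subst suminf_mono_reindex[of "\<lambda>r. Suc i + r", symmetric])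
           (auto simp: strict_mono_def image_iff less_iff_Suc_add)
      finally show "(\<Sum>n<K. if i < n then (ennreal p_arr * cycle_prob T i) * passage_prob_at T (n - Suc i) else 0)
        \<le> (ennreal p_arr * cycle_prob T i) * ?G" by simp
    qed
    also have "\<dots> = (\<Sum>n<K. cycle_prob T n) * (ennreal p_arr * ?G)"
      by (subst sum_distrib_right) (simp add: ac_simps)
    finally show ?thesis .
  qed
  \<comment> \<open>in the limit the probability that the busy period is not yet over vanishes, as \<open>L\<close> is finite\<close>
  have exact: "ennreal p_comp * ?L = ?L * ennreal (p_comp * busy_total T) + 1" if fin: "?L \<noteq> \<infinity>"
  proof -
    have c: "cycle_prob T n = ennreal (enn2real (cycle_prob T n))" for n
      using pr_le_1[of "\<lambda>h. in_cycle T h n"] unfolding cycle_prob_def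
      by (metis ennreal_enn2real ennreal_one_less_top order_le_less_trans)
    have "summable (\<lambda>n. enn2real (cycle_prob T n))"
      using fin by (intro summable_suminf_not_top) (simp_all add: c[symmetric])
    then have "(\<lambda>n. ennreal (enn2real (cycle_prob T n))) \<longlonglongrightarrow> ennreal 0"
      by (intro tendsto_ennrealI summable_LIMSEQ_zero)
    then have "cycle_prob T \<longlonglongrightarrow> 0" by (simp add: c[symmetric])
    moreover have "(\<lambda>K. \<Sum>n<K. cycle_prob T n) \<longlonglongrightarrow> ?L" by (rule summable_LIMSEQ) simp
    ultimately have "(\<lambda>K. ennreal p_comp * (\<Sum>n<K. cycle_prob T n) + cycle_prob T K) \<longlonglongrightarrow> ennreal p_comp * ?L + 0"
      by (intro tendsto_add ennreal_tendsto_cmult) auto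
    moreover have "(\<lambda>K. (\<Sum>n<K. ?H n) + 1) \<longlonglongrightarrow> (\<Sum>n. ?H n) + 1"
      by (intro tendsto_intros summable_LIMSEQ) simp
    ultimately show ?thesis
      unfolding cycle_balance total paG by (simp add: LIMSEQ_unique)
  qed
  show ?thesis
  proof (cases "busy_total T = 1")
    case True
    have "?L = \<infinity>"
    proof (rule ccontr)
      assume fin: "?L \<noteq> \<infinity>"
      then obtain r where "?L = ennreal r" "0 \<le> r" by (cases ?L) auto
      then show False using exact[OF fin] True p_comp_pos
        by (simp add: ennreal_mult[symmetric] ennreal_1[symmetric] ennreal_plus[symmetric] del: ennreal_1 ennreal_plus)
    qed
    then show ?thesis using True by simp
  next
    case False
    then have lt: "busy_total T < 1" using busy_total(3)[of T] by simp
    have bound: "(\<Sum>n<K. cycle_prob T n) \<le> ennreal (1 / (p_comp * (1 - busy_total T)))" for K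
    proof -
      have "cycle_prob T n < top" for n
        unfolding cycle_prob_def using pr_le_1 ennreal_one_less_top by (rule order_le_less_trans)
      then have "(\<Sum>n<K. cycle_prob T n) < top" by simp
      then obtain r where r: "(\<Sum>n<K. cycle_prob T n) = ennreal r" "0 \<le> r"
        by (cases "\<Sum>n<K. cycle_prob T n") auto
      have "ennreal p_comp * ennreal r \<le> ennreal p_comp * ennreal r + cycle_prob T K" by simp
      also have "\<dots> = (\<Sum>n<K. ?H n) + 1" unfolding r(1)[symmetric] by (rule cycle_balance)
      also have "\<dots> \<le> ennreal r * ennreal (p_comp * busy_total T) + 1"
        using partial[of K] unfolding r(1) paG by (rule add_right_mono)
      finally have "ennreal p_comp * ennreal r \<le> ennreal r * ennreal (p_comp * busy_total T) + 1" .
      then have "p_comp * r \<le> r * (p_comp * busy_total T) + 1"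
        using r p_comp_pos busy_total[of T]
        by (simp add: ennreal_mult[symmetric] ennreal_1[symmetric] ennreal_plus[symmetric] del: ennreal_1 ennreal_plus)
      then have "r \<le> 1 / (p_comp * (1 - busy_total T))"
        using p_comp_pos lt by (simp add: field_simps)
      then show ?thesis using r by (simp add: ennreal_leI)
    qed
    then have le: "?L \<le> ennreal (1 / (p_comp * (1 - busy_total T)))" by (rule suminf_ennreal_le_limit)
    then have fin: "?L \<noteq> \<infinity>" by (metis ennreal_neq_top infinity_ennreal_def top.extremum_uniqueI)
    then obtain r where r: "?L = ennreal r" "0 \<le> r" by (cases ?L) auto
    have "p_comp * r = r * (p_comp * busy_total T) + 1"
      using exact[OF fin] r p_comp_pos busy_total[of T]
      by (simp add: ennreal_mult[symmetric] ennreal_1[symmetric] ennreal_plus[symmetric] del: ennreal_1 ennreal_plus)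
    then have "r = 1 / (p_comp * (1 - busy_total T))" using p_comp_pos lt by (simp add: field_simps)
    then show ?thesis using r False by simp
  qed
qed

lemma expected_cycle_arrivals:
  "(\<integral>\<^sup>+h. (\<Sum>n. indicator {h. in_cycle T h n \<and> fst (h n)} h) \<partial>S) = ennreal p_arr * (\<Sum>n. cycle_prob T n)"
proof -
  have [measurable]: "{h. in_cycle T h n \<and> fst (h n)} \<in> sets S" for n
  proof -
    have "Measurable.pred S (\<lambda>h. in_cycle T h n \<and> fst (h n))" by measurable
    then show ?thesis by (simp add: pred_def)
  qed
  have "(\<integral>\<^sup>+h. (\<Sum>n. indicator {h. in_cycle T h n \<and> fst (h n)} h) \<partial>S) =
      (\<Sum>n. pr (\<lambda>h. in_cycle T h n \<and> fst (h n)))"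
    by (subst nn_integral_suminf) (simp_all add: pr_def)
  then show ?thesis by (simp add: pr_in_cycle_type)
qed

end

section \<open>Lack of memory\<close>

text \<open>
  The first component of \<open>z\<close> contains the interarrival times still to come and the second one the
  service times, where the entry \<open>0\<close> is the residual of the time in progress.
\<close>

definition race_event :: "(nat \<Rightarrow> real) \<times> (nat \<Rightarrow> real) \<Rightarrow> bool \<times> real" where
  "race_event z = (if fst z 0 < snd z 0 then (True, fst z 0) else (False, snd z 0))"

definition race_rest :: "(nat \<Rightarrow> real) \<times> (nat \<Rightarrow> real) \<Rightarrow> (nat \<Rightarrow> real) \<times> (nat \<Rightarrow> real)" where
  "race_rest z =
     (if fst z 0 < snd z 0 then (\<lambda>i. fst z (Suc i), case_nat (snd z 0 - fst z 0) (\<lambda>i. snd z (Suc i)))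
      else (case_nat (fst z 0 - snd z 0) (\<lambda>i. fst z (Suc i)), \<lambda>i. snd z (Suc i)))"

text \<open>
  When the server becomes idle, the residual interarrival time is dropped: the next customer arrives
  at the end of it and his service starts at once, with a fresh interarrival time in progress.
  Idle time and the arrival that ends it do not show up in the history.
\<close>

definition race_step :: "ereal \<Rightarrow> nat \<Rightarrow>
    (nat \<Rightarrow> bool \<times> real) \<times> (nat \<Rightarrow> real) \<times> (nat \<Rightarrow> real) \<Rightarrow>
    (nat \<Rightarrow> bool \<times> real) \<times> (nat \<Rightarrow> real) \<times> (nat \<Rightarrow> real)" where
  "race_step T n s =
     (let h = (fst s)(n := race_event (snd s)); z = race_rest (snd s)
      in (h, if idles T h n then (\<lambda>i. fst z (Suc i), snd z) else z))"

text \<open>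
  History and residual times after \<open>n\<close> events.  The value \<open>(False, 0)\<close> fills the places of events that
  have not happened yet.
\<close>

primrec chain :: "ereal \<Rightarrow> nat \<Rightarrow> (nat \<Rightarrow> real) \<times> (nat \<Rightarrow> real) \<Rightarrow>
    (nat \<Rightarrow> bool \<times> real) \<times> (nat \<Rightarrow> real) \<times> (nat \<Rightarrow> real)" where
  "chain T 0 z = (\<lambda>_. (False, 0), z)"
| "chain T (Suc n) z = race_step T n (chain T n z)"

definition event_seq :: "ereal \<Rightarrow> (nat \<Rightarrow> real) \<times> (nat \<Rightarrow> real) \<Rightarrow> nat \<Rightarrow> bool \<times> real" where
  "event_seq T z n = race_event (snd (chain T n z))"

text \<open>
  Ties and vanishing times have probability \<open>0\<close>.
\<close>

definition untied :: "(nat \<Rightarrow> real) \<times> (nat \<Rightarrow> real) \<Rightarrow> bool" where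
  "untied z \<longleftrightarrow> 0 < fst z 0 \<and> 0 < snd z 0 \<and> fst z 0 \<noteq> snd z 0"

lemma fst_chain: "fst (chain T n z) i = (if i < n then event_seq T z i else (False, 0))"
  by (induction n) (auto simp: race_step_def Let_def event_seq_def less_Suc_eq)

context race
begin

abbreviation X_law :: "real measure" where "X_law \<equiv> density lborel (exponential_density l)"
abbreviation Y_law :: "real measure" where "Y_law \<equiv> density lborel (exponential_density m)"

sublocale X: sequence_space X_law
  using l_pos by (intro sequence_space.intro product_prob_spaceI prob_space_exponential_density)
sublocale Y: sequence_space Y_law
  using m_pos by (intro sequence_space.intro product_prob_spaceI prob_space_exponential_density)
sublocale XY: pair_prob_space X.S Y.S by standard

abbreviation XY_law :: "((nat \<Rightarrow> real) \<times> (nat \<Rightarrow> real)) measure" where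
  "XY_law \<equiv> X.S \<Otimes>\<^sub>M Y.S"

text \<open>
  Lack of memory in the form of an integral: on \<open>a < b\<close> the excess \<open>b - a\<close> is again exponential, at the
  price of the factor \<open>exp (- s * a)\<close>, which turns the rate \<open>r\<close> of \<open>a\<close> into \<open>r + s\<close>.  The predicate
  \<open>P\<close> leaves open who wins a tie, so that the lemma covers both competitors.
\<close>

lemma half_race:
  fixes r s :: real
  assumes r: "0 < r" and s: "0 < s" and P: "\<And>t. 0 < t \<Longrightarrow> P t" "\<And>t. t < 0 \<Longrightarrow> \<not> P t"
    and F [measurable]: "case_prod F \<in> borel_measurable (borel \<Otimes>\<^sub>M borel)"
  shows "(\<integral>\<^sup>+a. \<integral>\<^sup>+b. (if P (b - a) then F a (b - a) else 0) \<partial>density lborel (exponential_density s)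
             \<partial>density lborel (exponential_density r))
       = ennreal (r / (r + s)) * (\<integral>\<^sup>+g. \<integral>\<^sup>+b. F g b \<partial>density lborel (exponential_density s)
             \<partial>density lborel (exponential_density (r + s)))"
proof -
  have Pm [measurable]: "Measurable.pred borel P"
  proof -
    obtain c where "P = (\<lambda>t. 0 < t \<or> (t = 0 \<and> c))" using P by (metis linorder_less_linear)
    then show ?thesis by simp
  qed
  have sec [measurable]: "F a \<in> borel_measurable borel" for a
    using measurable_compose[OF measurable_Pair1' F, of a] by simp
  let ?d = "\<lambda>r x. ennreal (exponential_density r x)"
  interpret es: prob_space "density lborel (exponential_density s)"
    using s by (rule prob_space_exponential_density)
  have inner: "?d r a * (\<integral>\<^sup>+b. (if P (b - a) then F a (b - a) else 0) \<partial>density lborel (exponential_density s))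
      = ennreal (r / (r + s)) * (?d (r + s) a * (\<integral>\<^sup>+b. F a b \<partial>density lborel (exponential_density s)))" for a
  proof (cases "a < 0")
    case True
    then show ?thesis by (simp add: exponential_density_def)
  next
    case False
    have "(\<integral>\<^sup>+b. (if P (b - a) then F a (b - a) else 0) \<partial>density lborel (exponential_density s))
        = (\<integral>\<^sup>+b. ?d s b * (if P (b - a) then F a (b - a) else 0) \<partial>lborel)"
      by (subst nn_integral_density) auto
    also have "\<dots> = (\<integral>\<^sup>+t. ?d s (a + t) * (if P t then F a t else 0) \<partial>lborel)"
      by (subst nn_integral_real_affine[of _ 1 a]) (auto cong: if_cong)
    also have "\<dots> = (\<integral>\<^sup>+t. ennreal (exp (- s * a)) * (?d s t * F a t) \<partial>lborel)"
    proof (rule nn_integral_cong_AE)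
      have "AE t in lborel. t \<noteq> (0::real)" by (rule AE_lborel_singleton)
      then show "AE t in lborel. ?d s (a + t) * (if P t then F a t else 0) = ennreal (exp (- s * a)) * (?d s t * F a t)"
      proof eventually_elim
        case (elim t)
        show ?case
        proof (cases "0 < t")
          case True
          then have "?d s (a + t) = ennreal (exp (- s * a)) * ?d s t"
            using False s by (simp add: exponential_density_def ennreal_mult[symmetric] exp_add[symmetric] algebra_simps)
          then show ?thesis using P True by (simp add: mult.assoc)
        next
          case False
          then show ?thesis using P elim by (simp add: exponential_density_def)
        qed
      qed
    qed
    also have "\<dots> = ennreal (exp (- s * a)) * (\<integral>\<^sup>+b. F a b \<partial>density lborel (exponential_density s))"
      by (simp add: nn_integral_cmult nn_integral_density)
    finally have eq: "(\<integral>\<^sup>+b. (if P (b - a) then F a (b - a) else 0) \<partial>density lborel (exponential_density s))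
        = ennreal (exp (- s * a)) * (\<integral>\<^sup>+b. F a b \<partial>density lborel (exponential_density s))" .
    have "?d r a * ennreal (exp (- s * a)) = ennreal (r / (r + s)) * ?d (r + s) a"
    proof -
      have "r * exp (- a * r) * exp (- s * a) = r * exp (- a * (r + s))"
        by (simp add: mult.assoc exp_add[symmetric] algebra_simps)
      also have "\<dots> = r / (r + s) * ((r + s) * exp (- a * (r + s)))"
        using r s by simp
      finally show ?thesis
        using r s False by (simp add: exponential_density_def ennreal_mult[symmetric] mult.commute)
    qed
    then show ?thesis unfolding eq by (simp add: mult.assoc[symmetric])
  qed
  have "(\<integral>\<^sup>+a. \<integral>\<^sup>+b. (if P (b - a) then F a (b - a) else 0) \<partial>density lborel (exponential_density s)
             \<partial>density lborel (exponential_density r))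
      = (\<integral>\<^sup>+a. ?d r a * (\<integral>\<^sup>+b. (if P (b - a) then F a (b - a) else 0) \<partial>density lborel (exponential_density s)) \<partial>lborel)"
    by (subst nn_integral_density) auto
  also have "\<dots> = ennreal (r / (r + s)) * (\<integral>\<^sup>+a. (?d (r + s) a * (\<integral>\<^sup>+b. F a b \<partial>density lborel (exponential_density s))) \<partial>lborel)"
    unfolding inner by (simp add: nn_integral_cmult)
  also have "\<dots> = ennreal (r / (r + s)) * (\<integral>\<^sup>+g. \<integral>\<^sup>+b. F g b \<partial>density lborel (exponential_density s)
             \<partial>density lborel (exponential_density (r + s)))"
    by (subst nn_integral_density) auto
  finally show ?thesis .
qed

lemma race_scalar:
  assumes F [measurable]: "case_prod F \<in> borel_measurable (borel \<Otimes>\<^sub>M borel)"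
    and G [measurable]: "case_prod G \<in> borel_measurable (borel \<Otimes>\<^sub>M borel)"
  shows "(\<integral>\<^sup>+a. \<integral>\<^sup>+b. (if a < b then F a (b - a) else G b (a - b)) \<partial>Y_law \<partial>X_law) =
    ennreal p_arr * (\<integral>\<^sup>+g. \<integral>\<^sup>+b. F g b \<partial>Y_law \<partial>gap_law) + ennreal p_comp * (\<integral>\<^sup>+g. \<integral>\<^sup>+a. G g a \<partial>X_law \<partial>gap_law)"
proof -
  interpret P: pair_sigma_finite X_law Y_law
    by (intro pair_sigma_finite.intro X.M.sigma_finite_measure Y.M.sigma_finite_measure)
  have [measurable]: "F a \<in> borel_measurable borel" "G a \<in> borel_measurable borel" for a
    using measurable_compose[OF measurable_Pair1' F, of a] measurable_compose[OF measurable_Pair1' G, of a] by simp_all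
  \<comment> \<open>ties go to the service; the second part is a race with the roles of \<open>a\<close> and \<open>b\<close> exchanged\<close>
  have split: "(if a < b then F a (b - a) else G b (a - b)) =
      (if 0 < b - a then F a (b - a) else 0) + (if 0 \<le> a - b then G b (a - b) else 0)" for a b
    by auto
  have "(\<integral>\<^sup>+a. \<integral>\<^sup>+b. (if a < b then F a (b - a) else G b (a - b)) \<partial>Y_law \<partial>X_law) =
      (\<integral>\<^sup>+a. \<integral>\<^sup>+b. (if 0 < b - a then F a (b - a) else 0) \<partial>Y_law \<partial>X_law)
    + (\<integral>\<^sup>+a. \<integral>\<^sup>+b. (if 0 \<le> a - b then G b (a - b) else 0) \<partial>Y_law \<partial>X_law)"
    unfolding split by (simp add: nn_integral_add)
  also have "(\<integral>\<^sup>+a. \<integral>\<^sup>+b. (if 0 \<le> a - b then G b (a - b) else 0) \<partial>Y_law \<partial>X_law)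
     = (\<integral>\<^sup>+b. \<integral>\<^sup>+a. (if 0 \<le> a - b then G b (a - b) else 0) \<partial>X_law \<partial>Y_law)"
    by (rule P.Fubini'[symmetric]) measurable
  finally show ?thesis
    using half_race[OF l_pos m_pos _ _ F, of "\<lambda>t. 0 < t"] half_race[OF m_pos l_pos _ _ G, of "\<lambda>t. 0 \<le> t"]
    by (simp add: p_arr_def p_comp_def gap_law_def add.commute)
qed

lemma measurable_X_component [measurable]: "(\<lambda>x. x i) \<in> borel_measurable X.S"
  using measurable_component_singleton[of i UNIV "\<lambda>_. X_law"] by simp

lemma measurable_Y_component [measurable]: "(\<lambda>x. x i) \<in> borel_measurable Y.S"
  using measurable_component_singleton[of i UNIV "\<lambda>_. Y_law"] by simp

lemma measurable_race_event [measurable]: "race_event \<in> measurable XY_law event_law"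
proof -
  have "race_event \<in> measurable XY_law (count_space UNIV \<Otimes>\<^sub>M borel)"
    unfolding race_event_def[abs_def] by measurable
  then show ?thesis using measurable_cong_sets[OF refl sets_event_law] by blast
qed

lemma measurable_race_rest [measurable]: "race_rest \<in> measurable XY_law XY_law"
proof -
  have X: "(\<lambda>z i. fst z (Suc i)) \<in> measurable XY_law X.S"
    using measurable_compose[OF measurable_fst X.measurable_tail] .
  have Y: "(\<lambda>z i. snd z (Suc i)) \<in> measurable XY_law Y.S"
    using measurable_compose[OF measurable_snd Y.measurable_tail] .
  have x: "(\<lambda>z. fst z 0) \<in> borel_measurable XY_law" and y: "(\<lambda>z. snd z 0) \<in> borel_measurable XY_law"
    using measurable_compose[OF measurable_fst measurable_X_component[of 0]]
      measurable_compose[OF measurable_snd measurable_Y_component[of 0]] by simp_all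
  then have "(\<lambda>z. snd z 0 - fst z 0) \<in> measurable XY_law Y_law"
    "(\<lambda>z. fst z 0 - snd z 0) \<in> measurable XY_law X_law" by simp_all
  then show ?thesis
    unfolding race_rest_def[abs_def]
    by (intro measurable_If measurable_Pair measurable_case_nat' X Y borel_measurable_less x y) auto
qed

lemma nn_integral_X_shift:
  assumes [measurable]: "f \<in> borel_measurable X.S"
  shows "(\<integral>\<^sup>+x. f (\<lambda>i. x (Suc i)) \<partial>X.S) = (\<integral>\<^sup>+x. f x \<partial>X.S)"
  using measurable_compose[OF X.measurable_tail assms]
  by (subst X.nn_integral_cons) (simp_all add: X.M.emeasure_space_1[simplified])

lemma nn_integral_XY_law:
  assumes [measurable]: "f \<in> borel_measurable XY_law"
  shows "(\<integral>\<^sup>+z. f z \<partial>XY_law) = (\<integral>\<^sup>+x. \<integral>\<^sup>+y. f (x, y) \<partial>Y.S \<partial>X.S)"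
  by (subst Y.P.nn_integral_fst[symmetric]) auto

lemma XY_cons_Y:
  assumes f [measurable]: "f \<in> borel_measurable XY_law"
  shows "(\<integral>\<^sup>+z. f z \<partial>XY_law) = (\<integral>\<^sup>+b. \<integral>\<^sup>+x. \<integral>\<^sup>+y. f (x, case_nat b y) \<partial>Y.S \<partial>X.S \<partial>Y_law)"
proof -
  interpret P: pair_sigma_finite X.S Y_law
    by (intro pair_sigma_finite.intro X.P.sigma_finite_measure Y.M.sigma_finite_measure)
  have "(\<integral>\<^sup>+z. f z \<partial>XY_law) = (\<integral>\<^sup>+x. \<integral>\<^sup>+b. \<integral>\<^sup>+y. f (x, case_nat b y) \<partial>Y.S \<partial>Y_law \<partial>X.S)"
    by (subst nn_integral_XY_law, measurable) (intro nn_integral_cong Y.nn_integral_cons, measurable)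
  also have "\<dots> = (\<integral>\<^sup>+b. \<integral>\<^sup>+x. \<integral>\<^sup>+y. f (x, case_nat b y) \<partial>Y.S \<partial>X.S \<partial>Y_law)"
    by (rule P.Fubini'[symmetric], measurable)
  finally show ?thesis .
qed

lemma XY_cons:
  assumes f [measurable]: "f \<in> borel_measurable XY_law"
  shows "(\<integral>\<^sup>+z. f z \<partial>XY_law) =
    (\<integral>\<^sup>+a. \<integral>\<^sup>+b. \<integral>\<^sup>+x. \<integral>\<^sup>+y. f (case_nat a x, case_nat b y) \<partial>Y.S \<partial>X.S \<partial>Y_law \<partial>X_law)"
proof -
  interpret P: pair_sigma_finite X.S Y_law
    by (intro pair_sigma_finite.intro X.P.sigma_finite_measure Y.M.sigma_finite_measure)
  have "(\<integral>\<^sup>+z. f z \<partial>XY_law) = (\<integral>\<^sup>+a. \<integral>\<^sup>+x. \<integral>\<^sup>+y. f (case_nat a x, y) \<partial>Y.S \<partial>X.S \<partial>X_law)"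
    by (subst nn_integral_XY_law, measurable) (subst X.nn_integral_cons, measurable)
  also have "\<dots> = (\<integral>\<^sup>+a. \<integral>\<^sup>+x. \<integral>\<^sup>+b. \<integral>\<^sup>+y. f (case_nat a x, case_nat b y) \<partial>Y.S \<partial>Y_law \<partial>X.S \<partial>X_law)"
    by (intro nn_integral_cong) (rule Y.nn_integral_cons, measurable)
  also have "\<dots> = (\<integral>\<^sup>+a. \<integral>\<^sup>+b. \<integral>\<^sup>+x. \<integral>\<^sup>+y. f (case_nat a x, case_nat b y) \<partial>Y.S \<partial>X.S \<partial>Y_law \<partial>X_law)"
    by (intro nn_integral_cong) (rule P.Fubini'[symmetric], measurable)
  finally show ?thesis .
qed

text \<open>
  The winner is discarded, the residual time of the loser is again exponential by lack of memory, and
  the times behind them take no part in the race.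
\<close>

lemma race_law:
  assumes f [measurable]: "f \<in> borel_measurable (event_law \<Otimes>\<^sub>M XY_law)"
  shows "(\<integral>\<^sup>+z. f (race_event z, race_rest z) \<partial>XY_law) = (\<integral>\<^sup>+e. \<integral>\<^sup>+z. f (e, z) \<partial>XY_law \<partial>event_law)"
proof -
  define F where "F g b = (\<integral>\<^sup>+x. \<integral>\<^sup>+y. f ((True, g), (x, case_nat b y)) \<partial>Y.S \<partial>X.S)" for g b
  define G where "G g a = (\<integral>\<^sup>+x. \<integral>\<^sup>+y. f ((False, g), (case_nat a x, y)) \<partial>Y.S \<partial>X.S)" for g a
  have E: "(\<lambda>w. (c, g w)) \<in> measurable N event_law" if "g \<in> borel_measurable N"
    for c and g :: "'z \<Rightarrow> real" and N :: "'z measure"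
  proof -
    have "(\<lambda>w. (c, g w)) \<in> measurable N (count_space UNIV \<Otimes>\<^sub>M borel)" using that by simp
    then show ?thesis using measurable_cong_sets[OF refl sets_event_law] by blast
  qed
  have Fm: "case_prod F \<in> borel_measurable (borel \<Otimes>\<^sub>M borel)"
  proof -
    have "(\<lambda>w. ((True, fst (fst (fst w))), (snd (fst w), case_nat (snd (fst (fst w))) (snd w))))
        \<in> measurable (((borel \<Otimes>\<^sub>M borel) \<Otimes>\<^sub>M X.S) \<Otimes>\<^sub>M Y.S) (event_law \<Otimes>\<^sub>M XY_law)"
      by (intro measurable_Pair E measurable_case_nat'; measurable)
    from X.P.borel_measurable_nn_integral_fst[OF Y.P.borel_measurable_nn_integral_fst[OF measurable_compose[OF this f]]]
    have "(\<lambda>v. \<integral>\<^sup>+x. \<integral>\<^sup>+y. f ((True, fst v), (x, case_nat (snd v) y)) \<partial>Y.S \<partial>X.S) \<in> borel_measurable (borel \<Otimes>\<^sub>M borel)"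
      by (simp only: fst_conv snd_conv)
    then show ?thesis unfolding F_def[abs_def] split_beta' .
  qed
  have Gm: "case_prod G \<in> borel_measurable (borel \<Otimes>\<^sub>M borel)"
  proof -
    have "(\<lambda>w. ((False, fst (fst (fst w))), (case_nat (snd (fst (fst w))) (snd (fst w)), snd w)))
        \<in> measurable (((borel \<Otimes>\<^sub>M borel) \<Otimes>\<^sub>M X.S) \<Otimes>\<^sub>M Y.S) (event_law \<Otimes>\<^sub>M XY_law)"
      by (intro measurable_Pair E measurable_case_nat'; measurable)
    from X.P.borel_measurable_nn_integral_fst[OF Y.P.borel_measurable_nn_integral_fst[OF measurable_compose[OF this f]]]
    have "(\<lambda>v. \<integral>\<^sup>+x. \<integral>\<^sup>+y. f ((False, fst v), (case_nat (snd v) x, y)) \<partial>Y.S \<partial>X.S) \<in> borel_measurable (borel \<Otimes>\<^sub>M borel)"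
      by (simp only: fst_conv snd_conv)
    then show ?thesis unfolding G_def[abs_def] split_beta' .
  qed
  have mE: "(\<lambda>z. f ((c, g), z)) \<in> borel_measurable XY_law" for c g
    by (rule measurable_compose[OF measurable_Pair1' f]) simp
  have F: "(\<integral>\<^sup>+b. F g b \<partial>Y_law) = (\<integral>\<^sup>+z. f ((True, g), z) \<partial>XY_law)" for g
    unfolding F_def by (rule XY_cons_Y[OF mE, symmetric])
  have G: "(\<integral>\<^sup>+a. G g a \<partial>X_law) = (\<integral>\<^sup>+z. f ((False, g), z) \<partial>XY_law)" for g
  proof -
    have m: "(\<lambda>x. \<integral>\<^sup>+y. f ((False, g), (x, y)) \<partial>Y.S) \<in> borel_measurable X.S"
      by (rule Y.P.borel_measurable_nn_integral_fst[OF mE])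
    show ?thesis
      unfolding G_def nn_integral_XY_law[OF mE] by (rule X.nn_integral_cons[OF m, symmetric])
  qed
  have "(\<integral>\<^sup>+z. f (race_event z, race_rest z) \<partial>XY_law)
      = (\<integral>\<^sup>+a. \<integral>\<^sup>+b. (if a < b then F a (b - a) else G b (a - b)) \<partial>Y_law \<partial>X_law)"
  proof -
    have "(\<lambda>z. f (race_event z, race_rest z)) \<in> borel_measurable XY_law"
      by (rule measurable_compose[OF measurable_Pair[OF measurable_race_event measurable_race_rest] f])
    from XY_cons[OF this] show ?thesis
    proof (rule trans, intro nn_integral_cong)
      fix a b :: real
      show "(\<integral>\<^sup>+x. \<integral>\<^sup>+y. f (race_event (case_nat a x, case_nat b y), race_rest (case_nat a x, case_nat b y)) \<partial>Y.S \<partial>X.S)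
        = (if a < b then F a (b - a) else G b (a - b))"
        by (cases "a < b") (simp_all only: race_event_def race_rest_def F_def G_def fst_conv snd_conv nat.case if_True if_False)
    qed
  qed
  also have "\<dots> = ennreal p_arr * (\<integral>\<^sup>+g. \<integral>\<^sup>+b. F g b \<partial>Y_law \<partial>gap_law) + ennreal p_comp * (\<integral>\<^sup>+g. \<integral>\<^sup>+a. G g a \<partial>X_law \<partial>gap_law)"
    by (rule race_scalar[OF Fm Gm])
  also have "\<dots> = ennreal p_arr * (\<integral>\<^sup>+g. \<integral>\<^sup>+z. f ((True, g), z) \<partial>XY_law \<partial>gap_law)
      + ennreal p_comp * (\<integral>\<^sup>+g. \<integral>\<^sup>+z. f ((False, g), z) \<partial>XY_law \<partial>gap_law)
"
    by (simp only: F G)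
  also have "\<dots> = (\<integral>\<^sup>+e. \<integral>\<^sup>+z. f (e, z) \<partial>XY_law \<partial>event_law)"
  proof (rule nn_integral_event_law[symmetric])
    show "(\<lambda>e. \<integral>\<^sup>+z. f (e, z) \<partial>XY_law) \<in> borel_measurable (count_space UNIV \<Otimes>\<^sub>M borel)"
      unfolding measurable_cong_sets[OF sets_event_law refl, symmetric]
      by (rule XY.P.borel_measurable_nn_integral_fst[OF f])
  qed
  finally show ?thesis .
qed

definition history_upto :: "nat \<Rightarrow> (nat \<Rightarrow> bool \<times> real) \<Rightarrow> nat \<Rightarrow> bool \<times> real" where
  "history_upto n h = (\<lambda>i. if i < n then h i else (False, 0))"

lemma measurable_history_upto: "history_upto n \<in> measurable S S"
proof -
  have "(\<lambda>h. if i < n then h i else (False, 0)) \<in> measurable S event_law" for i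
    by (cases "i < n") (simp_all add: measurable_component_singleton)
  then show ?thesis
    unfolding history_upto_def[abs_def] by (intro measurable_PiM_single') (auto simp: space_PiM)
qed

lemma measurable_history_update:
  assumes f: "f \<in> measurable N S" and e: "e \<in> measurable N event_law"
  shows "(\<lambda>w. (f w)(n := e w)) \<in> measurable N S"
  using measurable_fun_upd[where I=UNIV and J=UNIV and M="\<lambda>_. event_law" and i=n, OF _ f e] by blast

lemma measurable_race_step: "race_step T n \<in> measurable (S \<Otimes>\<^sub>M XY_law) (S \<Otimes>\<^sub>M XY_law)"
proof -
  let ?h = "\<lambda>s. (fst s)(n := race_event (snd s))" and ?z = "\<lambda>s. race_rest (snd s)"
  have h: "?h \<in> measurable (S \<Otimes>\<^sub>M XY_law) S"
    by (rule measurable_history_update[OF measurable_fst measurable_compose[OF measurable_snd measurable_race_event]])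
  have z: "?z \<in> measurable (S \<Otimes>\<^sub>M XY_law) XY_law"
    by (rule measurable_compose[OF measurable_snd measurable_race_rest])
  have s: "(\<lambda>s. (\<lambda>i. fst (?z s) (Suc i), snd (?z s))) \<in> measurable (S \<Otimes>\<^sub>M XY_law) XY_law"
    by (rule measurable_Pair[OF measurable_compose[OF measurable_compose[OF z measurable_fst] X.measurable_tail]
        measurable_compose[OF z measurable_snd]])
  have p: "Measurable.pred (S \<Otimes>\<^sub>M XY_law) (\<lambda>s. idles T (?h s) n)"
    by (rule measurable_compose[OF h measurable_idles])
  show ?thesis
    unfolding race_step_def[abs_def] Let_def
    by (rule measurable_Pair[OF h measurable_If[OF s z]]) (rule p[unfolded pred_def])
qed

lemma measurable_chain: "chain T n \<in> measurable XY_law (S \<Otimes>\<^sub>M XY_law)"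
proof (induction n)
  case 0
  have "(\<lambda>z. (\<lambda>_. (False, 0), z)) \<in> measurable XY_law (S \<Otimes>\<^sub>M XY_law)"
    by (rule measurable_Pair) (auto simp: space_PiM)
  then show ?case by simp
next
  case (Suc n)
  show ?case using measurable_compose[OF Suc measurable_race_step] by simp
qed

lemma XY_shift:
  assumes f: "f \<in> borel_measurable XY_law"
  shows "(\<integral>\<^sup>+z. f (\<lambda>i. fst z (Suc i), snd z) \<partial>XY_law) = (\<integral>\<^sup>+z. f z \<partial>XY_law)"
proof -
  have m: "(\<lambda>z. (\<lambda>i. fst z (Suc i), snd z)) \<in> measurable XY_law XY_law"
    by (rule measurable_Pair[OF measurable_compose[OF measurable_fst X.measurable_tail] measurable_snd])
  have F: "(\<lambda>x. \<integral>\<^sup>+y. f (x, y) \<partial>Y.S) \<in> borel_measurable X.S"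
    by (rule Y.P.borel_measurable_nn_integral_fst[OF f])
  have "(\<integral>\<^sup>+z. f (\<lambda>i. fst z (Suc i), snd z) \<partial>XY_law) = (\<integral>\<^sup>+x. \<integral>\<^sup>+y. f (\<lambda>i. x (Suc i), y) \<partial>Y.S \<partial>X.S)"
    using nn_integral_XY_law[OF measurable_compose[OF m f]] by (simp only: fst_conv snd_conv)
  also have "\<dots> = (\<integral>\<^sup>+x. \<integral>\<^sup>+y. f (x, y) \<partial>Y.S \<partial>X.S)"
    by (rule nn_integral_X_shift[OF F])
  finally show ?thesis unfolding nn_integral_XY_law[OF f] .
qed

lemma history_resample:
  assumes f: "f \<in> borel_measurable S"
  shows "(\<integral>\<^sup>+h. \<integral>\<^sup>+e. f (h(n := e)) \<partial>event_law \<partial>S) = (\<integral>\<^sup>+h. f h \<partial>S)"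
proof -
  interpret Q: pair_sigma_finite event_law S
    by (intro pair_sigma_finite.intro M.sigma_finite_measure P.sigma_finite_measure)
  have u: "(\<lambda>(e, h). h(n := e)) \<in> measurable (event_law \<Otimes>\<^sub>M S) S"
    unfolding split_beta' by (rule measurable_history_update[OF measurable_snd measurable_fst])
  have fu: "(\<lambda>p. f (case p of (e, h) \<Rightarrow> h(n := e))) \<in> borel_measurable (event_law \<Otimes>\<^sub>M S)"
    by (rule measurable_compose[OF u f])
  have "distr (event_law \<Otimes>\<^sub>M S) S (\<lambda>(e, h). h(n := e)) = S"
    using distr_pair_PiM_eq_PiM[of UNIV "\<lambda>_. event_law" n] prob_space_event_law by (simp add: insert_absorb)
  then have "(\<integral>\<^sup>+h. f h \<partial>S) = (\<integral>\<^sup>+h. f h \<partial>distr (event_law \<Otimes>\<^sub>M S) S (\<lambda>(e, h). h(n := e)))" by (rule arg_cong[OF sym])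
  also have "\<dots> = (\<integral>\<^sup>+p. f (case p of (e, h) \<Rightarrow> h(n := e)) \<partial>(event_law \<Otimes>\<^sub>M S))"
    by (rule nn_integral_distr[OF u]) (simp only: measurable_distr_eq1 f)
  also have "\<dots> = (\<integral>\<^sup>+h. \<integral>\<^sup>+e. f (h(n := e)) \<partial>event_law \<partial>S)"
    using Q.nn_integral_snd[OF fu] by (simp only: prod.case)
  finally show ?thesis ..
qed

text \<open>
  One step draws a fresh event and reproduces the law of the residual times (\<open>race_law\<close>).  Dropping an
  interarrival time does no harm, because the decision to do so depends on the history only, of which
  the residual times are independent (\<open>XY_shift\<close>).
\<close>

lemma chain_law:
  assumes "f \<in> borel_measurable (S \<Otimes>\<^sub>M XY_law)"
  shows "(\<integral>\<^sup>+z. f (chain T n z) \<partial>XY_law) = (\<integral>\<^sup>+h. \<integral>\<^sup>+z. f (history_upto n h, z) \<partial>XY_law \<partial>S)"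
  using assms
proof (induction n arbitrary: f)
  case 0
  have "history_upto 0 h = (\<lambda>_. (False, 0))" for h by (simp add: history_upto_def)
  then show ?case by (simp only: chain.simps nn_integral_const P.emeasure_space_1 mult_1_right)
next
  case (Suc n)
  note f = Suc.prems
  have fz: "(\<lambda>z. f (h, z)) \<in> borel_measurable XY_law" for h
    by (rule measurable_compose[OF measurable_Pair1' f]) simp
  have inner: "(\<integral>\<^sup>+z. f (race_step T n (history_upto n h, z)) \<partial>XY_law) =
      (\<integral>\<^sup>+e. \<integral>\<^sup>+z. f (history_upto (Suc n) (h(n := e)), z) \<partial>XY_law \<partial>event_law)" for h
  proof -
    let ?k = "\<lambda>e. (history_upto n h)(n := e)"
    let ?g = "\<lambda>(e, z). f (?k e, if idles T (?k e) n then (\<lambda>i. fst z (Suc i), snd z) else z)"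
    have k: "?k \<in> measurable event_law S"
      by (rule measurable_history_update) (simp_all add: space_PiM)
    have k1: "(\<lambda>p. ?k (fst p)) \<in> measurable (event_law \<Otimes>\<^sub>M XY_law) S"
      by (rule measurable_compose[OF measurable_fst k])
    have sh: "(\<lambda>p. (\<lambda>i. fst (snd p) (Suc i), snd (snd p))) \<in> measurable (event_law \<Otimes>\<^sub>M XY_law) XY_law"
      by (rule measurable_Pair[OF measurable_compose[OF measurable_compose[OF measurable_snd measurable_fst] X.measurable_tail]
            measurable_compose[OF measurable_snd measurable_snd]])
    have p: "Measurable.pred (event_law \<Otimes>\<^sub>M XY_law) (\<lambda>p. idles T (?k (fst p)) n)"
      by (rule measurable_compose[OF k1 measurable_idles])
    have g: "?g \<in> borel_measurable (event_law \<Otimes>\<^sub>M XY_law)"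
      unfolding split_beta'
      by (rule measurable_compose[OF measurable_Pair[OF k1 measurable_If[OF sh measurable_snd]] f])
         (rule p[unfolded pred_def])
    have "(\<integral>\<^sup>+z. f (race_step T n (history_upto n h, z)) \<partial>XY_law) = (\<integral>\<^sup>+z. ?g (race_event z, race_rest z) \<partial>XY_law)"
      by (simp only: race_step_def Let_def fst_conv snd_conv prod.case)
    also have "\<dots> = (\<integral>\<^sup>+e. \<integral>\<^sup>+z. ?g (e, z) \<partial>XY_law \<partial>event_law)"
      by (rule race_law[OF g])
    also have "\<dots> = (\<integral>\<^sup>+e. \<integral>\<^sup>+z. f (history_upto (Suc n) (h(n := e)), z) \<partial>XY_law \<partial>event_law)"
    proof (rule nn_integral_cong)
      fix e
      have ke: "?k e = history_upto (Suc n) (h(n := e))"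
        by (auto simp: history_upto_def fun_eq_iff)
      show "(\<integral>\<^sup>+z. ?g (e, z) \<partial>XY_law) = (\<integral>\<^sup>+z. f (history_upto (Suc n) (h(n := e)), z) \<partial>XY_law)"
      proof (cases "idles T (?k e) n")
        case True
        then show ?thesis unfolding ke[symmetric] using XY_shift[OF fz[of "?k e"]]
          by (simp only: prod.case if_True)
      next
        case False
        then show ?thesis unfolding ke[symmetric] by (simp only: prod.case if_False)
      qed
    qed
    finally show ?thesis .
  qed
  have "(\<integral>\<^sup>+z. f (chain T (Suc n) z) \<partial>XY_law) = (\<integral>\<^sup>+z. f (race_step T n (chain T n z)) \<partial>XY_law)"
    by (simp only: chain.simps)
  also have "\<dots> = (\<integral>\<^sup>+h. \<integral>\<^sup>+z. f (race_step T n (history_upto n h, z)) \<partial>XY_law \<partial>S)"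
    by (rule Suc.IH[OF measurable_compose[OF measurable_race_step f]])
  also have "\<dots> = (\<integral>\<^sup>+h. \<integral>\<^sup>+e. \<integral>\<^sup>+z. f (history_upto (Suc n) (h(n := e)), z) \<partial>XY_law \<partial>event_law \<partial>S)"
    by (simp only: inner)
  also have "\<dots> = (\<integral>\<^sup>+h. \<integral>\<^sup>+z. f (history_upto (Suc n) h, z) \<partial>XY_law \<partial>S)"
    by (rule history_resample,
        rule measurable_compose[OF measurable_history_upto XY.P.borel_measurable_nn_integral_fst[OF f]])
  finally show ?case .
qed

lemma measurable_event_seq: "event_seq T \<in> measurable XY_law S"
proof (rule measurable_PiM_single')
  fix i
  show "(\<lambda>z. event_seq T z i) \<in> measurable XY_law event_law"
    unfolding event_seq_def
    by (rule measurable_compose[OF measurable_compose[OF measurable_chain measurable_snd] measurable_race_event])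
qed (simp add: space_PiM)

lemma event_seq_law: "distr XY_law S (event_seq T) = S"
proof (rule PiM_eq)
  fix J :: "nat set" and F assume J: "finite J" "J \<subseteq> UNIV" "\<And>j. j \<in> J \<Longrightarrow> F j \<in> sets event_law"
  let ?B = "prod_emb UNIV (\<lambda>_. event_law) J (\<Pi>\<^sub>E j\<in>J. F j)"
  have B: "?B \<in> sets S" using J by (intro sets_PiM_I) auto
  obtain n where n: "\<And>j. j \<in> J \<Longrightarrow> j < n" using J(1) by (meson finite_nat_set_iff_bounded)
  have local: "h \<in> ?B \<longleftrightarrow> h' \<in> ?B" if "\<And>j. j < n \<Longrightarrow> h j = h' j" for h h'
    using that n by (auto simp: prod_emb_def PiE_iff)
  have "emeasure (distr XY_law S (event_seq T)) ?B = (\<integral>\<^sup>+h. indicator ?B h \<partial>distr XY_law S (event_seq T))"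
    using B by simp
  also have "\<dots> = (\<integral>\<^sup>+z. indicator ?B (event_seq T z) \<partial>XY_law)"
    by (rule nn_integral_distr[OF measurable_event_seq]) (simp only: measurable_distr_eq1 borel_measurable_indicator[OF B])
  also have "\<dots> = (\<integral>\<^sup>+z. indicator ?B (fst (chain T n z)) \<partial>XY_law)"
  proof (rule nn_integral_cong)
    fix z
    have "event_seq T z \<in> ?B \<longleftrightarrow> fst (chain T n z) \<in> ?B"
      by (rule local) (simp add: fst_chain)
    then show "indicator ?B (event_seq T z) = (indicator ?B (fst (chain T n z)) :: ennreal)"
      by (simp only: indicator_def)
  qed
  also have "\<dots> = (\<integral>\<^sup>+h. \<integral>\<^sup>+z. indicator ?B (fst (history_upto n h, z)) \<partial>XY_law \<partial>S)"
    by (rule chain_law, rule measurable_compose[OF measurable_fst]) (use B in simp)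
  also have "\<dots> = (\<integral>\<^sup>+h. indicator ?B h \<partial>S)"
  proof (rule nn_integral_cong)
    fix h
    have "history_upto n h \<in> ?B \<longleftrightarrow> h \<in> ?B"
      by (rule local) (simp add: history_upto_def)
    then have "indicator ?B (history_upto n h) = (indicator ?B h :: ennreal)"
      by (simp only: indicator_def)
    then show "(\<integral>\<^sup>+z. indicator ?B (fst (history_upto n h, z)) \<partial>XY_law) = (indicator ?B h :: ennreal)"
      by (simp only: fst_conv nn_integral_const XY.P.emeasure_space_1 mult_1_right)
  qed
  also have "\<dots> = emeasure S ?B" using B by simp
  also have "\<dots> = (\<Prod>j\<in>J. emeasure event_law (F j))"
    using J by (intro emeasure_PiM_emb) auto
  finally show "emeasure (distr XY_law S (event_seq T)) ?B = (\<Prod>j\<in>J. emeasure event_law (F j))" .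
qed simp

lemma pred_untied: "Measurable.pred XY_law untied"
proof -
  have x: "(\<lambda>z. fst z 0) \<in> borel_measurable XY_law" and y: "(\<lambda>z. snd z 0) \<in> borel_measurable XY_law"
    using measurable_compose[OF measurable_fst measurable_X_component[of 0]]
      measurable_compose[OF measurable_snd measurable_Y_component[of 0]] by simp_all
  then show ?thesis unfolding untied_def[abs_def] by (intro pred_intros_logic) simp_all
qed

lemma AE_exponential: "0 < r \<Longrightarrow> AE t in density lborel (exponential_density r). 0 < t \<and> t \<noteq> c"
proof -
  assume r: "0 < r"
  have "AE t in lborel. t \<noteq> (0::real)" "AE t in lborel. t \<noteq> c" by (rule AE_lborel_singleton)+
  then have "AE t in lborel. 0 < ennreal (exponential_density r t) \<longrightarrow> 0 < t \<and> t \<noteq> c"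
    by eventually_elim (auto simp: exponential_density_def)
  then show ?thesis by (subst AE_density) auto
qed

lemma AE_untied: "AE z in XY_law. untied z"
proof -
  have x: "AE x in X.S. 0 < x 0"
    by (rule X.AE_component) (use AE_exponential[OF l_pos, of 0] in auto)
  have y: "AE y in Y.S. 0 < y 0 \<and> y 0 \<noteq> c" for c
    by (rule Y.AE_component) (use AE_exponential[OF m_pos, of c] in auto)
  show ?thesis
  proof (rule XY.AE_pair_measure)
    show "{z \<in> space XY_law. untied z} \<in> sets XY_law" using pred_untied by (simp add: pred_def)
    show "AE x in X.S. AE y in Y.S. untied (x, y)"
      using x
    proof eventually_elim
      case (elim x)
      show ?case using y[of "x 0"] by eventually_elim (use elim in \<open>auto simp: untied_def\<close>)
    qed
  qed
qed

lemma AE_chain_untied: "AE z in XY_law. \<forall>n. untied (snd (chain T n z))"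
proof -
  have B: "{z \<in> space XY_law. \<not> untied z} \<in> sets XY_law"
    using pred_untied by measurable
  have "AE z in XY_law. untied (snd (chain T n z))" for n
  proof -
    let ?I = "indicator {z \<in> space XY_law. \<not> untied z} :: _ \<Rightarrow> ennreal"
    have Im: "?I \<in> borel_measurable XY_law" using B by simp
    have I0: "(\<integral>\<^sup>+z. ?I z \<partial>XY_law) = 0"
      using AE_untied AE_iff_measurable[OF B refl] B by simp
    have "(\<integral>\<^sup>+z. ?I (snd (chain T n z)) \<partial>XY_law) = (\<integral>\<^sup>+h. \<integral>\<^sup>+z. ?I (snd (history_upto n h, z)) \<partial>XY_law \<partial>S)"
      by (rule chain_law, rule measurable_compose[OF measurable_snd Im])
    also have "\<dots> = 0" by (simp only: snd_conv I0 nn_integral_const mult_zero_left)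
    finally have z: "(\<integral>\<^sup>+z. ?I (snd (chain T n z)) \<partial>XY_law) = 0" .
    have "AE z in XY_law. ?I (snd (chain T n z)) = 0"
      using z nn_integral_0_iff_AE[OF measurable_compose[OF measurable_compose[OF measurable_chain measurable_snd] Im]]
      by blast
    then show ?thesis
      by eventually_elim (auto simp: indicator_def space_pair_measure space_PiM split: if_splits)
  qed
  then show ?thesis by (simp add: AE_all_countable)
qed

end

section \<open>The queue as a function of the events\<close>

lemma clock_strict_mono:
  assumes "\<And>j. 0 < snd (h j)" "m < n"
  shows "clock h m < clock h n"
proof -
  have "strict_mono (clock h)"
    using assms(1) by (intro strict_monoI_Suc) (simp add: clock_Suc)
  then show ?thesis using assms(2) by (simp add: strict_mono_less)
qed

lemma completion_exists:
  assumes "\<And>n. \<exists>j\<ge>n. \<not> fst (h j)"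
  shows "\<exists>j. \<not> fst (h j) \<and> completions h j = k"
proof -
  have "\<exists>N. k \<le> completions h N" for k
  proof (induction k)
    case (Suc k)
    then obtain N where N: "k \<le> completions h N" by blast
    obtain j where "j \<ge> N" "\<not> fst (h j)" using assms by blast
    then show ?case using N completions_mono[of N j h] by (intro exI[of _ "Suc j"]) simp
  qed simp
  then obtain N where N: "Suc k \<le> completions h N" by blast
  define M where "M = (LEAST N. Suc k \<le> completions h N)"
  have M: "Suc k \<le> completions h M" unfolding M_def using N by (rule LeastI)
  then obtain j where j: "M = Suc j" by (cases M) auto
  have "\<not> Suc k \<le> completions h j" using not_less_Least[of j "\<lambda>N. Suc k \<le> completions h N"] j M_def by simp
  then show ?thesis using M j by (intro exI[of _ j]) (auto split: if_splits)
qed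

text \<open>
  The number of the customer who arrived last.  A customer who ends an idle time is counted together with
  the completion that began this idle time.
\<close>

primrec arrived :: "ereal \<Rightarrow> (nat \<Rightarrow> bool \<times> real) \<Rightarrow> nat \<Rightarrow> nat" where
  "arrived T h 0 = 0"
| "arrived T h (Suc n) = (if fst (h n) \<or> idles T h n then Suc (arrived T h n) else arrived T h n)"

text \<open>
  A single path of the queue, outside of the null set where ties occur.
\<close>

locale queue_path =
  fixes x y :: "nat \<Rightarrow> real" and T :: ereal
  assumes T_pos: "0 < T"
    and x_pos: "\<And>i. 0 < x (Suc i)" and y_pos: "\<And>i. 0 < y (Suc i)"
    and untied_chain: "\<And>n. untied (snd (chain T n (\<lambda>i. x (Suc i), \<lambda>i. y (Suc i))))"
begin

abbreviation z0 :: "(nat \<Rightarrow> real) \<times> (nat \<Rightarrow> real)" where "z0 \<equiv> (\<lambda>i. x (Suc i), \<lambda>i. y (Suc i))"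
abbreviation e :: "nat \<Rightarrow> bool \<times> real" where "e \<equiv> event_seq T z0"
abbreviation A :: "nat \<Rightarrow> real" where "A \<equiv> arrival_time x"
abbreviation t :: "nat \<Rightarrow> real" where "t k \<equiv> fst (server_state x y T k)"
abbreviation served :: "nat \<Rightarrow> nat set" where "served k \<equiv> snd (server_state x y T k)"
abbreviation cust :: "nat \<Rightarrow> nat" where "cust \<equiv> served_customer x y T"
abbreviation wait :: "nat \<Rightarrow> real" where "wait \<equiv> served_wait x y T"

definition u :: "nat \<Rightarrow> nat \<Rightarrow> real" where "u n = fst (snd (chain T n z0))"
definition v :: "nat \<Rightarrow> nat \<Rightarrow> real" where "v n = snd (snd (chain T n z0))"
text \<open>
  Real time after \<open>n\<close> events and after a possible idle time that follows them.
\<close>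

definition now :: "nat \<Rightarrow> real" where "now n = A (Suc (arrived T e n)) - u n 0"
definition age :: "nat \<Rightarrow> nat \<Rightarrow> real" where "age n i = clock e n - clock e (Suc i)"

lemma A_0 [simp]: "A 0 = 0" and A_Suc: "A (Suc n) = A n + x (Suc n)"
  by (simp_all add: arrival_time_def)

lemma A_strict_mono: "strict_mono A"
  using x_pos by (intro strict_monoI_Suc) (simp add: A_Suc)

lemma A_less: "A i < A j \<longleftrightarrow> i < j" and A_le: "A i \<le> A j \<longleftrightarrow> i \<le> j" and A_eq: "A i = A j \<longleftrightarrow> i = j"
  using A_strict_mono by (auto simp: strict_mono_less strict_mono_less_eq strict_mono_eq)

lemma u_v_pos: "0 < u n 0" "0 < v n 0" "u n 0 \<noteq> v n 0"
  using untied_chain[of n] by (simp_all add: u_def v_def untied_def)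

lemma e_eq: "e n = (if u n 0 < v n 0 then (True, u n 0) else (False, v n 0))"
  by (simp add: event_seq_def race_event_def u_def v_def)

lemma gap_pos: "0 < snd (e n)"
  using u_v_pos[of n] by (simp add: e_eq)

lemma idles_chain: "idles T ((fst (chain T n z0))(n := race_event (snd (chain T n z0)))) n \<longleftrightarrow> idles T e n"
  by (rule idles_cong) (auto simp: fst_chain event_seq_def)

lemma rest_Suc: "(u (Suc n), v (Suc n)) =
    (let z = race_rest (u n, v n) in if idles T e n then (\<lambda>i. fst z (Suc i), snd z) else z)"
  using idles_chain[of n] by (simp add: u_def v_def race_step_def Let_def)

lemma rest_arrival: "fst (e n) \<Longrightarrow> u (Suc n) = (\<lambda>i. u n (Suc i))"
    "fst (e n) \<Longrightarrow> v (Suc n) = case_nat (v n 0 - u n 0) (\<lambda>i. v n (Suc i))"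
  using rest_Suc[of n] by (simp_all add: race_rest_def e_eq idles_def Let_def split: if_splits)

lemma rest_completion: "\<not> fst (e n) \<Longrightarrow> v (Suc n) = (\<lambda>i. v n (Suc i))"
    "\<not> fst (e n) \<Longrightarrow> \<not> idles T e n \<Longrightarrow> u (Suc n) = case_nat (u n 0 - v n 0) (\<lambda>i. u n (Suc i))"
    "\<not> fst (e n) \<Longrightarrow> idles T e n \<Longrightarrow> u (Suc n) = (\<lambda>i. u n (Suc i))"
  using rest_Suc[of n] by (simp_all add: race_rest_def e_eq Let_def split: if_splits)

lemma served_customer_Suc: "cust (Suc k) = next_customer x T (served k) (t k)"
  by (simp add: served_customer_def split_beta)

lemma server_state_Suc:
  "server_state x y T (Suc k) = (let c = cust (Suc k)
     in (max (t k) (A c) + y (Suc k), insert c (served k)))"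
  by (simp only: server_state.simps(2) served_customer_Suc split_beta Let_def)

lemma served_Suc: "served (Suc k) = insert (cust (Suc k)) (served k)"
  by (simp only: server_state_Suc Let_def snd_conv)

lemma t_Suc: "t (Suc k) = max (t k) (A (cust (Suc k))) + y (Suc k)"
  by (simp only: server_state_Suc Let_def fst_conv)

lemma served_wait_Suc: "wait (Suc k) =
    max (t k) (A (cust (Suc k))) - A (cust (Suc k))"
  by (simp add: served_wait_def service_start_def)

declare server_state.simps(2) [simp del]

lemma t_mono: "i \<le> j \<Longrightarrow> t i \<le> t j"
proof (rule lift_Suc_mono_le[of t])
  fix n show "t n \<le> t (Suc n)" unfolding t_Suc using y_pos[of n] by (simp add: max_def)
qed

lemma served_mono: "i \<le> j \<Longrightarrow> served i \<subseteq> served j"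
  by (rule lift_Suc_mono_le[of served]) (unfold served_Suc, blast)

lemma first_served: "cust 1 = 0"
proof -
  have "n = 0" if "A n \<le> 0" for n using A_le[of n 0] that by simp
  moreover have "ereal (0 - A 0) \<le> T" using T_pos by (simp add: zero_ereal_def[symmetric] less_imp_le)
  ultimately have "waiting_customers x T {} 0 = {0}"
    unfolding waiting_customers_def by auto
  moreover have "{n. is_arg_min (\<lambda>m. 0 - A m) (\<lambda>m. m \<in> {0}) n} = {0}"
    by (auto simp: is_arg_min_def)
  ultimately have "next_customer x T {} 0 = 0"
    unfolding next_customer_def Let_def by simp
  moreover have "cust 1 = next_customer x T {} 0"
    using served_customer_Suc[of 0] by simp
  ultimately show ?thesis by simp
qed

text \<open>
  The queue and its description by events agree after \<open>n\<close> events.  At this moment the service number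
  \<open>completions e n + 1\<close> is in progress.  The last two clauses compare the queue with the stack:
  each patient waiting customer is in the stack and has his true age there, and each entry of the stack
  with age at most \<open>T\<close> is a waiting customer.  Nothing is claimed about entries older than \<open>T\<close>, for
  which idle times may separate the busy clock from real time.
\<close>

definition coupled :: "nat \<Rightarrow> bool" where
  "coupled n \<longleftrightarrow>
     (\<forall>i. u n (Suc i) = x (Suc (arrived T e n + Suc i))) \<and>
     (\<forall>i. v n (Suc i) = y (completions e n + Suc (Suc i))) \<and>
     now n + v n 0 = t (Suc (completions e n)) \<and>
     A (arrived T e n) \<le> now n \<and>
     served (Suc (completions e n)) \<subseteq> {..arrived T e n} \<and>
     (\<forall>c\<le>arrived T e n. c \<notin> served (Suc (completions e n)) \<longrightarrow> ereal (now n - A c) \<le> T \<longrightarrow>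
        (\<exists>i\<in>set (stack e n). arrived T e (Suc i) = c \<and> age n i = now n - A c)) \<and>
     (\<forall>i\<in>set (stack e n). ereal (age n i) \<le> T \<longrightarrow>
        arrived T e (Suc i) \<notin> served (Suc (completions e n)) \<and>
        arrived T e (Suc i) \<le> arrived T e n \<and> A (arrived T e (Suc i)) = now n - age n i)"

lemma coupled_0: "coupled 0"
proof -
  have "t 1 = y 1" "served 1 = {0}"
    using t_Suc[of 0] served_Suc[of 0] first_served by simp_all
  then show ?thesis by (simp add: coupled_def u_def v_def now_def A_Suc)
qed

lemma age_Suc: "age (Suc n) i = age n i + snd (e n)"
  by (simp add: age_def clock_Suc)

lemma age_le: "i \<le> j \<Longrightarrow> age n j \<le> age n i"
  using clock_mono[of e "Suc i" "Suc j"] gap_pos by (simp add: age_def less_imp_le)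

lemma age_less: "i < j \<Longrightarrow> age n j < age n i"
  using clock_strict_mono[of e "Suc i" "Suc j"] gap_pos by (simp add: age_def)

lemma age_pos: "i < n \<Longrightarrow> 0 < age (Suc n) i"
  using clock_strict_mono[of e "Suc i" "Suc n"] gap_pos by (simp add: age_def)

lemma hit_iff_age: "hit T e n \<longleftrightarrow> \<not> fst (e n) \<and> stack e n \<noteq> [] \<and> ereal (age (Suc n) (hd (stack e n))) \<le> T"
  by (simp add: hit_def age_def)

lemma hd_stack_max: "i \<in> set (stack e n) \<Longrightarrow> i \<le> hd (stack e n)"
  using stack_sorted[of e n] by (cases "stack e n") auto

lemma ereal_le_trans: "a \<le> b \<Longrightarrow> ereal b \<le> T \<Longrightarrow> ereal a \<le> T"
  by (meson ereal_less_eq(3) order_trans)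

lemma coupled_arrival:
  assumes I: "coupled n" and e: "fst (e n)"
  shows "coupled (Suc n)"
proof -
  let ?a = "arrived T e n" and ?k = "completions e n"
  have U: "u n (Suc i) = x (Suc (?a + Suc i))" for i using I by (simp add: coupled_def)
  have V: "v n (Suc i) = y (?k + Suc (Suc i))" for i using I by (simp add: coupled_def)
  have gap: "snd (e n) = u n 0" using e by (simp add: e_eq split: if_splits)
  have a: "arrived T e (Suc n) = Suc ?a" and k: "completions e (Suc n) = ?k"
    and st: "stack e (Suc n) = n # stack e n" using e by simp_all
  have now: "now (Suc n) = now n + u n 0" "now (Suc n) = A (Suc ?a)"
    using U[of 0] unfolding now_def a by (simp_all add: rest_arrival[OF e] A_Suc)
  have nowt: "now n + v n 0 = t (Suc ?k)" and Sv: "served (Suc ?k) \<subseteq> {..?a}"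
    using I by (simp_all add: coupled_def)
  have age_n: "age (Suc n) n = 0" by (simp add: age_def)
  have 1: "\<exists>i\<in>set (stack e (Suc n)). arrived T e (Suc i) = c \<and> age (Suc n) i = now (Suc n) - A c"
    if c: "c \<le> Suc ?a" "c \<notin> served (Suc ?k)" "ereal (now (Suc n) - A c) \<le> T" for c
  proof (cases "c = Suc ?a")
    case True
    then show ?thesis using a st age_n now(2) by auto
  next
    case False
    have "ereal (now n - A c) \<le> T"
      using c(3) now(1) u_v_pos[of n] by (intro ereal_le_trans[OF _ c(3)]) simp
    then obtain i where "i \<in> set (stack e n)" "arrived T e (Suc i) = c" "age n i = now n - A c"
      using I c False unfolding coupled_def by (metis le_SucE)
    then show ?thesis using st now(1) by (auto simp: age_Suc gap)
  qed
  have 2: "arrived T e (Suc i) \<notin> served (Suc ?k) \<and> arrived T e (Suc i) \<le> Suc ?a \<and>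
      A (arrived T e (Suc i)) = now (Suc n) - age (Suc n) i"
    if i: "i \<in> set (stack e (Suc n))" "ereal (age (Suc n) i) \<le> T" for i
  proof (cases "i = n")
    case True
    then show ?thesis using Sv a age_n now(2) by auto
  next
    case False
    then have "i \<in> set (stack e n)" using i st by simp
    moreover have "ereal (age n i) \<le> T"
      using i(2) u_v_pos[of n] by (intro ereal_le_trans[OF _ i(2)]) (simp add: age_Suc gap)
    ultimately show ?thesis using I now(1) unfolding coupled_def by (fastforce simp: age_Suc gap)
  qed
  show ?thesis
    unfolding coupled_def a k
  proof (intro conjI allI impI ballI)
    show "u (Suc n) (Suc i) = x (Suc (Suc ?a + Suc i))" for i
      using U[of "Suc i"] by (simp add: rest_arrival[OF e])
    show "v (Suc n) (Suc i) = y (?k + Suc (Suc i))" for i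
      using V[of i] by (simp add: rest_arrival[OF e])
    show "now (Suc n) + v (Suc n) 0 = t (Suc ?k)"
      using now(1) nowt by (simp add: rest_arrival[OF e])
    show "A (Suc ?a) \<le> now (Suc n)" using now(2) by simp
    show "served (Suc ?k) \<subseteq> {..Suc ?a}" using Sv by auto
  qed (use 1 2 in \<open>auto simp del: stack.simps arrived.simps\<close>)
qed

text \<open>
  At a completion the patient waiting customers are the entries of the stack with age at most \<open>T\<close>, and
  the top is the youngest of them.  If even the top is too old, so are all others, and the server waits
  for the next arrival.
\<close>

lemma completion_step:
  assumes I: "coupled n" and e: "\<not> fst (e n)"
  shows "wait (Suc (Suc (completions e n))) = (if hit T e n then age (Suc n) (hd (stack e n)) else 0)"
    and "\<not> hit T e n \<Longrightarrow> cust (Suc (Suc (completions e n))) = Suc (arrived T e n)"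
    and "coupled (Suc n)"
proof -
  let ?a = "arrived T e n" and ?k = "completions e n"
  let ?t = "t (Suc ?k)" and ?c = "cust (Suc (Suc ?k))"
  let ?Q = "waiting_customers x T (served (Suc ?k)) ?t"
  have U: "u n (Suc i) = x (Suc (?a + Suc i))" for i using I by (simp add: coupled_def)
  have V: "v n (Suc i) = y (?k + Suc (Suc i))" for i using I by (simp add: coupled_def)
  have gap: "snd (e n) = v n 0" and lt: "v n 0 < u n 0"
    using e u_v_pos[of n] by (simp_all add: e_eq split: if_splits)
  have k: "completions e (Suc n) = Suc ?k" and st: "stack e (Suc n) = tl (stack e n)" using e by simp_all
  have nowt: "now n + v n 0 = ?t" and Sv: "served (Suc ?k) \<subseteq> {..?a}" and An: "A ?a \<le> now n"
    using I by (simp_all add: coupled_def)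
  have At: "A ?a < ?t" "?t < A (Suc ?a)"
    using An nowt u_v_pos[of n] lt by (simp_all add: now_def)
  have Q_le: "c \<le> ?a" if "c \<in> ?Q" for c
    using that At(2) A_less[of c "Suc ?a"] by (auto simp: waiting_customers_def)
  have Q_stack: "\<exists>i\<in>set (stack e n). arrived T e (Suc i) = c \<and> age (Suc n) i = ?t - A c" if c: "c \<in> ?Q" for c
  proof -
    have "ereal (?t - A c) \<le> T" "c \<notin> served (Suc ?k)" using c by (auto simp: waiting_customers_def)
    moreover have "ereal (now n - A c) \<le> T"
      using calculation(1) nowt u_v_pos[of n] by (intro ereal_le_trans[OF _ calculation(1)]) simp
    ultimately obtain i where "i \<in> set (stack e n)" "arrived T e (Suc i) = c" "age n i = now n - A c"
      using I Q_le[OF c] unfolding coupled_def by blast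
    then show ?thesis using nowt by (auto simp: age_Suc gap)
  qed
  have alive: "arrived T e (Suc i) \<in> ?Q \<and> arrived T e (Suc i) \<le> ?a \<and> A (arrived T e (Suc i)) = ?t - age (Suc n) i"
    if i: "i \<in> set (stack e n)" "ereal (age (Suc n) i) \<le> T" for i
  proof -
    have "ereal (age n i) \<le> T"
      using u_v_pos[of n] by (intro ereal_le_trans[OF _ i(2)]) (simp add: age_Suc gap)
    then have *: "arrived T e (Suc i) \<notin> served (Suc ?k)" "arrived T e (Suc i) \<le> ?a"
        "A (arrived T e (Suc i)) = now n - age n i"
      using I i(1) unfolding coupled_def by blast+
    then have eq: "A (arrived T e (Suc i)) = ?t - age (Suc n) i" using nowt by (simp add: age_Suc gap)
    have "A (arrived T e (Suc i)) \<le> ?t" using * At A_le[of "arrived T e (Suc i)" ?a] by linarith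
    then show ?thesis using * eq i(2) by (simp add: waiting_customers_def)
  qed
  have c_eq: "?c = next_customer x T (served (Suc ?k)) ?t" by (rule served_customer_Suc)
  have vS: "v (Suc n) (Suc i) = y (Suc ?k + Suc (Suc i))" for i
    using V[of "Suc i"] by (simp add: rest_completion(1)[OF e])
  have v0: "v (Suc n) 0 = y (Suc (Suc ?k))" using V[of 0] by (simp add: rest_completion(1)[OF e])
  have main: "wait (Suc (Suc ?k)) = (if hit T e n then age (Suc n) (hd (stack e n)) else 0)
    \<and> (\<not> hit T e n \<longrightarrow> ?c = Suc ?a) \<and> coupled (Suc n)"
  proof (cases "hit T e n")
    case hit: True
    define i where "i = hd (stack e n)"
    define c0 where "c0 = arrived T e (Suc i)"
    have ne: "stack e n \<noteq> []" and i_in: "i \<in> set (stack e n)" and i_T: "ereal (age (Suc n) i) \<le> T"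
      using hit by (auto simp: hit_iff_age i_def)
    have tl_stack: "stack e n = i # tl (stack e n)" using ne by (simp add: i_def)
    have c0: "c0 \<in> ?Q" "c0 \<le> ?a" "A c0 = ?t - age (Suc n) i"
      using alive[OF i_in i_T] by (simp_all add: c0_def)
    have max: "A c \<le> A c0" if c: "c \<in> ?Q" for c
    proof -
      obtain j where j: "j \<in> set (stack e n)" "age (Suc n) j = ?t - A c" using Q_stack[OF c] by blast
      have "age (Suc n) i \<le> age (Suc n) j" using hd_stack_max[OF j(1)] by (intro age_le) (simp add: i_def)
      then show ?thesis using j c0 by simp
    qed
    have "{c. is_arg_min (\<lambda>m. ?t - A m) (\<lambda>m. m \<in> ?Q) c} = {c0}"
    proof -
      have "is_arg_min (\<lambda>m. ?t - A m) (\<lambda>m. m \<in> ?Q) c \<longleftrightarrow> c = c0" for c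
        unfolding is_arg_min_def using c0(1) max[of c] max A_eq[of c c0] by force
      then show ?thesis by auto
    qed
    then have c: "?c = c0" using c0(1) by (auto simp: c_eq next_customer_def Let_def)
    have a: "arrived T e (Suc n) = ?a" using e hit by (simp add: idles_def)
    have u': "u (Suc n) = case_nat (u n 0 - v n 0) (\<lambda>i. u n (Suc i))"
      using hit by (intro rest_completion(2)[OF e]) (simp add: idles_def)
    have now: "now (Suc n) = ?t" unfolding now_def a u' using nowt by (simp add: now_def)
    have At0: "A c0 < ?t" using c0(2) At(1) A_le[of c0 ?a] by linarith
    have w: "wait (Suc (Suc ?k)) = age (Suc n) i"
      unfolding served_wait_Suc c using c0(3) At0 by simp
    have t2: "t (Suc (Suc ?k)) = ?t + y (Suc (Suc ?k))"
      unfolding t_Suc[of "Suc ?k"] c using At0 by simp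
    have S2: "served (Suc (Suc ?k)) = insert c0 (served (Suc ?k))"
      unfolding served_Suc[of "Suc ?k"] c ..
    have 1: "\<exists>j\<in>set (stack e (Suc n)). arrived T e (Suc j) = d \<and> age (Suc n) j = now (Suc n) - A d"
      if d: "d \<le> ?a" "d \<notin> served (Suc (Suc ?k))" "ereal (now (Suc n) - A d) \<le> T" for d
    proof -
      have "A d \<le> ?t" using d(1) At A_le[of d ?a] by linarith
      then have "d \<in> ?Q" using d now S2 by (simp add: waiting_customers_def)
      from Q_stack[OF this] obtain j where j: "j \<in> set (stack e n)" "arrived T e (Suc j) = d" "age (Suc n) j = ?t - A d"
        by blast
      have "j \<noteq> i" using j(2) d(2) S2 c0_def by auto
      then have "j \<in> set (tl (stack e n))" using j(1) tl_stack by (metis set_ConsD)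
      then show ?thesis using j now st by auto
    qed
    have 2: "arrived T e (Suc j) \<notin> served (Suc (Suc ?k)) \<and> arrived T e (Suc j) \<le> ?a \<and>
        A (arrived T e (Suc j)) = now (Suc n) - age (Suc n) j"
      if j: "j \<in> set (stack e (Suc n))" "ereal (age (Suc n) j) \<le> T" for j
    proof -
      have jn: "j \<in> set (stack e n)" using j(1) st ne by (simp add: list.set_sel(2))
      have "j < i" using stack_sorted[of e n] tl_stack j(1) st by (metis sorted_wrt.simps(2))
      have al: "arrived T e (Suc j) \<in> ?Q" "arrived T e (Suc j) \<le> ?a" "A (arrived T e (Suc j)) = ?t - age (Suc n) j"
        using alive[OF jn j(2)] by simp_all
      have "A (arrived T e (Suc j)) \<noteq> A c0" using age_less[OF \<open>j < i\<close>, of "Suc n"] al c0 by simp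
      then show ?thesis using al now S2 by (auto simp: waiting_customers_def)
    qed
    have "coupled (Suc n)"
      unfolding coupled_def a k
    proof (intro conjI allI impI ballI)
      show "u (Suc n) (Suc i) = x (Suc (?a + Suc i))" for i using U[of i] by (simp add: u')
      show "v (Suc n) (Suc i) = y (Suc ?k + Suc (Suc i))" for i by (rule vS)
      show "now (Suc n) + v (Suc n) 0 = t (Suc (Suc ?k))" using now t2 v0 by simp
      show "A ?a \<le> now (Suc n)" using now At by simp
      show "served (Suc (Suc ?k)) \<subseteq> {..?a}" using S2 Sv c0 by auto
    qed (use 1 2 in \<open>auto simp del: stack.simps arrived.simps server_state.simps\<close>)
    then show ?thesis using w hit by (simp add: i_def)
  next
    case idle: False
    have idles: "idles T e n" using idle e by (simp add: idles_def)
    \<comment> \<open>all entries are at least as old as the top\<close>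
    have dead: "\<not> ereal (age (Suc n) j) \<le> T" if j: "j \<in> set (stack e n)" for j
    proof
      assume "ereal (age (Suc n) j) \<le> T"
      then have "ereal (age (Suc n) (hd (stack e n))) \<le> T"
        by (rule ereal_le_trans[rotated]) (rule age_le[OF hd_stack_max[OF j]])
      then show False using idle e j by (auto simp: hit_iff_age)
    qed
    have Q: "?Q = {}"
    proof (rule ccontr)
      assume "?Q \<noteq> {}"
      then obtain c where c: "c \<in> ?Q" by blast
      obtain i where "i \<in> set (stack e n)" "age (Suc n) i = ?t - A c" using Q_stack[OF c] by blast
      moreover have "ereal (?t - A c) \<le> T" using c by (simp add: waiting_customers_def)
      ultimately show False using dead by metis
    qed
    have "(LEAST j. ?t < A j) = Suc ?a"
    proof (rule Least_equality)
      show "?t < A (Suc ?a)" by (rule At)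
      show "Suc ?a \<le> j" if "?t < A j" for j using that At(1) A_less[of ?a j] by linarith
    qed
    then have c: "?c = Suc ?a" using Q by (simp add: c_eq next_customer_def)
    have a: "arrived T e (Suc n) = Suc ?a" using idles by simp
    have u': "u (Suc n) = (\<lambda>i. u n (Suc i))" by (rule rest_completion(3)[OF e idles])
    have now: "now (Suc n) = A (Suc ?a)" unfolding now_def a u' using U[of 0] by (simp add: A_Suc)
    have w: "wait (Suc (Suc ?k)) = 0"
      unfolding served_wait_Suc c using At(2) by simp
    have t2: "t (Suc (Suc ?k)) = A (Suc ?a) + y (Suc (Suc ?k))"
      unfolding t_Suc[of "Suc ?k"] c using At(2) by simp
    have S2: "served (Suc (Suc ?k)) = insert (Suc ?a) (served (Suc ?k))"
      unfolding served_Suc[of "Suc ?k"] c ..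
    have 1: "False"
      if d: "d \<le> Suc ?a" "d \<notin> served (Suc (Suc ?k))" "ereal (now (Suc n) - A d) \<le> T" for d
    proof -
      have "d \<noteq> Suc ?a" using d(2) S2 by auto
      then have "d \<le> ?a" using d(1) by simp
      then have "A d \<le> ?t" using At A_le[of d ?a] by linarith
      moreover have "ereal (?t - A d) \<le> T" using At(2) now by (intro ereal_le_trans[OF _ d(3)]) simp
      ultimately have "d \<in> ?Q" using d S2 by (simp add: waiting_customers_def)
      then show False using Q by simp
    qed
    have 2: "False" if j: "j \<in> set (stack e (Suc n))" "ereal (age (Suc n) j) \<le> T" for j
      using dead[of j] j st by (metis list.set_sel(2) empty_iff list.set(1) tl_Nil)
    have "coupled (Suc n)"
      unfolding coupled_def a k
    proof (intro conjI allI impI ballI)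
      show "u (Suc n) (Suc i) = x (Suc (Suc ?a + Suc i))" for i using U[of "Suc i"] by (simp add: u')
      show "v (Suc n) (Suc i) = y (Suc ?k + Suc (Suc i))" for i by (rule vS)
      show "now (Suc n) + v (Suc n) 0 = t (Suc (Suc ?k))" using now t2 v0 by simp
      show "A (Suc ?a) \<le> now (Suc n)" using now by simp
      show "served (Suc (Suc ?k)) \<subseteq> {..Suc ?a}" using S2 Sv by auto
    qed (auto simp del: stack.simps arrived.simps dest: 1 2)
    then show ?thesis using w idle c by simp
  qed
  from main show "wait (Suc (Suc ?k)) = (if hit T e n then age (Suc n) (hd (stack e n)) else 0)"
    and "\<not> hit T e n \<Longrightarrow> ?c = Suc ?a" and "coupled (Suc n)" by blast+
qed

lemma coupled: "coupled n"
  by (induction n) (use coupled_0 coupled_arrival completion_step(3) in blast)+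

lemma served_wait_event:
  assumes "\<not> fst (e n)"
  shows "wait (Suc (Suc (completions e n))) = (if hit T e n then age (Suc n) (hd (stack e n)) else 0)"
  by (rule completion_step(1)[OF coupled assms])

lemma hit_wait_pos: "hit T e n \<Longrightarrow> 0 < age (Suc n) (hd (stack e n))"
  by (rule age_pos) (use stack_less[of "hd (stack e n)" e n] in \<open>simp add: hit_def\<close>)

lemma arrived_in_cycle: "in_cycle T e n \<Longrightarrow> arrived T e n = card {j. j < n \<and> fst (e j)}"
proof (induction n)
  case (Suc n)
  have "{j. j < Suc n \<and> fst (e j)} = (if fst (e n) then insert n {j. j < n \<and> fst (e j)} else {j. j < n \<and> fst (e j)})"
    by (auto simp: less_Suc_eq)
  then show ?case using Suc by (auto simp: in_cycle_Suc)
qed simp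

lemma customer_wait_0D:
  assumes "customer_wait x y T c = 0"
  obtains k where "1 \<le> k" "cust k = c" "wait k = 0"
proof -
  from assms have ex: "\<exists>k\<ge>1. cust k = c" unfolding customer_wait_def by (auto split: if_splits)
  define k where "k = (LEAST k. 1 \<le> k \<and> cust k = c)"
  have "1 \<le> k \<and> cust k = c"
    unfolding k_def using ex by (metis (mono_tags, lifting) LeastI)
  moreover have "wait k = 0"
    using assms ex unfolding customer_wait_def k_def by (auto simp: zero_ereal_def split: if_splits)
  ultimately show ?thesis using that by blast
qed

text \<open>
  The first customer after customer \<open>0\<close> who does not wait is the one who arrives after the first idling
  completion.  His number is one plus the number of arrivals during the first busy period.
  If the server never becomes idle, both sides are infinite.
\<close>

lemma tau_eq:
  assumes comp: "\<And>n. \<exists>j\<ge>n. \<not> fst (e j)" and arr: "\<And>n. \<exists>j\<ge>n. fst (e j)"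
  shows "ennreal_of_enat (tau x y T) = 1 + (\<Sum>n. indicator {h. in_cycle T h n \<and> fst (h n)} e)"
proof -
  have zero: "\<exists>n. \<not> fst (e n) \<and> completions e n = k - 2 \<and> k = Suc (Suc (completions e n)) \<and> \<not> hit T e n"
    if k: "1 \<le> k" "cust k = c" "wait k = 0" "1 \<le> c" for k c
  proof -
    have "k \<noteq> 1" using k first_served by auto
    then have k2: "k = Suc (Suc (k - 2))" using k by simp
    obtain n where n: "\<not> fst (e n)" "completions e n = k - 2" using completion_exists[OF comp] by blast
    then show ?thesis using k k2 served_wait_event[OF n(1)] hit_wait_pos[of n] by (metis order_less_irrefl)
  qed
  show ?thesis
  proof (cases "\<exists>n. idles T e n")
    case False
    then have cyc: "in_cycle T e n" for n by (simp add: in_cycle_def)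
    have none: "{enat n |n. 1 \<le> n \<and> customer_wait x y T n = 0} = {}"
    proof (rule ccontr)
      assume "{enat n |n. 1 \<le> n \<and> customer_wait x y T n = 0} \<noteq> {}"
      then obtain c where c: "1 \<le> c" "customer_wait x y T c = 0" by blast
      from customer_wait_0D[OF c(2)] zero c(1) False show False unfolding idles_def by metis
    qed
    have tau: "tau x y T = \<infinity>" unfolding tau_def none by (simp add: Inf_enat_def)
    have "(\<Sum>n. indicator {h. in_cycle T h n \<and> fst (h n)} e :: ennreal) = \<infinity>"
    proof (rule ccontr)
      assume fin: "(\<Sum>n. indicator {h. in_cycle T h n \<and> fst (h n)} e :: ennreal) \<noteq> \<infinity>"
      have "summable (\<lambda>n. indicator {h. in_cycle T h n \<and> fst (h n)} e :: real)"
        using fin by (intro summable_suminf_not_top) (simp_all add: ennreal_indicator)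
      then have "(\<lambda>n. indicator {h. in_cycle T h n \<and> fst (h n)} e :: real) \<longlonglongrightarrow> 0"
        by (rule summable_LIMSEQ_zero)
      then have "eventually (\<lambda>n. (indicator {h. in_cycle T h n \<and> fst (h n)} e :: real) < 1) sequentially"
        by (rule order_tendstoD) simp
      then obtain N where "\<And>n. n \<ge> N \<Longrightarrow> (indicator {h. in_cycle T h n \<and> fst (h n)} e :: real) < 1"
        by (auto simp: eventually_sequentially)
      moreover obtain j where "j \<ge> N" "fst (e j)" using arr by blast
      ultimately show False using cyc by fastforce
    qed
    then show ?thesis by (simp add: tau)
  next
    case True
    define n0 where "n0 = (LEAST n. idles T e n)"
    have idle: "idles T e n0" unfolding n0_def using True by (metis LeastI)
    have before: "\<not> idles T e j" if "j < n0" for j using that unfolding n0_def by (rule not_less_Least)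
    have cyc: "in_cycle T e n \<longleftrightarrow> n \<le> n0" for n
      unfolding in_cycle_def using idle before by (meson not_le order_less_le_trans)
    let ?a = "arrived T e n0" and ?k = "completions e n0"
    have nc: "\<not> fst (e n0)" "\<not> hit T e n0" using idle by (auto simp: idles_def)
    have "(\<Sum>n. indicator {h. in_cycle T h n \<and> fst (h n)} e :: ennreal)
        = (\<Sum>n<n0. indicator {h. in_cycle T h n \<and> fst (h n)} e)"
      using cyc nc by (intro suminf_finite) (auto simp: indicator_def le_less)
    also have "\<dots> = (\<Sum>n<n0. if fst (e n) then 1 else 0)"
      using cyc by (intro sum.cong) (auto simp: indicator_def)
    also have "\<dots> = of_nat (card {j. j < n0 \<and> fst (e j)})"
      by (simp add: sum.If_cases Int_def)
    also have "\<dots> = of_nat ?a" using arrived_in_cycle[of n0] cyc by simp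
    finally have sum: "(\<Sum>n. indicator {h. in_cycle T h n \<and> fst (h n)} e :: ennreal) = of_nat ?a" .
    have served: "cust (Suc (Suc ?k)) = Suc ?a"
      and wait: "wait (Suc (Suc ?k)) = 0"
      using completion_step(2)[OF coupled nc(1) nc(2)] served_wait_event[OF nc(1)] nc(2) by simp_all
    have served_le: "served (Suc ?k) \<subseteq> {..?a}" and A_now: "A ?a \<le> now n0" and nowt: "now n0 + v n0 0 = t (Suc ?k)"
      using coupled[of n0] by (simp_all add: coupled_def)
    have At: "A ?a < t (Suc ?k)" using A_now nowt u_v_pos[of n0] by simp
    have in_served: "cust k \<in> served (Suc ?k)" if k: "1 \<le> k" "k \<le> Suc ?k" for k
    proof -
      obtain j where j: "k = Suc j" using k(1) by (cases k) auto
      have "cust k \<in> served k" unfolding j served_Suc by simp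
      then show ?thesis using served_mono[OF k(2)] by blast
    qed
    have "(LEAST k. 1 \<le> k \<and> cust k = Suc ?a) = Suc (Suc ?k)"
    proof (rule Least_equality)
      fix k assume k: "1 \<le> k \<and> cust k = Suc ?a"
      show "Suc (Suc ?k) \<le> k"
      proof (rule ccontr)
        assume "\<not> Suc (Suc ?k) \<le> k"
        then have "Suc ?a \<in> served (Suc ?k)" using in_served[of k] k by simp
        then show False using served_le by auto
      qed
    qed (use served in simp)
    then have D: "customer_wait x y T (Suc ?a) = 0"
      unfolding customer_wait_def using served wait by (auto intro!: exI[of _ "Suc (Suc ?k)"])
    have least: "Suc ?a \<le> c" if c: "1 \<le> c" "customer_wait x y T c = 0" for c
    proof (rule ccontr)
      assume "\<not> Suc ?a \<le> c"
      then have ca: "c \<le> ?a" by simp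
      obtain k where k: "1 \<le> k" "cust k = c" "wait k = 0"
        using customer_wait_0D[OF c(2)] .
      obtain n where n: "\<not> fst (e n)" "k = Suc (Suc (completions e n))" "\<not> hit T e n"
        using zero[OF k c(1)] by blast
      have "idles T e n" using n by (simp add: idles_def)
      then have "n0 \<le> n" using before by (meson not_le)
      then have kk: "?k \<le> completions e n" by (rule completions_mono)
      have "A c < t (Suc (completions e n))"
        using At A_le[of c ?a] ca t_mono[of "Suc ?k" "Suc (completions e n)"] kk by simp
      then have "0 < wait k" using k(2) unfolding n(2) served_wait_Suc by simp
      then show False using k(3) by simp
    qed
    have "tau x y T = enat (Suc ?a)"
      unfolding tau_def
    proof (rule antisym)
      show "Inf {enat n |n. 1 \<le> n \<and> customer_wait x y T n = 0} \<le> enat (Suc ?a)"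
        using D by (intro Inf_lower) auto
      show "enat (Suc ?a) \<le> Inf {enat n |n. 1 \<le> n \<and> customer_wait x y T n = 0}"
        using least by (intro Inf_greatest) auto
    qed
    then show ?thesis by (simp add: sum)
  qed
qed

end

section \<open>Measurability and joint law of the input\<close>

text \<open>
  The set of served customers is handled through the events that a given customer belongs to it, and
  the choice of the next customer through countably many comparisons.
\<close>

lemma measurable_served_wait:
  fixes P :: "'a measure"
  assumes X: "\<And>i. 1 \<le> i \<Longrightarrow> X i \<in> borel_measurable P" and Y: "\<And>i. 1 \<le> i \<Longrightarrow> Y i \<in> borel_measurable P"
  shows "(\<lambda>\<omega>. served_wait (\<lambda>i. X i \<omega>) (\<lambda>k. Y k \<omega>) T n) \<in> borel_measurable P"
proof -
  let ?A = "\<lambda>n \<omega>. arrival_time (\<lambda>i. X i \<omega>) n"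
  let ?st = "\<lambda>k \<omega>. server_state (\<lambda>i. X i \<omega>) (\<lambda>k. Y k \<omega>) T k"
  let ?next = "\<lambda>k \<omega>. next_customer (\<lambda>i. X i \<omega>) T (snd (?st k \<omega>)) (fst (?st k \<omega>))"
  have A [measurable]: "?A n \<in> borel_measurable P" for n
    unfolding arrival_time_def by (rule borel_measurable_sum) (use X in auto)
  have A_at: "(\<lambda>\<omega>. ?A (c \<omega>) \<omega>) \<in> borel_measurable P" if "c \<in> measurable P (count_space UNIV)" for c
    using A that by (rule measurable_compose_countable)
  have next_m: "?next k \<in> measurable P (count_space UNIV)"
    if t [measurable]: "(\<lambda>\<omega>. fst (?st k \<omega>)) \<in> borel_measurable P"
      and S [measurable]: "\<And>n. Measurable.pred P (\<lambda>\<omega>. n \<in> snd (?st k \<omega>))" for k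
  proof -
    define Q where "Q n \<omega> \<longleftrightarrow> n \<notin> snd (?st k \<omega>) \<and> ?A n \<omega> \<le> fst (?st k \<omega>) \<and>
        ereal (fst (?st k \<omega>) - ?A n \<omega>) \<le> T" for n \<omega>
    have Qm [measurable]: "Measurable.pred P (Q n)" for n unfolding Q_def by measurable
    have Q: "waiting_customers (\<lambda>i. X i \<omega>) T (snd (?st k \<omega>)) (fst (?st k \<omega>)) = {n. Q n \<omega>}" for \<omega>
      by (simp add: waiting_customers_def Q_def)
    have Q_empty: "{n. Q n \<omega>} = {} \<longleftrightarrow> (\<forall>n. \<not> Q n \<omega>)" for \<omega> by auto
    have "(\<lambda>\<omega>. if (\<forall>n. \<not> Q n \<omega>) then (LEAST n. fst (?st k \<omega>) < ?A n \<omega>)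
        else Max {n. Q n \<omega> \<and> \<not> (\<exists>j. Q j \<omega> \<and> fst (?st k \<omega>) - ?A j \<omega> < fst (?st k \<omega>) - ?A n \<omega>)})
      \<in> measurable P (count_space UNIV)"
      by measurable
    then show ?thesis
      unfolding next_customer_def Let_def Q Q_empty is_arg_min_def mem_Collect_eq .
  qed
  have state: "(\<lambda>\<omega>. fst (?st k \<omega>)) \<in> borel_measurable P \<and> (\<forall>n. Measurable.pred P (\<lambda>\<omega>. n \<in> snd (?st k \<omega>)))" for k
  proof (induction k)
    case (Suc k)
    then have c: "?next k \<in> measurable P (count_space UNIV)" by (intro next_m) auto
    note [measurable] = A_at[OF c] Y[of "Suc k"] c
    have [measurable]: "(\<lambda>\<omega>. fst (?st k \<omega>)) \<in> borel_measurable P" "Measurable.pred P (\<lambda>\<omega>. n \<in> snd (?st k \<omega>))" for n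
      using Suc by auto
    have f: "fst (?st (Suc k) \<omega>) = max (fst (?st k \<omega>)) (?A (?next k \<omega>) \<omega>) + Y (Suc k) \<omega>"
      and s: "snd (?st (Suc k) \<omega>) = insert (?next k \<omega>) (snd (?st k \<omega>))" for \<omega>
      by (simp_all only: server_state.simps split_beta Let_def fst_conv snd_conv)
    have "Y (Suc k) \<in> borel_measurable P" using Y[of "Suc k"] by simp
    then show ?case unfolding f s insert_iff by (intro conjI allI) measurable
  qed simp
  have c: "?next k \<in> measurable P (count_space UNIV)" for k
    using state by (intro next_m) auto
  have "served_wait (\<lambda>i. X i \<omega>) (\<lambda>k. Y k \<omega>) T n =
      max (fst (?st (n - 1) \<omega>)) (?A (?next (n - 1) \<omega>) \<omega>) - ?A (?next (n - 1) \<omega>) \<omega>" for \<omega>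
    by (simp only: served_wait_def service_start_def served_customer_def split_beta)
  moreover have "(\<lambda>\<omega>. max (fst (?st (n - 1) \<omega>)) (?A (?next (n - 1) \<omega>) \<omega>) - ?A (?next (n - 1) \<omega>) \<omega>) \<in> borel_measurable P"
    using A_at[OF c] state by (intro borel_measurable_diff borel_measurable_max) auto
  ultimately show ?thesis by (simp only:)
qed

context race
begin

text \<open>
  The joint law of all interarrival and service times is a product over the sum type.  Restriction to
  either summand gives the two sequences, which are independent as functions of disjoint blocks.
\<close>

lemma distr_indep_exponentials:
  fixes P :: "'a measure" and X Y :: "nat \<Rightarrow> 'a \<Rightarrow> real"
  assumes P: "prob_space P"
    and ind: "prob_space.indep_vars P (\<lambda>_. borel) (case_sum X Y) ({1..} <+> {1..})"
    and X: "\<And>i. 1 \<le> i \<Longrightarrow> distributed P lborel (X i) (exponential_density l)"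
    and Y: "\<And>k. 1 \<le> k \<Longrightarrow> distributed P lborel (Y k) (exponential_density m)"
  shows "(\<lambda>\<omega>. (\<lambda>i. X (Suc i) \<omega>, \<lambda>i. Y (Suc i) \<omega>)) \<in> measurable P XY_law"
    and "distr P XY_law (\<lambda>\<omega>. (\<lambda>i. X (Suc i) \<omega>, \<lambda>i. Y (Suc i) \<omega>)) = XY_law"
proof -
  interpret Q: prob_space P by fact
  let ?K = "{1..} <+> {1..} :: (nat + nat) set"
  let ?Z = "case_sum X Y"
  let ?B = "\<lambda>_ :: nat + nat. borel :: real measure"
  have Xm: "X i \<in> borel_measurable P" if "1 \<le> i" for i
    using distributed_measurable[OF X[OF that]] by simp
  have Ym: "Y i \<in> borel_measurable P" if "1 \<le> i" for i
    using distributed_measurable[OF Y[OF that]] by simp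
  have Zm: "?Z i \<in> borel_measurable P" if "i \<in> ?K" for i
    using that Xm Ym by auto
  have Xd: "distr P borel (X i) = X_law" if "1 \<le> i" for i
  proof -
    have "distr P borel (X i) = distr P lborel (X i)" by (rule distr_cong) auto
    then show ?thesis using distributed_distr_eq_density[OF X[OF that]] by simp
  qed
  have Yd: "distr P borel (Y i) = Y_law" if "1 \<le> i" for i
  proof -
    have "distr P borel (Y i) = distr P lborel (Y i)" by (rule distr_cong) auto
    then show ?thesis using distributed_distr_eq_density[OF Y[OF that]] by simp
  qed
  have joint: "distr P (PiM ?K ?B) (\<lambda>\<omega>. \<lambda>i\<in>?K. ?Z i \<omega>) = PiM ?K (\<lambda>i. distr P borel (?Z i))"
    using ind Zm by (subst (asm) Q.indep_vars_iff_distr_eq_PiM') auto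
  have Zr: "(\<lambda>\<omega>. \<lambda>i\<in>?K. ?Z i \<omega>) \<in> measurable P (PiM ?K ?B)"
    by (rule measurable_restrict) (rule Zm)
  have marginal: "distr P (PiM UNIV (\<lambda>_. borel)) (\<lambda>\<omega> n. ?Z (f n) \<omega>) = PiM UNIV (\<lambda>_ :: nat. D)"
    if f: "inj f" "\<And>n. f n \<in> ?K" and D: "\<And>n. distr P borel (?Z (f n)) = D" for f D
  proof -
    have sets_D: "sets D = sets borel" using D[of 0] by (metis sets_distr)
    let ?M = "\<lambda>i. if i \<in> ?K then distr P borel (?Z i) else return borel 0"
    have pM: "prob_space (?M i)" for i
      using Zm[of i] by (auto intro: Q.prob_space_distr prob_space_return)
    have sM: "sets (?M i) = sets borel" for i by simp
    have "PiM ?K (\<lambda>i. distr P borel (?Z i)) = PiM ?K ?M" by (rule PiM_cong) auto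
    with joint have joint': "distr P (PiM ?K ?B) (\<lambda>\<omega>. \<lambda>i\<in>?K. ?Z i \<omega>) = PiM ?K ?M" by simp
    have g: "(\<lambda>\<omega>. \<lambda>n\<in>UNIV. \<omega> (f n)) \<in> measurable (PiM ?K ?B) (PiM UNIV (\<lambda>_. borel))"
      by (rule measurable_restrict) (use f in \<open>auto intro!: measurable_component_singleton\<close>)
    have "PiM UNIV (\<lambda>n. ?M (f n)) = distr (PiM ?K ?M) (PiM UNIV (\<lambda>n. ?M (f n))) (\<lambda>\<omega>. \<lambda>n\<in>UNIV. \<omega> (f n))"
      by (rule distr_PiM_reindex[where K="?K" and M="?M" and f=f and I=UNIV, symmetric, OF pM f(1)])
         (rule Pi_I, rule f(2))
    also have "\<dots> = distr (PiM ?K ?M) (PiM UNIV (\<lambda>_. borel)) (\<lambda>\<omega>. \<lambda>n\<in>UNIV. \<omega> (f n))"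
      by (intro distr_cong refl sets_PiM_cong sM)
    also have "\<dots> = distr P (PiM UNIV (\<lambda>_. borel)) ((\<lambda>\<omega>. \<lambda>n\<in>UNIV. \<omega> (f n)) \<circ> (\<lambda>\<omega>. \<lambda>i\<in>?K. ?Z i \<omega>))"
      unfolding joint'[symmetric] by (rule distr_distr[OF g Zr])
    also have "((\<lambda>\<omega>. \<lambda>n\<in>UNIV. \<omega> (f n)) \<circ> (\<lambda>\<omega>. \<lambda>i\<in>?K. ?Z i \<omega>)) = (\<lambda>\<omega> n. ?Z (f n) \<omega>)"
      using f by (auto simp: fun_eq_iff)
    also have "(\<lambda>n. ?M (f n)) = (\<lambda>_. D)" using f D by auto
    finally show ?thesis ..
  qed
  let ?x = "\<lambda>\<omega> i. X (Suc i) \<omega>" and ?y = "\<lambda>\<omega> i. Y (Suc i) \<omega>"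
  have x: "distr P (PiM UNIV (\<lambda>_. borel)) ?x = X.S"
    using marginal[of "\<lambda>n. Inl (Suc n)" X_law] Xd by (simp add: inj_on_def InlI)
  have y: "distr P (PiM UNIV (\<lambda>_. borel)) ?y = Y.S"
    using marginal[of "\<lambda>n. Inr (Suc n)" Y_law] Yd by (simp add: inj_on_def InrI)
  have "Q.indep_var (PiM (Inl ` {1..}) ?B) (\<lambda>\<omega>. restrict (\<lambda>i. ?Z i \<omega>) (Inl ` {1..}))
      (PiM (Inr ` {1..}) ?B) (\<lambda>\<omega>. restrict (\<lambda>i. ?Z i \<omega>) (Inr ` {1..}))"
    by (rule Q.indep_var_restrict[OF ind]) auto
  then have "Q.indep_var (PiM UNIV (\<lambda>_. borel)) ((\<lambda>\<omega> i. \<omega> (Inl (Suc i))) \<circ> (\<lambda>\<omega>. restrict (\<lambda>i. ?Z i \<omega>) (Inl ` {1..})))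
      (PiM UNIV (\<lambda>_. borel)) ((\<lambda>\<omega> i. \<omega> (Inr (Suc i))) \<circ> (\<lambda>\<omega>. restrict (\<lambda>i. ?Z i \<omega>) (Inr ` {1..})))"
    by (rule Q.indep_var_compose)
       (auto intro!: measurable_PiM_single' measurable_component_singleton simp: space_PiM PiE_iff)
  moreover have "((\<lambda>\<omega> i. \<omega> (Inl (Suc i))) \<circ> (\<lambda>\<omega>. restrict (\<lambda>i. ?Z i \<omega>) (Inl ` {1..}))) = ?x"
    "((\<lambda>\<omega> i. \<omega> (Inr (Suc i))) \<circ> (\<lambda>\<omega>. restrict (\<lambda>i. ?Z i \<omega>) (Inr ` {1..}))) = ?y"
    by (auto simp: fun_eq_iff image_iff)
  ultimately have "Q.indep_var (PiM UNIV (\<lambda>_. borel)) ?x (PiM UNIV (\<lambda>_. borel)) ?y" by simp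
  then have xy: "?x \<in> measurable P (PiM UNIV (\<lambda>_. borel))" "?y \<in> measurable P (PiM UNIV (\<lambda>_. borel))"
      "X.S \<Otimes>\<^sub>M Y.S = distr P (PiM UNIV (\<lambda>_. borel) \<Otimes>\<^sub>M PiM UNIV (\<lambda>_. borel)) (\<lambda>\<omega>. (?x \<omega>, ?y \<omega>))"
    unfolding Q.indep_var_distribution_eq x y by auto
  have sX: "sets X.S = sets (PiM UNIV (\<lambda>_ :: nat. borel))" and sY: "sets Y.S = sets (PiM UNIV (\<lambda>_ :: nat. borel))"
    by (auto intro!: sets_PiM_cong)
  show "(\<lambda>\<omega>. (?x \<omega>, ?y \<omega>)) \<in> measurable P XY_law"
    using xy(1,2) measurable_cong_sets[OF refl sX] measurable_cong_sets[OF refl sY] by (intro measurable_Pair) blast+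
  have "distr P XY_law (\<lambda>\<omega>. (?x \<omega>, ?y \<omega>)) =
      distr P (PiM UNIV (\<lambda>_. borel) \<Otimes>\<^sub>M PiM UNIV (\<lambda>_. borel)) (\<lambda>\<omega>. (?x \<omega>, ?y \<omega>))"
    by (intro distr_cong refl sets_pair_measure_cong sX sY)
  then show "distr P XY_law (\<lambda>\<omega>. (?x \<omega>, ?y \<omega>)) = XY_law" using xy(3) by simp
qed

lemma AE_XY_pos: "AE z in XY_law. \<forall>i. 0 < fst z i \<and> 0 < snd z i"
proof -
  have x: "AE x in X.S. 0 < x i" for i
    by (rule X.AE_component) (use AE_exponential[OF l_pos, of 0] in auto)
  have y: "AE y in Y.S. 0 < y i" for i
    by (rule Y.AE_component) (use AE_exponential[OF m_pos, of 0] in auto)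
  have "AE z in XY_law. 0 < fst z i \<and> 0 < snd z i" for i
  proof (rule XY.AE_pair_measure)
    have a: "(\<lambda>z. fst z i) \<in> borel_measurable XY_law" and b: "(\<lambda>z. snd z i) \<in> borel_measurable XY_law"
      using measurable_compose[OF measurable_fst measurable_X_component[of i]]
        measurable_compose[OF measurable_snd measurable_Y_component[of i]] by simp_all
    then have "Measurable.pred XY_law (\<lambda>z. 0 < fst z i \<and> 0 < snd z i)"
      by (intro pred_intros_logic) simp_all
    then show "{z \<in> space XY_law. 0 < fst z i \<and> 0 < snd z i} \<in> sets XY_law" by (simp add: pred_def)
    show "AE a in X.S. AE b in Y.S. 0 < fst (a, b) i \<and> 0 < snd (a, b) i"
      using x[of i]
    proof eventually_elim
      case (elim a)
      show ?case using y[of i] by eventually_elim (use elim in simp)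
    qed
  qed
  then show ?thesis by (simp add: AE_all_countable)
qed

section \<open>The limit distribution\<close>

definition busy_density :: "real \<Rightarrow> real" where
  "busy_density t = (\<Sum>j. busy_term j t)"

lemma summable_busy_term: "summable (\<lambda>j. busy_term j t)"
proof (cases "t < 0")
  case True
  then show ?thesis by (simp add: busy_term_def)
next
  case False
  let ?z = "l * m * t\<^sup>2" and ?K = "l * exp (- (l + m) * t)"
  have z: "0 \<le> ?z" using l_pos m_pos by simp
  have "summable (\<lambda>j. ?K * (inverse (fact j) * ?z ^ j))"
    by (intro summable_mult summable_exp)
  moreover have "norm (busy_term j t) \<le> ?K * (inverse (fact j) * ?z ^ j)" for j
  proof -
    have "busy_term j t = ?K * (inverse (fact j) * ?z ^ j) / fact (Suc j)"
      using False by (simp add: busy_term_def power_mult_distrib power_mult field_simps del: fact_Suc)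
        (simp add: power_mult[symmetric] mult.commute)
    also have "\<dots> \<le> ?K * (inverse (fact j) * ?z ^ j) / 1"
      using l_pos z by (intro divide_left_mono) (simp_all add: fact_ge_1 del: fact_Suc)
    finally show ?thesis using busy_term_nonneg[of j t] by simp
  qed
  ultimately show ?thesis by (rule summable_comparison_test'[where N=0])
qed

lemma measurable_busy_density [measurable]: "busy_density \<in> borel_measurable borel"
  unfolding busy_density_def[abs_def] by measurable

lemma busy_density_nonneg: "0 \<le> busy_density t"
  unfolding busy_density_def by (intro suminf_nonneg summable_busy_term busy_term_nonneg)

text \<open>
  Comparison of the power series term by term.  The constants match because
  \<open>sqrt (max \<rho> (inverse \<rho>)) * sqrt (l * m) = max \<rho> 1 * m\<close> for \<open>\<rho> = l/m\<close>.
\<close>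

lemma f_dens_eq:
  assumes t: "0 < t"
  shows "f_dens l m t = max (l / m) 1 / (l / m) * busy_density t"
proof -
  let ?r = "l / m" and ?s = "sqrt (l * m)" and ?q = "sqrt (max (l / m) (inverse (l / m)))"
  let ?c = "max ?r 1 / ?r" and ?E = "exp (- (l + m) * t)"
  have q: "?q * ?s = ?c * l"
  proof (cases "l \<le> m")
    case True
    then have "max ?r (inverse ?r) = m / l" "max ?r 1 = 1"
      using l_pos m_pos by (auto simp: field_simps max_def mult_mono intro: antisym)
    then show ?thesis using l_pos m_pos by (simp add: real_sqrt_mult[symmetric])
  next
    case False
    then have "max ?r (inverse ?r) = l / m" "max ?r 1 = l / m"
      using l_pos m_pos by (auto simp: field_simps max_def intro!: antisym mult_mono)
    then show ?thesis using l_pos m_pos by (simp add: real_sqrt_mult[symmetric])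
  qed
  let ?b = "\<lambda>j. 1 / (fact j * fact (j + 1)) * (2 * t * ?s / 2) ^ (2 * j + 1)"
  define k where "k = t * ?s / (l * ?E)"
  have "?b j = k * busy_term j t" for j
  proof -
    have "(t * ?s) ^ (2 * j + 1) = t * ?s * (t ^ (2 * j) * (l * m) ^ j)"
      using l_pos m_pos by (simp add: power_mult_distrib power_mult)
    moreover have "k * busy_term j t = t * ?s * (t ^ (2 * j) * (l * m) ^ j) / (fact j * fact (j + 1))"
      using t l_pos by (simp add: k_def busy_term_def power_mult_distrib del: fact_Suc)
    ultimately show ?thesis by (simp del: fact_Suc)
  qed
  then have "bessel_I1 (2 * t * ?s) = (\<Sum>j. k * busy_term j t)"
    by (simp only: bessel_I1_def)
  also have "\<dots> = k * busy_density t"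
    unfolding busy_density_def by (rule suminf_mult[OF summable_busy_term])
  finally have "f_dens l m t = ?q * (1 / t) * ?E * (k * busy_density t)"
    by (simp only: f_dens_def Let_def)
  also have "\<dots> = (?q * ?s) / l * busy_density t" using t by (simp add: k_def)
  also have "\<dots> = ?c * busy_density t" unfolding q using l_pos by simp
  finally show ?thesis .
qed

lemma measurable_busy_summand:
  "(\<lambda>t. ennreal (busy_term j t) * indicator {t. ereal t \<le> x} t) \<in> borel_measurable lborel"
proof -
  have "{t :: real. ereal t \<le> x} \<in> sets borel" by simp
  then have "(indicator {t. ereal t \<le> x} :: real \<Rightarrow> ennreal) \<in> borel_measurable borel"
    by (rule borel_measurable_indicator)
  moreover have "(\<lambda>t. ennreal (busy_term j t)) \<in> borel_measurable borel"
    by (rule measurable_compose[OF measurable_busy_term measurable_ennreal])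
  ultimately show ?thesis
    unfolding measurable_cong_sets[OF sets_lborel refl] by (rule borel_measurable_times_ennreal[rotated])
qed

lemma nn_integral_busy_terms:
  "(\<integral>\<^sup>+t. (\<Sum>j. ennreal (busy_term j t) * indicator {t. ereal t \<le> x} t) \<partial>lborel) = (\<Sum>j. busy_mass x j)"
  unfolding busy_mass_def by (rule nn_integral_suminf[OF measurable_busy_summand])

lemma interval_integral_f_dens:
  assumes x: "0 \<le> x"
  shows "(LBINT t=0..x. f_dens l m t) = max (l / m) 1 / (l / m) * busy_total x"
proof -
  let ?c = "max (l / m) 1 / (l / m)"
  have c: "0 \<le> ?c" using l_pos m_pos by simp
  have "(LBINT t=0..x. f_dens l m t) = (LINT t|lborel. indicator (einterval 0 x) t *\<^sub>R f_dens l m t)"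
    using x by (simp add: interval_lebesgue_integral_def set_lebesgue_integral_def)
  also have "\<dots> = (LINT t|lborel. indicator (einterval 0 x) t * (?c * busy_density t))"
    by (intro Bochner_Integration.integral_cong refl) (auto simp: indicator_def einterval_def f_dens_eq zero_ereal_def)
  also have "\<dots> = enn2real (\<integral>\<^sup>+t. ennreal (indicator (einterval 0 x) t * (?c * busy_density t)) \<partial>lborel)"
  proof (rule integral_eq_nn_integral)
    show "AE t in lborel. 0 \<le> indicator (einterval 0 x) t * (?c * busy_density t)"
      by (intro AE_I2 mult_nonneg_nonneg c busy_density_nonneg) simp
    have "einterval 0 x \<in> sets lborel" "busy_density \<in> borel_measurable lborel"
      using measurable_busy_density by simp_all
    then show "(\<lambda>t. indicator (einterval 0 x) t * (?c * busy_density t)) \<in> borel_measurable lborel"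
      by (intro borel_measurable_times borel_measurable_indicator borel_measurable_const)
  qed
  also have "(\<integral>\<^sup>+t. ennreal (indicator (einterval 0 x) t * (?c * busy_density t)) \<partial>lborel)
      = (\<integral>\<^sup>+t. ennreal ?c * (\<Sum>j. ennreal (busy_term j t) * indicator {t. ereal t \<le> x} t) \<partial>lborel)"
  proof (rule nn_integral_cong_AE)
    have "AE t in lborel. t \<noteq> (0::real)" "AE t in lborel. t \<noteq> real_of_ereal x" by (rule AE_lborel_singleton)+
    then show "AE t in lborel. ennreal (indicator (einterval 0 x) t * (?c * busy_density t))
      = ennreal ?c * (\<Sum>j. ennreal (busy_term j t) * indicator {t. ereal t \<le> x} t)"
    proof eventually_elim
      case (elim t)
      have neq: "ereal t \<noteq> x" using elim(2) by auto
      show ?case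
      proof (cases "0 < t \<and> ereal t \<le> x")
        case True
        have "(\<Sum>j. ennreal (busy_term j t)) = ennreal (busy_density t)"
          unfolding busy_density_def by (rule suminf_ennreal2[OF busy_term_nonneg summable_busy_term])
        moreover have "t \<in> einterval 0 x" using True neq by (simp add: einterval_def zero_ereal_def order_neq_le_trans)
        moreover have "ennreal (?c * busy_density t) = ennreal ?c * ennreal (busy_density t)"
          by (rule ennreal_mult[OF c busy_density_nonneg])
        ultimately show ?thesis using True by simp
      next
        case False
        then have z: "ennreal (busy_term j t) * indicator {t. ereal t \<le> x} t = 0" for j
          using elim(1) by (auto simp: busy_term_def indicator_def)
        moreover have "t \<notin> einterval 0 x" using False by (auto simp: einterval_def zero_ereal_def)
        ultimately show ?thesis unfolding z by simp
      qed
    qed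
  qed
  also have "\<dots> = ennreal ?c * (\<Sum>j. busy_mass x j)"
    unfolding nn_integral_busy_terms[symmetric]
    by (rule nn_integral_cmult) (rule borel_measurable_suminf_order[OF measurable_busy_summand])
  also have "enn2real \<dots> = ?c * busy_total x"
    unfolding enn2real_mult busy_total_def[symmetric] enn2real_ennreal[OF c] ..
  finally show ?thesis .
qed

text \<open>
  An atom at \<open>0\<close>, whose mass is the limiting probability that a completion leaves the server idle, and
  a density on \<open>[0,T]\<close>.
\<close>

definition limit_cdf :: "ereal \<Rightarrow> real \<Rightarrow> real" where
  "limit_cdf T r = (1 - busy_total T) * indicator {0..} r + busy_total (min (ereal r) T)"

lemma busy_total_neg: "x < 0 \<Longrightarrow> busy_total x = 0"
proof -
  assume x: "x < 0"
  have "busy_mass x j = 0" for j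
  proof -
    have "(\<integral>\<^sup>+t. ennreal (busy_term j t) * indicator {t. ereal t \<le> x} t \<partial>lborel) = (\<integral>\<^sup>+t. 0 \<partial>(lborel :: real measure))"
    proof (rule nn_integral_cong)
      fix t :: real
      show "ennreal (busy_term j t) * indicator {t. ereal t \<le> x} t = 0"
      proof (cases "t < 0")
        case True then show ?thesis by (simp add: busy_term_def)
      next
        case False
        then have "0 \<le> ereal t" by (simp add: zero_ereal_def)
        then have "\<not> ereal t \<le> x" using x by (meson not_le order_less_le_trans)
        then show ?thesis by simp
      qed
    qed
    then show ?thesis by (simp add: busy_mass_def)
  qed
  then show ?thesis by (simp add: busy_total_def)
qed

text \<open>
  Away from the atom the function is the distribution function of the finite measure with density
  \<open>\<Sum>j. busy_term j t\<close> on \<open>t \<le> T\<close>, which takes care of continuity and limits, also for \<open>T = \<infinity>\<close>.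
\<close>

lemma limit_distribution:
  assumes T: "0 < T"
  obtains N where "real_distribution N" "cdf N = limit_cdf T"
proof -
  define D where "D = density lborel (\<lambda>t. \<Sum>j. ennreal (busy_term j t) * indicator {t. ereal t \<le> T} t)"
  have sets_D: "sets D = sets borel" and space_D: "space D = UNIV" by (simp_all add: D_def)
  have em: "emeasure D A = (\<Sum>j. busy_mass x j)"
    if A: "A \<in> sets borel" "\<And>t. t \<in> A \<and> ereal t \<le> T \<longleftrightarrow> ereal t \<le> x" for A x
  proof -
    have "emeasure D A = (\<integral>\<^sup>+t. (\<Sum>j. ennreal (busy_term j t) * indicator {t. ereal t \<le> T} t) * indicator A t \<partial>lborel)"
      unfolding D_def using A(1) by (subst emeasure_density) auto
    also have "\<dots> = (\<integral>\<^sup>+t. (\<Sum>j. ennreal (busy_term j t) * indicator {t. ereal t \<le> x} t) \<partial>lborel)"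
      using A(2) by (intro nn_integral_cong) (auto simp: indicator_def)
    also have "\<dots> = (\<Sum>j. busy_mass x j)"
      by (rule nn_integral_busy_terms)
    finally show ?thesis .
  qed
  have D_UNIV: "emeasure D UNIV = ennreal (busy_total T)"
    using em[of UNIV T] busy_total(1)[of T] by simp
  have D_Iic: "emeasure D {..r} = ennreal (busy_total (min (ereal r) T))" for r
    using em[of "{..r}" "min (ereal r) T"] busy_total(1)[of "min (ereal r) T"] by simp
  interpret D: finite_borel_measure D
    by (intro finite_borel_measure.intro finite_measureI finite_borel_measure_axioms.intro sets_D)
       (simp add: space_D D_UNIV)
  have cdf_D: "cdf D r = busy_total (min (ereal r) T)" for r
    unfolding cdf_def using D_Iic busy_total(2) by (simp add: measure_def)
  have D_total: "measure D (space D) = busy_total T"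
    unfolding space_D using D_UNIV busy_total(2) by (simp add: measure_def)
  define b where "b = 1 - busy_total T"
  have b: "0 \<le> b" using busy_total(3)[of T] by (simp add: b_def)
  have F: "limit_cdf T = (\<lambda>r. b * indicator {0..} r + cdf D r)"
    by (simp add: fun_eq_iff limit_cdf_def b_def cdf_D)
  have mono: "limit_cdf T r \<le> limit_cdf T r'" if "r \<le> r'" for r r'
    unfolding F using that b D.cdf_nondecreasing[OF that]
    by (intro add_mono mult_left_mono) (auto simp: indicator_def)
  have right: "continuous (at_right a) (limit_cdf T)" for a
  proof -
    have "((\<lambda>r :: real. indicator {0..} r :: real) \<longlongrightarrow> indicator {0..} a) (at_right a)"
    proof (rule tendsto_eventually)
      have "eventually (\<lambda>r. r \<in> {a<..<(if a < 0 then 0 else a + 1)}) (at_right a)"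
        by (rule eventually_at_rightI[of a "if a < 0 then 0 else a + 1"]) (auto split: if_splits)
      then show "eventually (\<lambda>r. indicator {0..} r = (indicator {0..} a :: real)) (at_right a)"
        by eventually_elim (auto simp: indicator_def split: if_splits)
    qed
    then show ?thesis
      unfolding F using D.cdf_is_right_cont[of a]
      by (auto simp: continuous_within intro!: tendsto_intros)
  qed
  have bot: "(limit_cdf T \<longlongrightarrow> 0) at_bot"
  proof -
    have "((\<lambda>r :: real. indicator {0..} r :: real) \<longlongrightarrow> 0) at_bot"
    proof (rule tendsto_eventually)
      show "eventually (\<lambda>r :: real. indicator {0..} r = (0 :: real)) at_bot"
        using eventually_gt_at_bot[of "0::real"] by eventually_elim simp
    qed
    from tendsto_add[OF tendsto_mult_left[OF this, of b] D.cdf_lim_at_bot] show ?thesis unfolding F by simp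
  qed
  have top: "(limit_cdf T \<longlongrightarrow> 1) at_top"
  proof -
    have "((\<lambda>r :: real. indicator {0..} r :: real) \<longlongrightarrow> 1) at_top"
    proof (rule tendsto_eventually)
      show "eventually (\<lambda>r :: real. indicator {0..} r = (1 :: real)) at_top"
        using eventually_ge_at_top[of "0::real"] by eventually_elim simp
    qed
    from tendsto_add[OF tendsto_mult_left[OF this, of b] D.cdf_lim_at_top] show ?thesis
      unfolding F D_total by (simp add: b_def)
  qed
  show ?thesis
  proof (rule that)
    show "real_distribution (interval_measure (limit_cdf T))"
      by (rule real_distribution_interval_measure[OF mono right bot top])
    show "cdf (interval_measure (limit_cdf T)) = limit_cdf T"
      by (rule cdf_interval_measure[OF mono right bot])
  qed
qed

end

section \<open>Convergence of the waiting times\<close>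

lemma hit_mono: "hit r h n \<Longrightarrow> r \<le> T \<Longrightarrow> hit T h n"
  unfolding hit_def by (meson order_trans)

locale queue = race l m + Q: prob_space Q
  for l m :: real and Q :: "'a measure" +
  fixes X Y :: "nat \<Rightarrow> 'a \<Rightarrow> real" and T :: ereal
  assumes T_pos: "0 < T"
    and indep: "Q.indep_vars (\<lambda>_. borel) (case_sum X Y) ({1..} <+> {1..})"
    and X_exp: "\<And>i. 1 \<le> i \<Longrightarrow> distributed Q lborel (X i) (exponential_density l)"
    and Y_exp: "\<And>k. 1 \<le> k \<Longrightarrow> distributed Q lborel (Y k) (exponential_density m)"
begin

definition input :: "'a \<Rightarrow> (nat \<Rightarrow> real) \<times> (nat \<Rightarrow> real)" where
  "input \<omega> = (\<lambda>i. X (Suc i) \<omega>, \<lambda>i. Y (Suc i) \<omega>)"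

definition W :: "nat \<Rightarrow> 'a \<Rightarrow> real" where
  "W n \<omega> = served_wait (\<lambda>i. X i \<omega>) (\<lambda>k. Y k \<omega>) T n"

abbreviation E :: "'a \<Rightarrow> nat \<Rightarrow> bool \<times> real" where
  "E \<omega> \<equiv> event_seq T (input \<omega>)"

lemma measurable_input: "input \<in> measurable Q XY_law"
  and distr_input: "distr Q XY_law input = XY_law"
  using distr_indep_exponentials[OF Q.prob_space_axioms indep X_exp Y_exp]
  unfolding input_def[abs_def] by blast+

lemma measurable_E: "E \<in> measurable Q S"
  by (rule measurable_compose[OF measurable_input measurable_event_seq])

lemma distr_E: "distr Q S E = S"
proof -
  have "distr Q S E = distr (distr Q XY_law input) S (event_seq T)"
    using distr_distr[OF measurable_event_seq measurable_input, of T] by (simp only: comp_def)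
  then show ?thesis by (simp only: distr_input event_seq_law)
qed

lemma AE_E: "AE h in S. A h \<Longrightarrow> AE \<omega> in Q. A (E \<omega>)"
  using AE_distrD[OF measurable_E, of A] by (simp only: distr_E)

lemma AE_input: "AE z in XY_law. A z \<Longrightarrow> AE \<omega> in Q. A (input \<omega>)"
  using AE_distrD[OF measurable_input, of A] by (simp only: distr_input)

lemma prob_E:
  assumes "Measurable.pred S A"
  shows "Q.prob {\<omega> \<in> space Q. A (E \<omega>)} = enn2real (pr A)"
    and "{\<omega> \<in> space Q. A (E \<omega>)} \<in> sets Q"
proof -
  have A: "{h. A h} \<in> sets S" using assms by (simp add: pred_def)
  have "emeasure Q {\<omega> \<in> space Q. A (E \<omega>)} = emeasure (distr Q S E) {h. A h}"
    using A by (subst emeasure_distr[OF measurable_E]) (auto intro!: arg_cong2[where f=emeasure])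
  then show "Q.prob {\<omega> \<in> space Q. A (E \<omega>)} = enn2real (pr A)"
    by (simp only: distr_E pr_def measure_def)
  have "{\<omega> \<in> space Q. A (E \<omega>)} = E -` {h. A h} \<inter> space Q" by auto
  then show "{\<omega> \<in> space Q. A (E \<omega>)} \<in> sets Q" using measurable_sets[OF measurable_E A] by simp
qed

lemma AE_queue_path: "AE \<omega> in Q. queue_path (\<lambda>i. X i \<omega>) (\<lambda>k. Y k \<omega>) T"
  using AE_input[OF AE_XY_pos] AE_input[OF AE_chain_untied[of T]]
  by eventually_elim (auto simp: queue_path_def input_def T_pos)

lemma AE_completions: "AE \<omega> in Q. \<forall>n. \<exists>j\<ge>n. \<not> fst (E \<omega> j)"
  using AE_E[OF AE_type_infinitely_often[of False]] by eventually_elim simp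

lemma AE_arrivals: "AE \<omega> in Q. \<forall>n. \<exists>j\<ge>n. fst (E \<omega> j)"
  using AE_E[OF AE_type_infinitely_often[of True]] by eventually_elim simp

lemma measurable_W: "W n \<in> borel_measurable Q"
proof -
  have "X i \<in> borel_measurable Q" "Y i \<in> borel_measurable Q" if "1 \<le> i" for i
    using distributed_measurable[OF X_exp[OF that]] distributed_measurable[OF Y_exp[OF that]] by simp_all
  then show ?thesis unfolding W_def[abs_def] by (rule measurable_served_wait)
qed

text \<open>
  Service number \<open>k + 2\<close> follows the completion with \<open>k\<close> preceding ones.  Its customer waits at most
  \<open>r\<close> if the server was idle or if the top of the stack had age at most \<open>r\<close> and \<open>T\<close>.
\<close>

lemma AE_W_le:
  "AE \<omega> in Q. W (Suc (Suc k)) \<omega> \<le> r \<longleftrightarrow>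
     0 \<le> r \<and> (\<not> kth_hit T k (E \<omega>) \<or> kth_hit (min (ereal r) T) k (E \<omega>))"
  using AE_queue_path AE_completions
proof eventually_elim
  case (elim \<omega>)
  interpret queue_path "\<lambda>i. X i \<omega>" "\<lambda>k. Y k \<omega>" T by fact
  have e: "e = E \<omega>" by (simp add: input_def)
  obtain n where n: "\<not> fst (E \<omega> n)" "completions (E \<omega>) n = k"
    using completion_exists[of "E \<omega>" k] elim(2) by blast
  have kth: "kth_hit x k (E \<omega>) \<longleftrightarrow> hit x (E \<omega>) n" for x
    unfolding kth_hit_def using n completion_unique[of "E \<omega>" n] by (metis hit_def)
  have w: "W (Suc (Suc k)) \<omega> = (if hit T (E \<omega>) n then age (Suc n) (hd (stack (E \<omega>) n)) else 0)"
    using served_wait_event[of n] n unfolding W_def e by simp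
  have age: "hit x (E \<omega>) n \<longleftrightarrow> stack (E \<omega>) n \<noteq> [] \<and> ereal (age (Suc n) (hd (stack (E \<omega>) n))) \<le> x" for x
    using n unfolding hit_def age_def e by simp
  show ?case
  proof (cases "hit T (E \<omega>) n")
    case True
    have "0 < age (Suc n) (hd (stack (E \<omega>) n))" using hit_wait_pos[of n] True unfolding e .
    then show ?thesis using True unfolding w kth age by auto
  next
    case False
    then show ?thesis unfolding w kth by auto
  qed
qed

lemma measurable_kth_hit: "Measurable.pred S (kth_hit x k)"
  unfolding kth_hit_def[abs_def] by measurable

lemma cdf_W: "cdf (distr Q borel (W (Suc (Suc k)))) r =
   (if 0 \<le> r then 1 - enn2real (pr (kth_hit T k)) + enn2real (pr (kth_hit (min (ereal r) T) k)) else 0)"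
proof -
  let ?A = "\<lambda>x. {\<omega> \<in> space Q. kth_hit x k (E \<omega>)}" and ?x = "min (ereal r) T"
  have A: "?A x \<in> sets Q" "Q.prob (?A x) = enn2real (pr (kth_hit x k))" for x
    using prob_E[OF measurable_kth_hit] by blast+
  have "cdf (distr Q borel (W (Suc (Suc k)))) r = Q.prob {\<omega> \<in> space Q. W (Suc (Suc k)) \<omega> \<le> r}"
    unfolding cdf_def using measurable_W
    by (subst measure_distr) (auto intro!: arg_cong2[where f=measure])
  also have "\<dots> = Q.prob {\<omega> \<in> space Q. 0 \<le> r \<and> (\<not> kth_hit T k (E \<omega>) \<or> kth_hit ?x k (E \<omega>))}"
  proof (rule Q.finite_measure_eq_AE)
    show "AE \<omega> in Q. (\<omega> \<in> {\<omega> \<in> space Q. W (Suc (Suc k)) \<omega> \<le> r}) =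
        (\<omega> \<in> {\<omega> \<in> space Q. 0 \<le> r \<and> (\<not> kth_hit T k (E \<omega>) \<or> kth_hit ?x k (E \<omega>))})"
      using AE_W_le[of k r] by eventually_elim auto
    show "{\<omega> \<in> space Q. W (Suc (Suc k)) \<omega> \<le> r} \<in> sets Q" using measurable_W by measurable
    have "{\<omega> \<in> space Q. 0 \<le> r \<and> (\<not> kth_hit T k (E \<omega>) \<or> kth_hit ?x k (E \<omega>))} =
        (if 0 \<le> r then (space Q - ?A T) \<union> ?A ?x else {})" by auto
    then show "{\<omega> \<in> space Q. 0 \<le> r \<and> (\<not> kth_hit T k (E \<omega>) \<or> kth_hit ?x k (E \<omega>))} \<in> sets Q"
      using A by simp
  qed
  also have "\<dots> = (if 0 \<le> r then 1 - enn2real (pr (kth_hit T k)) + enn2real (pr (kth_hit ?x k)) else 0)"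
  proof (cases "0 \<le> r")
    case True
    have sub: "?A ?x \<subseteq> ?A T" unfolding kth_hit_def using hit_mono[of ?x _ _ T] by auto
    have "{\<omega> \<in> space Q. 0 \<le> r \<and> (\<not> kth_hit T k (E \<omega>) \<or> kth_hit ?x k (E \<omega>))} = (space Q - ?A T) \<union> ?A ?x"
      using True by auto
    then have "Q.prob {\<omega> \<in> space Q. 0 \<le> r \<and> (\<not> kth_hit T k (E \<omega>) \<or> kth_hit ?x k (E \<omega>))}
        = Q.prob (space Q - ?A T) + Q.prob (?A ?x)"
      using A sub by (simp only:) (subst Q.finite_measure_Union, auto)
    also have "Q.prob (space Q - ?A T) = 1 - Q.prob (?A T)" by (rule Q.prob_compl[OF A(1)])
    finally show ?thesis using True A(2) by simp
  qed simp
  finally show ?thesis .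
qed

lemma kth_hit_limit: "(\<lambda>k. enn2real (pr (kth_hit x k))) \<longlonglongrightarrow> busy_total x"
proof -
  have "(\<lambda>k. \<Sum>j\<le>k. busy_mass x j) \<longlonglongrightarrow> (\<Sum>j. busy_mass x j)"
    by (rule summable_LIMSEQ') (rule summableI)
  then have "(\<lambda>k. pr (kth_hit x k)) \<longlonglongrightarrow> ennreal (busy_total x)"
    by (simp only: kth_hit_prob busy_total(1))
  from tendsto_enn2real[OF this] show ?thesis using busy_total(2)[of x] by simp
qed

lemma cdf_W_limit: "(\<lambda>n. cdf (distr Q borel (W n)) r) \<longlonglongrightarrow> limit_cdf T r"
proof (rule LIMSEQ_offset[where k=2])
  have "(\<lambda>k. cdf (distr Q borel (W (Suc (Suc k)))) r) \<longlonglongrightarrow> limit_cdf T r"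
  proof (cases "0 \<le> r")
    case True
    have "(\<lambda>k. 1 - enn2real (pr (kth_hit T k)) + enn2real (pr (kth_hit (min (ereal r) T) k)))
        \<longlonglongrightarrow> 1 - busy_total T + busy_total (min (ereal r) T)"
      by (intro tendsto_intros kth_hit_limit)
    then show ?thesis using True by (simp add: cdf_W limit_cdf_def)
  next
    case False
    then have "min (ereal r) T < 0" by (simp add: min_less_iff_disj)
    then show ?thesis using False by (simp add: cdf_W limit_cdf_def busy_total_neg)
  qed
  then show "(\<lambda>n. cdf (distr Q borel (W (n + 2))) r) \<longlonglongrightarrow> limit_cdf T r" by simp
qed

text \<open>
  Whether the first busy period reaches event \<open>n\<close> is independent of the type of this event.  So the
  expected number of arrivals in this period is \<open>p_arr\<close> times its expected number of events.
\<close>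

lemma expected_tau_eq: "expected_tau Q X Y T =
   (if busy_total T = 1 then \<infinity> else ennreal (1 + l / m / (1 - busy_total T)))"
proof -
  let ?f = "\<lambda>h. (\<Sum>n. indicator {h. in_cycle T h n \<and> fst (h n)} h) :: ennreal"
  have ind: "(indicator {h. in_cycle T h n \<and> fst (h n)} :: _ \<Rightarrow> ennreal) \<in> borel_measurable S" for n
  proof -
    have "Measurable.pred S (\<lambda>h. in_cycle T h n \<and> fst (h n))" by measurable
    then show ?thesis by (simp add: pred_def)
  qed
  have f: "?f \<in> borel_measurable S" using ind by (rule borel_measurable_suminf_order)
  have "expected_tau Q X Y T = (\<integral>\<^sup>+\<omega>. 1 + ?f (E \<omega>) \<partial>Q)"
    unfolding expected_tau_def
  proof (rule nn_integral_cong_AE)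
    show "AE \<omega> in Q. ennreal_of_enat (tau (\<lambda>i. X i \<omega>) (\<lambda>k. Y k \<omega>) T) = 1 + ?f (E \<omega>)"
      using AE_queue_path AE_completions AE_arrivals
    proof eventually_elim
      case (elim \<omega>)
      interpret queue_path "\<lambda>i. X i \<omega>" "\<lambda>k. Y k \<omega>" T by fact
      show ?case using tau_eq elim(2,3) by (simp only: input_def)
    qed
  qed
  also have "\<dots> = 1 + (\<integral>\<^sup>+\<omega>. ?f (E \<omega>) \<partial>Q)"
    using measurable_compose[OF measurable_E f] by (subst nn_integral_add) (simp_all add: Q.emeasure_space_1)
  also have "(\<integral>\<^sup>+\<omega>. ?f (E \<omega>) \<partial>Q) = (\<integral>\<^sup>+h. ?f h \<partial>distr Q S E)"
    by (rule nn_integral_distr[OF measurable_E, symmetric]) (simp only: measurable_distr_eq1 f)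
  also have "\<dots> = ennreal p_arr * (\<Sum>n. cycle_prob T n)"
    by (simp only: distr_E expected_cycle_arrivals)
  also have "1 + \<dots> = (if busy_total T = 1 then \<infinity> else ennreal (1 + l / m / (1 - busy_total T)))"
  proof (cases "busy_total T = 1")
    case True
    then show ?thesis using p_arr_pos by (simp add: cycle_length ennreal_mult_eq_top_iff)
  next
    case False
    then have lt: "0 < 1 - busy_total T" using busy_total(3)[of T] by simp
    have "p_arr * (1 / (p_comp * (1 - busy_total T))) = l / m / (1 - busy_total T)"
      using l_pos m_pos by (simp add: p_arr_def p_comp_def)
    then have "ennreal p_arr * ennreal (1 / (p_comp * (1 - busy_total T))) = ennreal (l / m / (1 - busy_total T))"
      using p_arr_pos by (subst ennreal_mult'[symmetric]) simp_all
    moreover have "1 + ennreal (l / m / (1 - busy_total T)) = ennreal (1 + l / m / (1 - busy_total T))"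
      using lt l_pos m_pos by (subst ennreal_plus) simp_all
    ultimately show ?thesis using False by (simp add: cycle_length)
  qed
  finally show ?thesis .
qed

lemma inverse_expected_tau:
  "enn2real (1 / expected_tau Q X Y T) = (1 - busy_total T) / (1 - busy_total T + l / m)"
proof (cases "busy_total T = 1")
  case True
  then show ?thesis by (simp add: expected_tau_eq)
next
  case False
  then have lt: "0 < 1 - busy_total T" using busy_total(3)[of T] by simp
  then have pos: "0 < 1 + l / m / (1 - busy_total T)" using l_pos m_pos by (intro add_pos_nonneg) simp_all
  have "1 / ennreal (1 + l / m / (1 - busy_total T)) = ennreal (1 / (1 + l / m / (1 - busy_total T)))"
    using pos by (simp add: divide_ennreal[of 1, symmetric])
  then have "enn2real (1 / expected_tau Q X Y T) = 1 / (1 + l / m / (1 - busy_total T))"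
    using False pos by (simp add: expected_tau_eq)
  also have "\<dots> = (1 - busy_total T) / (1 - busy_total T + l / m)"
    using lt l_pos m_pos by (simp add: field_simps)
  finally show ?thesis .
qed

lemma limit_law:
  assumes p: "p = enn2real (1 / expected_tau Q X Y T)"
  shows "\<exists>N. real_distribution N \<and> (AE w in N. 0 \<le> w) \<and>
      weak_conv_m (\<lambda>n. distr Q borel (W n)) N \<and>
      (\<forall>x<0. cdf N x = 0) \<and>
      (\<forall>x. T < ereal x \<longrightarrow> cdf N x = 1) \<and>
      (\<forall>x. 0 \<le> x \<and> ereal x \<le> T \<longrightarrow>
        cdf N x = 1 / norm_const l m p T *
          (p + 1 / max (l / m) 1 * (1 - p) * (LBINT t=0..ereal x. f_dens l m t)))"
proof -
  obtain N where N: "real_distribution N" "cdf N = limit_cdf T" using limit_distribution[OF T_pos] .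
  interpret N: real_distribution N by fact
  have neg: "cdf N x = 0" if "x < 0" for x
    using that by (simp add: N(2) limit_cdf_def busy_total_neg min_less_iff_disj)
  have "(cdf N \<longlongrightarrow> 0) (at_left 0)"
  proof (rule tendsto_eventually)
    show "eventually (\<lambda>x. cdf N x = 0) (at_left 0)"
      by (rule eventually_at_leftI[of "-1"]) (auto intro: neg)
  qed
  then have "measure N {..<0} = 0"
    using tendsto_unique[OF _ N.cdf_at_left[of 0]] trivial_limit_at_left_real by blast
  then have "AE w in N. 0 \<le> w"
    by (intro AE_I[where N="{..<0}"]) (auto simp: N.emeasure_eq_measure)
  moreover have "weak_conv_m (\<lambda>n. distr Q borel (W n)) N"
    unfolding weak_conv_m_def weak_conv_def N(2) using cdf_W_limit by blast
  moreover have "cdf N x = 1" if "T < ereal x" for x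
  proof -
    have "0 \<le> x" using that T_pos by (metis ereal_less_eq(5) less_imp_le less_trans)
    moreover have "min (ereal x) T = T" using that by (simp add: min_absorb2 less_imp_le)
    ultimately show ?thesis by (simp add: N(2) limit_cdf_def)
  qed
  moreover have "cdf N x = 1 / norm_const l m p T *
      (p + 1 / max (l / m) 1 * (1 - p) * (LBINT t=0..ereal x. f_dens l m t))"
    if x: "0 \<le> x" "ereal x \<le> T" for x
  proof -
    let ?r = "l / m" and ?B = "busy_total T"
    have r: "0 < ?r" using l_pos m_pos by simp
    have pos: "0 < 1 - ?B + ?r" using busy_total(3)[of T] r by simp
    have p_eq: "p = (1 - ?B) / (1 - ?B + ?r)" unfolding p by (rule inverse_expected_tau)
    have q_eq: "1 - p = ?r / (1 - ?B + ?r)" using pos unfolding p_eq by (simp add: field_simps)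
    have bracket: "p + 1 / max ?r 1 * (1 - p) * (LBINT t=0..z. f_dens l m t) = (1 - ?B + busy_total z) / (1 - ?B + ?r)"
      if "0 \<le> z" for z
    proof -
      have "1 / max ?r 1 * (1 - p) * (LBINT t=0..z. f_dens l m t) = (1 - p) / ?r * busy_total z"
      proof -
        have "1 / K * (1 - p) * (K / ?r * busy_total z) = (1 - p) / ?r * busy_total z" if "K \<noteq> 0" for K
          using that by simp
        from this[of "max ?r 1"] r show ?thesis unfolding interval_integral_f_dens[OF \<open>0 \<le> z\<close>] by linarith
      qed
      also have "\<dots> = busy_total z / (1 - ?B + ?r)" unfolding q_eq using l_pos m_pos by simp
      finally show ?thesis unfolding p_eq by (simp add: add_divide_distrib)
    qed
    have "norm_const l m p T = 1 / (1 - ?B + ?r)"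
      unfolding norm_const_def F_bracket_def using bracket[of T] T_pos by simp
    moreover have "cdf N x = 1 - ?B + busy_total (ereal x)"
      using x by (simp add: N(2) limit_cdf_def min_def)
    ultimately show ?thesis using bracket[of "ereal x"] x(1) pos by simp
  qed
  ultimately show ?thesis using N(1) neg by blast
qed

end

theorem theorem1p2:
  fixes l m :: real and T :: ereal
    and P :: "'a measure" and X Y :: "nat \<Rightarrow> 'a \<Rightarrow> real"
    and W :: "nat \<Rightarrow> 'a \<Rightarrow> real" and M :: ennreal and p :: real
  assumes "0 < l" and "0 < m" and "0 < T"
    and "prob_space P"
    and "prob_space.indep_vars P (\<lambda>_. borel) (case_sum X Y) ({1..} <+> {1..})"
    and "\<And>i. 1 \<le> i \<Longrightarrow> distributed P lborel (X i) (exponential_density l)"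
    and "\<And>k. 1 \<le> k \<Longrightarrow> distributed P lborel (Y k) (exponential_density m)"
    and W_def: "W = (\<lambda>n \<omega>. served_wait (\<lambda>i. X i \<omega>) (\<lambda>k. Y k \<omega>) T n)"
    and M_def: "M = expected_tau P X Y T"
    and p_def: "p = enn2real (1 / M)"
  shows "(\<forall>n\<ge>1. W n \<in> borel_measurable P) \<and>
    (\<exists>N. real_distribution N \<and> (AE w in N. 0 \<le> w) \<and>
      weak_conv_m (\<lambda>n. distr P borel (W n)) N \<and>
      (\<forall>x<0. cdf N x = 0) \<and>
      (\<forall>x. T < ereal x \<longrightarrow> cdf N x = 1) \<and>
      (\<forall>x. 0 \<le> x \<and> ereal x \<le> T \<longrightarrow>
        cdf N x = 1 / norm_const l m p T *
          (p + 1 / max (l / m) 1 * (1 - p) * (LBINT t=0..ereal x. f_dens l m t))))"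
proof -
  interpret prob_space P by fact
  interpret R: queue l m P X Y T
    by (intro queue.intro race.intro queue_axioms.intro) fact+
  have W: "W = R.W" by (simp add: W_def R.W_def fun_eq_iff)
  have "p = enn2real (1 / expected_tau P X Y T)" unfolding p_def M_def ..
  from R.limit_law[OF this] show ?thesis unfolding W using R.measurable_W by blast
qed

end
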